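(* Let $A_i\in\mathbb{C}_{\rm H}^{m_i}$ and $B_i\in\mathbb{C}^{m_i\times n}$ be given for $i=1,2$, and let $$M=\begin{bmatrix} A_1 & 0 & B_1\\ 0 & -A_2 & B_2\\ B_1^{*} & B_2^{*} & 0\end{bmatrix},\quad N=\begin{bmatrix} A_1 & B_1 & 0\\ B_1^{*} & 0 & B_2^{*}\end{bmatrix},\quad M_1=\begin{bmatrix} A_1 & B_1\\ B_1^{*} & 0\end{bmatrix}.$$ Assume that there exists $X\in\mathbb{C}_{\rm H}^{n}$ such that $B_2XB_2^{*}\succcurlyeq A_2$, i.e., $i_{-}\begin{bmatrix} A_2 & B_2\\ B_2^{*} & 0\end{bmatrix}=r[\,A_2,\,B_2\,]$, and let ${\cal T}_1=\{X\in\mathbb{C}_{\rm H}^{n} \mid B_2XB_2^{*}\succcurlyeq A_2\}$. Then $$\max_{X\in{\cal T}_1} r(A_1-B_1XB_1^{*}) = r[\,A_1,\,B_1\,],$$ $$\min_{X\in{\cal T}_1} r(A_1-B_1XB_1^{*}) = 2r[\,A_1,\,B_1\,]+i_{-}(M)-i_{-}(M_1)-r(N),$$ $$\max_{X\in{\cal T}_1} i_{+}(A_1-B_1XB_1^{*}) = i_{+}(M)-r[\,A_2,\,B_2\,],$$ $$\min_{X\in{\cal T}_1} i_{+}(A_1-B_1XB_1^{*}) = r[\,A_1,\,B_1\,]-i_{-}(M_1),$$ $$\max_{X\in{\cal T}_1} i_{-}(A_1-B_1XB_1^{*}) = i_{-}(M_1),$$ $$\min_{X\in{\cal T}_1} i_{-}(A_1-B_1XB_1^{*})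 = r[\,A_1,\,B_1\,]-r(N)+i_{-}(M).$$ In consequence, the following hold. (a) There exists $X\in{\cal T}_1$ such that $A_1-B_1XB_1^{*}$ is nonsingular if and only if $r[\,A_1,\,B_1\,]=m_1$. (b) $A_1-B_1XB_1^{*}$ is nonsingular for every $X\in{\cal T}_1$ if and only if $i_{-}(M)=i_{-}(M_1)+r(N)-m_1$. (c) There exists $X\in{\cal T}_1$ such that $B_1XB_1^{*}=A_1$ if and only if ${\mathscr R}(A_1)\subseteq{\mathscr R}(B_1)$ and $i_{-}(M)=r\begin{bmatrix} B_1\\ B_2\end{bmatrix}$. (d) There exists $X\in{\cal T}_1$ such that $B_1XB_1^{*}\prec A_1$ if and only if $i_{+}(M)=r[\,A_2,\,B_2\,]+m_1$. (e) There exists $X\in{\cal T}_1$ such that $B_1XB_1^{*}\succ A_1$ if and only if $i_{-}(M_1)=m_1$. (f) There exists $X\in{\cal T}_1$ such that $B_1XB_1^{*}\preccurlyeq A_1$ if and only if $i_{-}(M)=r(N)-r[\,A_1,\,B_1\,]$. (g) There exists $X\in{\cal T}_1$ such that $B_1XB_1^{*}\succcurlyeq A_1$ if and only if $i_{-}(M_1)=r[\,A_1,\,B_1\,]$. (h) $B_1XB_1^{*}\succcurlyeq A_1$ holds for all $X\in{\cal T}_1$, i.e., ${\cal T}_1\subseteq\{X\in\mathbb{C}_{\rm H}^{n}\mid B_1XB_1^{*}\succcurlyeq A_1\}$, if and only if $i_{+}(M)=r[\,A_2,\,B_2\,]$. (i) $r(A_1-B_1XB_1^{*})$ takes the same value for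 all $X\in{\cal T}_1$ if and only if $i_{-}(M)=i_{-}(M_1)+r(N)-r[\,A_1,\,B_1\,]$. (j) $i_{+}(A_1-B_1XB_1^{*})$ takes the same value for all $X\in{\cal T}_1$ if and only if $i_{+}(M)+i_{-}(M_1)=r[\,A_1,\,B_1\,]+r[\,A_2,\,B_2\,]$. (k) $i_{-}(A_1-B_1XB_1^{*})$ takes the same value for all $X\in{\cal T}_1$ if and only if $i_{-}(M_1)+r(N)=r[\,A_1,\,B_1\,]+i_{-}(M)$. (l) If there exist $X_1,X_2\in\mathbb{C}_{\rm H}^{n}$ such that $B_1X_1B_1^{*}=A_1$ and $B_2X_2B_2^{*}=A_2$, respectively, i.e., ${\mathscr R}(A_1)\subseteq{\mathscr R}(B_1)$ and ${\mathscr R}(A_2)\subseteq{\mathscr R}(B_2)$, then $$\max_{X\in{\cal T}_1} r(A_1-B_1XB_1^{*})=r(B_1),\qquad \min_{X\in{\cal T}_1} r(A_1-B_1XB_1^{*})=i_{-}(M)-r\begin{bmatrix} B_1\\ B_2\end{bmatrix},$$ $$\max_{X\in{\cal T}_1} i_{+}(A_1-B_1XB_1^{*})=i_{+}(M)-r(B_2),\qquad \min_{X\in{\cal T}_1} i_{+}(A_1-B_1XB_1^{*})=0,$$ $$\max_{X\in{\cal T}_1} i_{-}(A_1-B_1XB_1^{*})=r(B_1),\qquad \min_{X\in{\cal T}_1} i_{-}(A_1-B_1XB_1^{*})=i_{-}(M)-r\begin{bmatrix} B_1\\ B_2\end{bmatrix}.$$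
   Context: $\mathbb{C}^{m\times n}$ is the set of $m\times n$ complex matrices and $\mathbb{C}_{\rm H}^{m}$ is the set of $m\times m$ complex Hermitian matrices. $r(\cdot)$ is rank, ${\mathscr R}(\cdot)$ is range (column space), $A^{*}$ is the conjugate transpose. $i_{+}(A)$ and $i_{-}(A)$ are the numbers of positive and negative eigenvalues of a Hermitian matrix $A$, counted with multiplicity. $[\,A,\,B\,]$ is the row block matrix. For Hermitian $P,Q$, $P\succcurlyeq Q$ ($P\succ Q$) means $P-Q$ is positive semi-definite (positive definite); $P\preccurlyeq Q$ ($P\prec Q$) means $Q\succcurlyeq P$ ($Q\succ P$).
   Formalization: In (b) the condition r[A1,B1]=m1 is added to the right-hand side; as printed, (b) fails for A1=diag(1,0), B1=(1,0)^T, A2=0, B2=0, where the equation holds but A1-B1XB1* is always singular. *)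

theory Defs
  imports
    "Jordan_Normal_Form.Matrix"
    "Jordan_Normal_Form.Char_Poly"
    "Jordan_Normal_Form.DL_Rank"
    "Jordan_Normal_Form.Schur_Decomposition"
begin

abbreviation mat_rank :: "complex mat \<Rightarrow> nat" where
  "mat_rank A \<equiv> vec_space.rank (dim_row A) A"

abbreviation mat_range :: "complex mat \<Rightarrow> complex vec set" where
  "mat_range A \<equiv> vec_space.col_space (dim_row A) A"

definition hermitian_mats :: "nat \<Rightarrow> complex mat set" where
  "hermitian_mats m = {A \<in> carrier_mat m m. mat_adjoint A = A}"

(* Multiplicity is the multiplicity as a root of the characteristic polynomial. The real
   eigenvalues are all of them for Hermitian A, the only matrices the inertia is used for. *)
definition pos_inertia :: "complex mat \<Rightarrow> nat" where
  "pos_inertia A =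
     (\<Sum>t \<in> {t::real. eigenvalue A (complex_of_real t) \<and> t > 0}.
        order (complex_of_real t) (char_poly A))"

definition neg_inertia :: "complex mat \<Rightarrow> nat" where
  "neg_inertia A =
     (\<Sum>t \<in> {t::real. eigenvalue A (complex_of_real t) \<and> t < 0}.
        order (complex_of_real t) (char_poly A))"

(* For Hermitian A the scalar v^* A v is real, so taking its real part loses nothing. *)
definition pos_semidef :: "complex mat \<Rightarrow> bool" where
  "pos_semidef A \<longleftrightarrow> A \<in> hermitian_mats (dim_row A) \<and>
     (\<forall>v \<in> carrier_vec (dim_row A). 0 \<le> Re ((A *\<^sub>v v) \<bullet>c v))"

definition pos_def :: "complex mat \<Rightarrow> bool" where
  "pos_def A \<longleftrightarrow> A \<in> hermitian_mats (dim_row A) \<and>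
     (\<forall>v \<in> carrier_vec (dim_row A). v \<noteq> 0\<^sub>v (dim_row A) \<longrightarrow> 0 < Re ((A *\<^sub>v v) \<bullet>c v))"

definition loewner_ge :: "complex mat \<Rightarrow> complex mat \<Rightarrow> bool" (infix \<open>\<succeq>\<^sub>L\<close> 50) where
  "P \<succeq>\<^sub>L Q \<longleftrightarrow> pos_semidef (P - Q)"

definition loewner_gt :: "complex mat \<Rightarrow> complex mat \<Rightarrow> bool" (infix \<open>\<succ>\<^sub>L\<close> 50) where
  "P \<succ>\<^sub>L Q \<longleftrightarrow> pos_def (P - Q)"

abbreviation loewner_le :: "complex mat \<Rightarrow> complex mat \<Rightarrow> bool" (infix \<open>\<preceq>\<^sub>L\<close> 50) where
  "P \<preceq>\<^sub>L Q \<equiv> Q \<succeq>\<^sub>L P"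

abbreviation loewner_lt :: "complex mat \<Rightarrow> complex mat \<Rightarrow> bool" (infix \<open>\<prec>\<^sub>L\<close> 50) where
  "P \<prec>\<^sub>L Q \<equiv> Q \<succ>\<^sub>L P"

(* The row block matrix [A, B]; the column block matrix is append_rows, written @\<^sub>r. *)
definition append_cols :: "'a :: zero mat \<Rightarrow> 'a mat \<Rightarrow> 'a mat" (infixr \<open>@\<^sub>c\<close> 65) where
  "A @\<^sub>c B = four_block_mat A B (0\<^sub>m 0 (dim_col A)) (0\<^sub>m 0 (dim_col B))"

(* Attained extrema. The value is an integer because the formulas for it contain subtractions,
   which would be truncated on nat. *)
definition has_max_on :: "('a \<Rightarrow> nat) \<Rightarrow> 'a set \<Rightarrow> int \<Rightarrow> bool" where
  "has_max_on f S v \<longleftrightarrow> (\<exists>x\<in>S. int (f x) = v) \<and> (\<forall>x\<in>S. int (f x) \<le> v)"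

definition has_min_on :: "('a \<Rightarrow> nat) \<Rightarrow> 'a set \<Rightarrow> int \<Rightarrow> bool" where
  "has_min_on f S v \<longleftrightarrow> (\<exists>x\<in>S. int (f x) = v) \<and> (\<forall>x\<in>S. v \<le> int (f x))"

end

theory Submission
  imports Defs "HOL-Library.Function_Algebras"
begin

text \<open>
  Write \<open>a1\<close>, \<open>a2\<close> and \<open>x\<close> for the Hermitian forms of \<open>A1\<close>, \<open>A2\<close> and \<open>X\<close>, and \<open>\<beta>1\<close>, \<open>\<beta>2\<close> for the adjoints
  of \<open>B1\<close>, \<open>B2\<close>, so that \<open>A1 - B1 X B1*\<close> is the form \<open>a1 - x(\<beta>1, \<beta>1)\<close>. A Schur complement turns the
  constraint into \<open>x \<ge> s\<close> on the range \<open>V\<close> of \<open>\<beta>2\<close>, for a fixed form \<open>s\<close>. Hence the admissible values of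
  \<open>a1 - x(\<beta>1, \<beta>1)\<close> are the forms \<open>g\<close> that agree with \<open>a1\<close> on \<open>K \<times> \<complex>\<^sup>m\<close>, where \<open>K\<close> is the kernel of \<open>\<beta>1\<close>,
  and satisfy \<open>g \<le> a1 - s(\<beta>1, \<beta>1)\<close> on the preimage of \<open>V\<close> under \<open>\<beta>1\<close>. Bounds for the inertia of \<open>g\<close>
  follow by counting dimensions of semidefinite subspaces. Making \<open>g\<close> very negative off \<open>K\<close> gives the
  maximal rank and negative inertia; making it very positive off the preimage of \<open>V\<close> gives the maximal
  positive and the minimal negative inertia, and from the latter form a positive semidefinite part can
  still be removed until the positive inertia is minimal too, so both minima are attained together.
  A bordered matrix \<open>[A, B; B*, 0]\<close> has the inertia of \<open>A\<close> on the kernel of \<open>B*\<close>, shifted by the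
  rank of \<open>B\<close>, which translates these numbers into the inertias of \<open>M\<close> and \<open>M1\<close>.
\<close>

section \<open>Finite-dimensional subspaces\<close>

text \<open>An index is the largest dimension of a positive subspace, so every bound is a dimension
  count, and eigenvalues enter only in \<open>inertia_eq_index\<close>. The obstacle is degeneracy.
  A subspace on which the form is merely nonnegative must be counted too, and
  \<open>dim_nonneg_le\<close> charges it only for its overlap with the radical. This is where
  \<open>r(N)\<close> and \<open>r[A1, B1]\<close> come from: \<open>K\<close> meets the radical of
  the constrained form on the preimage of \<open>V\<close> in dimension \<open>k2\<close>, but only
  \<open>k1\<close> of these dimensions are null on the whole space for every \<open>X\<close>, and
  each of the remaining \<open>k2 - k1\<close> costs one negative direction. That this cost suffices
  is not shown by minimizing the negative index directly; the positive index and the radical are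
  made large at the same time, and \<open>inertia_sum\<close> leaves no room for more. On the side
  of \<open>M\<close>, the kernel of the adjoint of \<open>[B1; B2]\<close> splits orthogonally into
  a copy of that preimage and the kernel of the adjoint of \<open>B2\<close>. Feasibility makes the
  form of \<open>A2\<close> negative on the latter up to null vectors of \<open>A2\<close>, so it
  enters \<open>i+\<close> of \<open>M\<close> through \<open>r[A2, B2]\<close> and
  \<open>i-\<close> not at all.\<close>

locale complex_vector_space = vector_space scale
  for scale :: "complex \<Rightarrow> 'b::ab_group_add \<Rightarrow> 'b" (infixr \<open>*s\<close> 75)
begin

abbreviation lin :: "('b \<Rightarrow> 'b) \<Rightarrow> bool" where
  "lin f \<equiv> Vector_Spaces.linear scale scale f"

text \<open>The ambient type will be \<open>nat => complex\<close>, which has infinite dimension.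
  Finiteness is therefore a property of subspaces and is carried along as a hypothesis.\<close>

definition fin_dim :: "'b set \<Rightarrow> bool" where
  "fin_dim S \<longleftrightarrow> (\<exists>B. finite B \<and> S \<subseteq> span B)"

definition subspace_sum :: "'b set \<Rightarrow> 'b set \<Rightarrow> 'b set" (infixl \<open>\<oplus>\<^sub>s\<close> 65) where
  "S \<oplus>\<^sub>s T = {x + y |x y. x \<in> S \<and> y \<in> T}"

lemma fin_dim_subset: "fin_dim T \<Longrightarrow> S \<subseteq> T \<Longrightarrow> fin_dim S"
  unfolding fin_dim_def by blast

lemma independent_imp_finite:
  "independent B \<Longrightarrow> B \<subseteq> S \<Longrightarrow> fin_dim S \<Longrightarrow> finite B"
  unfolding fin_dim_def using independent_span_bound by blast

lemma finite_basis:
  assumes "subspace S" "fin_dim S"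
  obtains B where "finite B" "independent B" "B \<subseteq> S" "span B = S" "card B = dim S"
  by (metis assms basis_exists independent_imp_finite span_subspace)

lemma card_le_dim: 
  assumes "independent B" "B \<subseteq> S" "fin_dim S"
  shows "card B \<le> dim S"
proof -
  obtain C where C: "B \<subseteq> C" "C \<subseteq> S" "independent C" "S \<subseteq> span C"
    using maximal_independent_subset_extend[OF assms(2,1)] by blast
  then have "card C = dim S" by (simp add: basis_card_eq_dim)
  moreover have "finite C" using C assms(3) independent_imp_finite by blast
  ultimately show ?thesis using C card_mono by metis
qed

lemma dim_subspace_mono:
  assumes "S \<subseteq> T" "fin_dim T" shows "dim S \<le> dim T"
  by (metis assms basis_exists card_le_dim order_trans)

lemma subspace_sum_subspace: "subspace S \<Longrightarrow> subspace T \<Longrightarrow> subspace (S \<oplus>\<^sub>s T)"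
  unfolding subspace_sum_def by (rule subspace_sums)

lemma subspace_sum_subset:
  "subspace W \<Longrightarrow> S \<subseteq> W \<Longrightarrow> T \<subseteq> W \<Longrightarrow> S \<oplus>\<^sub>s T \<subseteq> W"
  unfolding subspace_sum_def using subspace_add by blast

lemma subspace_sumE:
  assumes "x \<in> S \<oplus>\<^sub>s T" obtains y z where "x = y + z" "y \<in> S" "z \<in> T"
  using assms unfolding subspace_sum_def by blast

lemma subspace_sumI: "y \<in> S \<Longrightarrow> z \<in> T \<Longrightarrow> y + z \<in> S \<oplus>\<^sub>s T"
  unfolding subspace_sum_def by blast

lemma subspace_sum_left: "subspace T \<Longrightarrow> S \<subseteq> S \<oplus>\<^sub>s T"
  using subspace_sumI[of _ S 0 T] subspace_0 by fastforce

lemma subspace_sum_right: "subspace S \<Longrightarrow> T \<subseteq> S \<oplus>\<^sub>s T"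
  using subspace_sumI[of 0 S _ T] subspace_0 by fastforce

lemma span_sum_span: "span (B \<union> C) = span B \<oplus>\<^sub>s span C"
  unfolding subspace_sum_def by (rule span_Un)

lemma dim_subspace_sum:
  assumes "subspace S" "subspace T" "fin_dim S" "fin_dim T" "S \<inter> T \<subseteq> {0}"
  shows "dim (S \<oplus>\<^sub>s T) = dim S + dim T"
proof -
  obtain B where B: "finite B" "independent B" "B \<subseteq> S" "span B = S" "card B = dim S"
    using finite_basis[OF assms(1,3)] .
  obtain C where C: "finite C" "independent C" "C \<subseteq> T" "span C = T" "card C = dim T"
    using finite_basis[OF assms(2,4)] .
  have "0 \<notin> B" using B(2) dependent_zero by blast
  with B C assms(5) have dis: "B \<inter> C = {}" by auto
  have "independent (B \<union> C)"
  proof (rule independent_if_scalars_zero)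
    show "finite (B \<union> C)" using B C by simp
    fix u x assume z: "(\<Sum>x\<in>B \<union> C. u x *s x) = 0" and x: "x \<in> B \<union> C"
    have "(\<Sum>x\<in>B. u x *s x) + (\<Sum>x\<in>C. u x *s x) = 0"
      using z sum.union_disjoint[OF B(1) C(1) dis] by metis
    then have e: "(\<Sum>x\<in>B. u x *s x) = - (\<Sum>x\<in>C. u x *s x)"
      by (simp add: eq_neg_iff_add_eq_0)
    have "(\<Sum>x\<in>B. u x *s x) \<in> S" "- (\<Sum>x\<in>C. u x *s x) \<in> T"
      using B(3) C(3) assms(1,2) by (auto intro!: subspace_sum subspace_scale subspace_neg)
    with e assms(5) have "(\<Sum>x\<in>B. u x *s x) = 0" "(\<Sum>x\<in>C. u x *s x) = 0" by auto
    then show "u x = 0" using independentD[OF B(2) B(1) order_refl] independentD[OF C(2) C(1) order_refl] x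
      by blast
  qed
  moreover have "span (B \<union> C) = S \<oplus>\<^sub>s T" using B C span_sum_span by simp
  ultimately have "dim (S \<oplus>\<^sub>s T) = card (B \<union> C)"
    by (metis dim_span_eq_card_independent)
  then show ?thesis using B C card_Un_disjoint[OF B(1) C(1) dis] by simp
qed

text \<open>A basis of \<open>S\<close> is extended to one of \<open>T\<close>; the added vectors
  span the complement.\<close>

lemma complement_exists:
  assumes "subspace S" "subspace T" "S \<subseteq> T"
  obtains C where "subspace C" "C \<subseteq> T" "S \<inter> C = {0}" "S \<oplus>\<^sub>s C = T"
proof -
  obtain B where B: "B \<subseteq> S" "independent B" "S \<subseteq> span B"
    using maximal_independent_subset by blast
  have sB: "span B = S" using B assms(1) span_subspace by blast
  obtain D where D: "B \<subseteq> D" "D \<subseteq> T" "independent D" "T \<subseteq> span D"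
    using maximal_independent_subset_extend[of B T] B assms by blast
  have sD: "span D = T" using D assms(2) span_subspace by blast
  let ?C = "span (D - B)"
  have "S \<inter> ?C = {0}"
  proof -
    interpret vector_space_pair scale scale by unfold_locales
    \<comment> \<open>\<open>g\<close> fixes the basis of \<open>S\<close> and kills the added
      vectors, so a common vector of both spans equals its own image 0.\<close>
    obtain g where g: "lin g" "\<And>x. x \<in> D \<Longrightarrow> g x = (if x \<in> B then x else 0)"
      using linear_independent_extend[OF D(3), of "\<lambda>x. if x \<in> B then x else 0"] by blast
    interpret g: Vector_Spaces.linear scale scale g by (rule g)
    have "x = 0" if x: "x \<in> span B" "x \<in> ?C" for x
    proof -
      have "g x = 0" using x(2) by (rule g.eq_0_on_span[rotated]) (use g in auto)
      moreover have "g x = x"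
        using x(1)
      proof (induction rule: span_induct_alt)
        case (step c y z)
        then show ?case using g(2)[of y] D(1) by (auto simp: g.add g.scale)
      qed (simp add: g.zero)
      ultimately show ?thesis by simp
    qed
    then show ?thesis using sB span_zero subspace_0[OF assms(1)] by blast
  qed
  moreover have "S \<oplus>\<^sub>s ?C = T"
    using span_sum_span[of B "D - B"] D(1) sB sD by (simp add: Un_absorb1)
  moreover have "?C \<subseteq> T" using sD span_mono[of "D - B" D] by blast
  ultimately show thesis using that[of ?C] by simp
qed

lemma subspace_zero_dim: "subspace S \<Longrightarrow> fin_dim S \<Longrightarrow> dim S = 0 \<Longrightarrow> S = {0}"
  by (rule finite_basis) auto

lemma dim_zero_subspace [simp]: "dim {0} = 0"
  using dim_span_eq_card_independent[OF independent_empty] by simp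

lemma dim_complement:
  assumes "subspace S" "subspace C" "fin_dim T" "S \<inter> C = {0}" "S \<oplus>\<^sub>s C = T"
  shows "dim T = dim S + dim C"
proof -
  have "S \<subseteq> T" "C \<subseteq> T" using subspace_sum_left[OF assms(2)] subspace_sum_right[OF assms(1)] assms(5) by auto
  then show ?thesis
    using dim_subspace_sum[OF assms(1,2)] fin_dim_subset[OF assms(3)] assms(4,5) by blast
qed

lemma dim_subspace_eq:
  assumes "subspace S" "subspace T" "S \<subseteq> T" "fin_dim T" "dim T \<le> dim S"
  shows "S = T"
proof -
  obtain C where C: "subspace C" "C \<subseteq> T" "S \<inter> C = {0}" "S \<oplus>\<^sub>s C = T"
    using complement_exists[OF assms(1-3)] .
  then have "dim C = 0" using dim_complement[OF assms(1) C(1) assms(4) C(3,4)] assms(5) by simp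
  then have "C = {0}" using subspace_zero_dim C assms(4) fin_dim_subset by blast
  then have "T \<subseteq> S" using C(4) subspace_sum_subset[of S S C] subspace_0 assms(1) by auto
  then show ?thesis using assms(3) by blast
qed

text \<open>A complement of \<open>S \<inter> T\<close> inside \<open>S\<close> is independent of
  \<open>T\<close>, so it fits next to \<open>T\<close> in \<open>W\<close>.\<close>

lemma dim_Int_ge:
  assumes "subspace S" "subspace T" "subspace W" "S \<subseteq> W" "T \<subseteq> W" "fin_dim W"
  shows "dim S + dim T \<le> dim W + dim (S \<inter> T)"
proof -
  obtain C where C: "subspace C" "C \<subseteq> S" "(S \<inter> T) \<inter> C = {0}" "(S \<inter> T) \<oplus>\<^sub>s C = S"
    using complement_exists[OF subspace_inter[OF assms(1,2)] assms(1) Int_lower1] .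
  have f: "fin_dim S" "fin_dim T" using fin_dim_subset[OF assms(6)] assms(4,5) by auto
  have fC: "fin_dim C" using fin_dim_subset[OF f(1) C(2)] .
  have 1: "dim S = dim (S \<inter> T) + dim C"
    using dim_complement[OF subspace_inter[OF assms(1,2)] C(1) f(1) C(3,4)] .
  have 2: "dim (C \<oplus>\<^sub>s T) = dim C + dim T"
    using dim_subspace_sum[OF C(1) assms(2) fC f(2)] C(2,3) by blast
  have "C \<oplus>\<^sub>s T \<subseteq> W" using subspace_sum_subset[OF assms(3) _ assms(5)] C(2) assms(4) by blast
  then have "dim (C \<oplus>\<^sub>s T) \<le> dim W" using dim_subspace_mono assms(6) by blast
  then show ?thesis using 1 2 by simp
qed

lemma linearI':
  "(\<And>x y. f (x + y) = f x + f y) \<Longrightarrow> (\<And>c x. f (c *s x) = c *s f x) \<Longrightarrow> lin f"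
  unfolding Vector_Spaces.linear_iff using vector_space_axioms by blast

lemma dim_image_inj:
  assumes f: "lin f" and S: "subspace S" and i: "\<And>x. x \<in> S \<Longrightarrow> f x = 0 \<Longrightarrow> x = 0"
  shows "dim (f ` S) = dim S"
proof -
  interpret f: Vector_Spaces.linear scale scale f by (rule f)
  obtain B where B: "B \<subseteq> S" "independent B" "S \<subseteq> span B" "card B = dim S" using basis_exists .
  have sB: "span B = S" using B S span_subspace by blast
  have inj: "inj_on f (span B)" using f.inj_on_iff_eq_0[of "span B"] i sB S by auto
  have "independent (f ` B)" using f.independent_injective_image[OF B(2) inj] .
  moreover have "span (f ` B) = f ` S" using f.span_image sB by simp
  ultimately have "dim (f ` S) = card (f ` B)" by (metis dim_span_eq_card_independent)
  moreover have "inj_on f B" using inj inj_on_subset span_superset by blast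
  ultimately show ?thesis using B card_image by metis
qed

lemma fin_dim_image:
  assumes f: "lin f" and "fin_dim S" shows "fin_dim (f ` S)"
proof -
  interpret f: Vector_Spaces.linear scale scale f by (rule f)
  obtain B where "finite B" "S \<subseteq> span B" using assms(2) fin_dim_def by blast
  then have "finite (f ` B)" "f ` S \<subseteq> span (f ` B)" using f.span_image by auto
  then show ?thesis unfolding fin_dim_def by blast
qed

lemma subspace_kernel_on:
  assumes f: "lin f" and S: "subspace S"
  shows "subspace {x \<in> S. f x = 0}"
proof -
  interpret f: Vector_Spaces.linear scale scale f by (rule f)
  have "{x \<in> S. f x = 0} = S \<inter> {x. f x = 0}" by blast
  then show ?thesis using S subspace_inter f.subspace_kernel by metis
qed

text \<open>On a complement of the kernel \<open>f\<close> is injective and has the same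
  image.\<close>

lemma rank_nullity:
  assumes f: "lin f" and S: "subspace S" "fin_dim S"
  shows "dim S = dim {x \<in> S. f x = 0} + dim (f ` S)"
proof -
  interpret f: Vector_Spaces.linear scale scale f by (rule f)
  let ?K = "{x \<in> S. f x = 0}"
  have K: "subspace ?K" using subspace_kernel_on[OF f S(1)] .
  obtain C where C: "subspace C" "C \<subseteq> S" "?K \<inter> C = {0}" "?K \<oplus>\<^sub>s C = S"
    using complement_exists[OF K S(1) Collect_restrict] .
  have "f ` C = f ` S"
  proof
    show "f ` S \<subseteq> f ` C"
    proof
      fix y assume "y \<in> f ` S"
      then obtain x where "y = f x" "x \<in> S" by blast
      moreover have "x \<in> ?K \<oplus>\<^sub>s C" using C(4) \<open>x \<in> S\<close> by simp
      then obtain a b where "x = a + b" "a \<in> ?K" "b \<in> C" by (rule subspace_sumE)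
      ultimately have "y = f b" using f.add[of a b] by simp
      then show "y \<in> f ` C" using \<open>b \<in> C\<close> by simp
    qed
  qed (use C in blast)
  moreover have "x = 0" if "x \<in> C" "f x = 0" for x
    using that C(2,3) by (auto simp: set_eq_iff)
  then have "dim (f ` C) = dim C" using dim_image_inj[OF f C(1)] by simp
  ultimately show ?thesis using dim_complement[OF K C(1) S(2) C(3,4)] by simp
qed

lemma projection_exists:
  assumes "subspace S" "subspace T" "S \<inter> T = {0}" "S \<oplus>\<^sub>s T = UNIV"
  obtains p where "lin p" "\<And>x. p x \<in> S" "\<And>x. x - p x \<in> T"
    "\<And>x. x \<in> S \<Longrightarrow> p x = x" "\<And>x. x \<in> T \<Longrightarrow> p x = 0"
proof -
  have ex: "\<exists>y. y \<in> S \<and> x - y \<in> T" for x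
    using assms(4) subspace_sumE[of x S T] by (metis UNIV_I add_diff_cancel_left')
  define p where "p x = (SOME y. y \<in> S \<and> x - y \<in> T)" for x
  have p: "p x \<in> S" "x - p x \<in> T" for x
    using someI_ex[OF ex[of x]] unfolding p_def by auto
  have uni: "p x = y" if "y \<in> S" "x - y \<in> T" for x y
  proof -
    have "p x - y \<in> S" using p(1) that(1) assms(1) subspace_diff by blast
    moreover have "p x - y = (x - y) - (x - p x)" by simp
    then have "p x - y \<in> T" using p(2)[of x] that(2) assms(2) subspace_diff by metis
    ultimately have "p x - y \<in> {0}" unfolding assms(3)[symmetric] by (rule IntI)
    then show ?thesis by simp
  qed
  have "p (x + y) = p x + p y" for x y
  proof (rule uni)
    show "p x + p y \<in> S" using p(1) assms(1) subspace_add by blast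
    have "x + y - (p x + p y) = (x - p x) + (y - p y)" by simp
    then show "x + y - (p x + p y) \<in> T" using subspace_add[OF assms(2) p(2)[of x] p(2)[of y]] by (simp only:)
  qed
  moreover have "p (c *s x) = c *s p x" for c x
  proof (rule uni)
    show "c *s p x \<in> S" using p(1) assms(1) subspace_scale by blast
    show "c *s x - c *s p x \<in> T" using subspace_scale[OF assms(2) p(2), of c x] by (simp add: scale_right_diff_distrib)
  qed
  ultimately have "lin p" by (rule linearI')
  moreover have "p x = x" if "x \<in> S" for x using uni[OF that, of x] subspace_0[OF assms(2)] by simp
  moreover have "p x = 0" if "x \<in> T" for x using uni[of 0 x] that subspace_0[OF assms(1)] by simp
  ultimately show thesis using p by (intro that)
qed

text \<open>The values stay in \<open>S\<close> even off the image, so forms can be pulled back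
  along \<open>g\<close> without side conditions.\<close>

lemma linear_section:
  assumes f: "lin f" and S: "subspace S"
  obtains g where "lin g" "\<And>x. g x \<in> S" "\<And>y. y \<in> f ` S \<Longrightarrow> f (g y) = y"
proof -
  interpret vector_space_pair scale scale by unfold_locales
  obtain g where g: "g ` UNIV \<subseteq> S" "lin g" "\<forall>v\<in>f ` S. f (g v) = v"
    using linear_exists_right_inverse_on[OF f S] by (elim exE conjE)
  have "g x \<in> S" for x using g(1) by blast
  then show thesis using that[OF g(2)] bspec[OF g(3)] by simp
qed

lemma linear_left_inverse:
  assumes f: "lin f" and S: "subspace S"
    and i: "\<And>x. x \<in> S \<Longrightarrow> f x = 0 \<Longrightarrow> x = 0"
  obtains g where "lin g" "\<And>x. g x \<in> S" "\<And>y. y \<in> S \<Longrightarrow> g (f y) = y"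
proof -
  interpret vector_space_pair scale scale by unfold_locales
  interpret f: Vector_Spaces.linear scale scale f by (rule f)
  have "inj_on f S" using f.inj_on_iff_eq_0[OF S] i by auto
  from linear_exists_left_inverse_on[OF f S this]
  obtain g where g: "g ` UNIV \<subseteq> S" "lin g" "\<forall>v\<in>S. g (f v) = v" by (elim exE conjE)
  have "g x \<in> S" for x using g(1) by blast
  then show thesis using that[OF g(2)] bspec[OF g(3)] by simp
qed

text \<open>\<open>S\<close> and \<open>T\<close> need not fill the space. A complement of their sum
  is put into the kernel, which keeps \<open>p\<close> a total linear map at the price that
  \<open>x - p x\<close> is known to lie in \<open>S\<close> only on the sum.\<close>

lemma projection_along:
  assumes S: "subspace S" and T: "subspace T" and ST: "S \<inter> T = {0}"
  obtains p where "lin p" "\<And>x. p x \<in> T" "\<And>x. x \<in> T \<Longrightarrow> p x = x" "\<And>x. x \<in> S \<Longrightarrow> p x = 0"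
    "\<And>x. x \<in> S \<oplus>\<^sub>s T \<Longrightarrow> x - p x \<in> S"
proof -
  have sST: "subspace (S \<oplus>\<^sub>s T)" using subspace_sum_subspace[OF S T] .
  obtain D where D: "subspace D" "(S \<oplus>\<^sub>s T) \<inter> D = {0}" "(S \<oplus>\<^sub>s T) \<oplus>\<^sub>s D = UNIV"
    using complement_exists[OF sST subspace_UNIV subset_UNIV] .
  have 1: "T \<inter> (S \<oplus>\<^sub>s D) = {0}"
  proof -
    have "x = 0" if x: "x \<in> T" "x \<in> S \<oplus>\<^sub>s D" for x
    proof -
      obtain y d where yd: "x = y + d" "y \<in> S" "d \<in> D" using x(2) by (rule subspace_sumE)
      have "d = - y + x" using yd(1) by simp
      then have "d \<in> S \<oplus>\<^sub>s T" using subspace_sumI[of "- y" S x T] yd(2) x(1) subspace_neg[OF S] by simp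
      then have "d \<in> {0}" unfolding D(2)[symmetric] using yd(3) by (rule IntI)
      then have "x \<in> S \<inter> T" using yd x by simp
      then show ?thesis unfolding ST by simp
    qed
    then show ?thesis using subspace_0[OF T] subspace_0[OF subspace_sum_subspace[OF S D(1)]] by blast
  qed
  have 2: "T \<oplus>\<^sub>s (S \<oplus>\<^sub>s D) = UNIV"
  proof -
    have "x \<in> T \<oplus>\<^sub>s (S \<oplus>\<^sub>s D)" for x
    proof -
      have "x \<in> (S \<oplus>\<^sub>s T) \<oplus>\<^sub>s D" using D(3) by simp
      then obtain w d where wd: "x = w + d" "w \<in> S \<oplus>\<^sub>s T" "d \<in> D" by (rule subspace_sumE)
      obtain y z where yz: "w = y + z" "y \<in> S" "z \<in> T" using wd(2) by (rule subspace_sumE)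
      have "x = z + (y + d)" using wd yz by (simp add: algebra_simps)
      then show ?thesis using subspace_sumI[OF yz(3) subspace_sumI[OF yz(2) wd(3)]] by simp
    qed
    then show ?thesis by blast
  qed
  obtain p where p: "lin p" "\<And>x. p x \<in> T" "\<And>x. x - p x \<in> S \<oplus>\<^sub>s D" "\<And>x. x \<in> T \<Longrightarrow> p x = x"
    "\<And>x. x \<in> S \<oplus>\<^sub>s D \<Longrightarrow> p x = 0"
    using projection_exists[OF T subspace_sum_subspace[OF S D(1)] 1 2] by metis
  have S0: "p x = 0" if "x \<in> S" for x using p(5) subspace_sum_left[OF D(1), of S] that by blast
  have "x - p x \<in> S" if x: "x \<in> S \<oplus>\<^sub>s T" for x
  proof -
    interpret p: Vector_Spaces.linear scale scale p by (rule p(1))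
    obtain y z where yz: "x = y + z" "y \<in> S" "z \<in> T" using x by (rule subspace_sumE)
    then have "p x = z" using S0 p(4) by (simp add: p.add)
    then show ?thesis using yz by simp
  qed
  then show thesis using that[OF p(1,2,4) S0] by blast
qed

section \<open>Hermitian forms and their inertia\<close>

text \<open>Conjugate linearity in the second argument follows from the three clauses.\<close>

definition hermitian_form :: "('b \<Rightarrow> 'b \<Rightarrow> complex) \<Rightarrow> bool" where
  "hermitian_form h \<longleftrightarrow>
     (\<forall>x y z. h (x + y) z = h x z + h y z) \<and>
     (\<forall>c x z. h (c *s x) z = c * h x z) \<and>
     (\<forall>x y. h y x = cnj (h x y))"

lemma hermitian_formI:
  assumes "\<And>x y z. h (x + y) z = h x z + h y z" "\<And>c x z. h (c *s x) z = c * h x z"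
    "\<And>x y. h y x = cnj (h x y)"
  shows "hermitian_form h"
  unfolding hermitian_form_def using assms by blast

lemma
  assumes "hermitian_form h"
  shows form_add_left: "h (x + y) z = h x z + h y z"
    and form_scale_left: "h (c *s x) z = c * h x z"
    and form_cnj: "h y x = cnj (h x y)"
  using assms unfolding hermitian_form_def by blast+

lemma form_add_right: "hermitian_form h \<Longrightarrow> h z (x + y) = h z x + h z y"
  using form_add_left[of h x y z] form_cnj[of h z "x + y"] form_cnj[of h z x] form_cnj[of h z y] by simp

lemma form_scale_right: "hermitian_form h \<Longrightarrow> h z (c *s x) = cnj c * h z x"
  using form_scale_left[of h c x z] form_cnj[of h z "c *s x"] form_cnj[of h z x] by simp

lemma form_zero_left: "hermitian_form h \<Longrightarrow> h 0 x = 0"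
  using form_scale_left[of h 0 x x] by simp

lemma form_zero_right: "hermitian_form h \<Longrightarrow> h x 0 = 0"
  using form_scale_right[of h x 0 x] by simp

lemma form_minus_left: "hermitian_form h \<Longrightarrow> h (- x) z = - h x z"
  using form_add_left[of h x "- x" z] form_zero_left[of h z] by (simp add: eq_neg_iff_add_eq_0 add.commute)

lemma form_minus_right: "hermitian_form h \<Longrightarrow> h z (- x) = - h z x"
  using form_add_right[of h z x "- x"] form_zero_right[of h z] by (simp add: eq_neg_iff_add_eq_0 add.commute)

lemma form_diff_left: "hermitian_form h \<Longrightarrow> h (x - y) z = h x z - h y z"
  using form_add_left[of h x "- y" z] form_minus_left[of h y z] by simp

lemma form_diff_right: "hermitian_form h \<Longrightarrow> h z (x - y) = h z x - h z y"
  using form_add_right[of h z x "- y"] form_minus_right[of h z y] by simp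

lemma form_sym_zero: "hermitian_form h \<Longrightarrow> h x y = 0 \<Longrightarrow> h y x = 0"
  by (metis form_cnj complex_cnj_zero)

lemma form_self: "hermitian_form h \<Longrightarrow> h x x = complex_of_real (Re (h x x))"
  using form_cnj[of h x x] by (simp add: complex_eq_iff)

lemma form_self_zero: "hermitian_form h \<Longrightarrow> Re (h x x) = 0 \<Longrightarrow> h x x = 0"
  by (subst form_self) simp_all

lemmas form_simps = form_add_left form_add_right form_scale_left form_scale_right
  form_zero_left form_zero_right form_minus_left form_minus_right form_diff_left form_diff_right

lemma form_expand:
  assumes h: "hermitian_form h"
  shows "Re (h (x + c *s y) (x + c *s y))
    = Re (h x x) + 2 * Re (cnj c * h x y) + (cmod c)\<^sup>2 * Re (h y y)"
proof -
  have "h (x + c *s y) (x + c *s y) = h x x + (cnj c * h x y + c * h y x) + c * cnj c * h y y"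
    using h by (simp add: form_simps algebra_simps)
  moreover have "c * h y x = cnj (cnj c * h x y)" using form_cnj[OF h, of y x] by simp
  moreover have "Re (c * cnj c * h y y) = (cmod c)\<^sup>2 * Re (h y y)"
    by (metis Re_complex_of_real complex_norm_square form_self[OF h] of_real_mult)
  ultimately show ?thesis by simp
qed

lemma form_expand_orth:
  assumes h: "hermitian_form h" and o: "h x y = 0"
  shows "Re (h (x + y) (x + y)) = Re (h x x) + Re (h y y)"
  using assms form_sym_zero[OF assms] by (simp add: form_simps)

lemma hermitian_form_uminus:
  assumes "hermitian_form h" shows "hermitian_form (\<lambda>x y. - h x y)"
proof (rule hermitian_formI)
  fix x y show "- h y x = cnj (- h x y)" using form_cnj[OF assms, of y x] by simp
qed (simp_all add: form_simps[OF assms])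

lemma hermitian_form_add:
  assumes "hermitian_form h" "hermitian_form k" shows "hermitian_form (\<lambda>x y. h x y + k x y)"
proof (rule hermitian_formI)
  fix x y show "h y x + k y x = cnj (h x y + k x y)"
    using form_cnj[OF assms(1), of y x] form_cnj[OF assms(2), of y x] by simp
qed (simp_all add: form_simps[OF assms(1)] form_simps[OF assms(2)] algebra_simps)

lemma hermitian_form_scale:
  assumes "hermitian_form h" shows "hermitian_form (\<lambda>x y. complex_of_real c * h x y)"
proof (rule hermitian_formI)
  fix x y show "complex_of_real c * h y x = cnj (complex_of_real c * h x y)"
    using form_cnj[OF assms, of y x] by simp
qed (simp_all add: form_simps[OF assms] algebra_simps)

lemma hermitian_form_diff:
  assumes "hermitian_form h" "hermitian_form k" shows "hermitian_form (\<lambda>x y. h x y - k x y)"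
  using hermitian_form_add[OF assms(1) hermitian_form_uminus[OF assms(2)]] by simp

lemma hermitian_form_pullback:
  assumes h: "hermitian_form h" and f: "lin f"
  shows "hermitian_form (\<lambda>x y. h (f x) (f y))"
proof (rule hermitian_formI)
  interpret f: Vector_Spaces.linear scale scale f by (rule f)
  fix x y z c
  show "h (f (x + y)) (f z) = h (f x) (f z) + h (f y) (f z)"
    "h (f (c *s x)) (f z) = c * h (f x) (f z)"
    using h by (simp_all add: f.add f.scale form_simps)
  show "h (f y) (f x) = cnj (h (f x) (f y))" using h by (rule form_cnj)
qed

section \<open>Semidefinite subspaces and the index of a form\<close>

definition pos_on :: "('b \<Rightarrow> 'b \<Rightarrow> complex) \<Rightarrow> 'b set \<Rightarrow> bool" where
  "pos_on h S \<longleftrightarrow> (\<forall>x\<in>S. x \<noteq> 0 \<longrightarrow> 0 < Re (h x x))"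

definition nonneg_on :: "('b \<Rightarrow> 'b \<Rightarrow> complex) \<Rightarrow> 'b set \<Rightarrow> bool" where
  "nonneg_on h S \<longleftrightarrow> (\<forall>x\<in>S. 0 \<le> Re (h x x))"

text \<open>For an indefinite or degenerate form this need not be a complement of \<open>S\<close>;
  \<open>orth_complement\<close> says when the two at least span \<open>W\<close>.\<close>

definition orth :: "('b \<Rightarrow> 'b \<Rightarrow> complex) \<Rightarrow> 'b set \<Rightarrow> 'b set \<Rightarrow> 'b set" where
  "orth h S W = {w \<in> W. \<forall>s\<in>S. h w s = 0}"

abbreviation radical :: "('b \<Rightarrow> 'b \<Rightarrow> complex) \<Rightarrow> 'b set \<Rightarrow> 'b set" where
  "radical h W \<equiv> orth h W W"

text \<open>By Sylvester's law this is the number of positive eigenvalues, see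
  \<open>inertia_eq_index\<close>. As a maximum over subspaces it is bounded below by one positive
  subspace and above by one nonpositive subspace. For a finite-dimensional subspace \<open>W\<close>
  the set of dimensions is finite and contains 0, so \<open>Max\<close> is meaningful.\<close>

definition pos_index :: "('b \<Rightarrow> 'b \<Rightarrow> complex) \<Rightarrow> 'b set \<Rightarrow> nat" where
  "pos_index h W = Max {dim S |S. subspace S \<and> S \<subseteq> W \<and> pos_on h S}"

abbreviation neg_index :: "('b \<Rightarrow> 'b \<Rightarrow> complex) \<Rightarrow> 'b set \<Rightarrow> nat" where
  "neg_index h W \<equiv> pos_index (\<lambda>x y. - h x y) W"

lemma orth_subset: "orth h S W \<subseteq> W"
  unfolding orth_def by blast

lemma subspace_orth: "hermitian_form h \<Longrightarrow> subspace W \<Longrightarrow> subspace (orth h S W)"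
  unfolding orth_def subspace_def by (simp add: form_zero_left form_add_left form_scale_left)

lemma orth_uminus [simp]: "orth (\<lambda>x y. - h x y) S W = orth h S W"
  unfolding orth_def by simp

lemma
  assumes "fin_dim W" "subspace W"
  shows pos_index_attained': "\<exists>S. subspace S \<and> S \<subseteq> W \<and> pos_on h S \<and> dim S = pos_index h W"
      (is ?A)
    and pos_index_ge: "subspace S \<Longrightarrow> S \<subseteq> W \<Longrightarrow> pos_on h S \<Longrightarrow> dim S \<le> pos_index h W"
proof -
  let ?D = "{dim S |S. subspace S \<and> S \<subseteq> W \<and> pos_on h S}"
  have W: "0 \<in> W" using assms(2) by (rule subspace_0)
  have fin: "finite ?D"
    by (rule finite_subset[of _ "{..dim W}"]) (use dim_subspace_mono[OF _ assms(1)] in auto)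
  show "dim S \<le> pos_index h W" if "subspace S" "S \<subseteq> W" "pos_on h S" for S
    unfolding pos_index_def using that by (intro Max_ge[OF fin]) blast
  have "pos_on h {0}" unfolding pos_on_def by simp
  then have "?D \<noteq> {}" using W subspace_single_0 by blast
  then have "Max ?D \<in> ?D" using Max_in[OF fin] by blast
  then show ?A unfolding pos_index_def by auto
qed

lemma pos_index_attained:
  assumes "fin_dim W" "subspace W"
  obtains S where "subspace S" "S \<subseteq> W" "pos_on h S" "dim S = pos_index h W"
  using pos_index_attained'[OF assms] by blast

lemma pos_on_Int_zero:
  assumes "pos_on h S" "subspace S" "subspace T" "\<And>x. x \<in> T \<Longrightarrow> Re (h x x) \<le> 0"
  shows "S \<inter> T = {0}"
proof -
  have "x = 0" if "x \<in> S" "x \<in> T" for x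
    using assms(1) assms(4)[OF that(2)] that(1) unfolding pos_on_def by force
  then show ?thesis using subspace_0[OF assms(2)] subspace_0[OF assms(3)] by blast
qed

text \<open>A positive subspace meets \<open>Q\<close> only in 0. Together with
  \<open>pos_index_ge\<close> this pins an index down by exhibiting two subspaces.\<close>

lemma pos_index_le:
  assumes W: "fin_dim W" "subspace W" and Q: "subspace Q" "Q \<subseteq> W" "\<And>x. x \<in> Q \<Longrightarrow> Re (h x x) \<le> 0"
  shows "pos_index h W + dim Q \<le> dim W"
proof -
  obtain P where P: "subspace P" "P \<subseteq> W" "pos_on h P" "dim P = pos_index h W"
    using pos_index_attained[OF W] .
  have "P \<inter> Q = {0}" using pos_on_Int_zero[OF P(3,1) Q(1,3)] .
  then show ?thesis using dim_Int_ge[OF P(1) Q(1) W(2) P(2) Q(2) W(1)] P(4) by simp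
qed

text \<open>Gram-Schmidt without definiteness: it suffices that isotropic vectors of the span are
  orthogonal to all of \<open>W\<close>, since such vectors call for no correction.\<close>

lemma orth_projection:
  assumes h: "hermitian_form h" and W: "subspace W" and B: "finite B" "B \<subseteq> W"
    and d: "\<And>x w. x \<in> span B \<Longrightarrow> w \<in> W \<Longrightarrow> h x x = 0 \<Longrightarrow> h x w = 0"
  shows "w \<in> W \<Longrightarrow> \<exists>n\<in>span B. \<forall>b\<in>span B. h (w - n) b = 0"
  using B d
proof (induction B arbitrary: w rule: finite_induct)
  case empty
  then show ?case using h by (simp add: form_simps)
next
  case (insert b B)
  have sub: "span B \<subseteq> span (insert b B)" by (rule span_mono) blast
  have IH: "\<exists>n\<in>span B. \<forall>b\<in>span B. h (w - n) b = 0" if "w \<in> W" for w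
    using insert.IH[OF that] insert.prems(2,3) sub by blast
  obtain n where n: "n \<in> span B" "\<And>b'. b' \<in> span B \<Longrightarrow> h (b - n) b' = 0"
    using IH[of b] insert.prems by blast
  obtain m where m: "m \<in> span B" "\<And>b'. b' \<in> span B \<Longrightarrow> h (w - m) b' = 0"
    using IH[OF insert.prems(1)] by blast
  let ?b = "b - n"
  have bs: "?b \<in> span (insert b B)" using n(1) sub span_base[of b "insert b B"] by (blast intro: span_diff)
  have sW: "span (insert b B) \<subseteq> W" using insert.prems(2) W by (rule span_minimal)
  \<comment> \<open>If the new direction is isotropic, \<open>w - m\<close> is already orthogonal to
    it by the hypothesis on isotropic vectors, so the coefficient 0 works; otherwise it is the usual
    quotient.\<close>
  define c where "c = (if h ?b ?b = 0 then 0 else h (w - m) ?b / h ?b ?b)"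
  have wm: "w - m \<in> W" using insert.prems(1) m(1) sub sW W by (blast intro: subspace_diff)
  have "h (w - (m + c *s ?b)) ?b = 0"
  proof (cases "h ?b ?b = 0")
    case True
    then have "h ?b (w - m) = 0" using insert.prems(3)[OF bs wm] by simp
    then have "h (w - m) ?b = 0" using form_sym_zero[OF h] by blast
    then show ?thesis using True by (simp add: c_def)
  next
    case False
    have "h (w - m - c *s ?b) ?b = h (w - m) ?b - c * h ?b ?b"
      by (simp only: form_diff_left[OF h] form_scale_left[OF h])
    then show ?thesis using False by (simp add: c_def diff_diff_eq)
  qed
  moreover have "h (w - (m + c *s ?b)) b' = 0" if "b' \<in> span B" for b'
  proof -
    have "h (w - m - c *s ?b) b' = h (w - m) b' - c * h ?b b'"
      by (simp only: form_diff_left[OF h] form_scale_left[OF h])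
    then show ?thesis using m(2)[OF that] n(2)[OF that] by (simp add: diff_diff_eq)
  qed
  ultimately have "h (w - (m + c *s ?b)) (y + k *s ?b) = 0" if "y \<in> span B" for y k
    using that by (simp add: form_add_right[OF h] form_scale_right[OF h])
  moreover have "\<exists>y\<in>span B. \<exists>k. x = y + k *s ?b" if x: "x \<in> span (insert b B)" for x
  proof -
    obtain k where k: "x - k *s b \<in> span B" using x span_breakdown_eq by blast
    have "x - k *s b + k *s n \<in> span B" using k n(1) by (intro span_add span_scale)
    moreover have "x = (x - k *s b + k *s n) + k *s ?b" by (simp add: scale_right_diff_distrib)
    ultimately show ?thesis by blast
  qed
  ultimately have "\<forall>b'\<in>span (insert b B). h (w - (m + c *s ?b)) b' = 0" by metis
  moreover have "m + c *s ?b \<in> span (insert b B)"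
    using m(1) sub bs by (blast intro: span_add span_scale)
  ultimately show ?case by blast
qed

text \<open>The sum need not be direct: isotropic vectors of \<open>S\<close> lie in both summands.
  The hypothesis comes from \<open>nonneg_null_orth\<close> for nonnegative forms, and from
  feasibility in \<open>feasible_section\<close>.\<close>

lemma orth_complement:
  assumes h: "hermitian_form h" and W: "subspace W" and S: "subspace S" "fin_dim S" "S \<subseteq> W"
    and d: "\<And>x w. x \<in> S \<Longrightarrow> w \<in> W \<Longrightarrow> h x x = 0 \<Longrightarrow> h x w = 0"
  shows "S \<oplus>\<^sub>s orth h S W = W"
proof -
  obtain B where B: "finite B" "B \<subseteq> S" "span B = S" using finite_basis[OF S(1,2)] by metis
  have "w \<in> S \<oplus>\<^sub>s orth h S W" if w: "w \<in> W" for w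
  proof -
    obtain n where n: "n \<in> S" "\<forall>b\<in>S. h (w - n) b = 0"
      using orth_projection[OF h W B(1), of w] B d S(3) w by blast
    have "w - n \<in> orth h S W" using n S(3) W w by (auto simp: orth_def intro: subspace_diff)
    then show ?thesis using subspace_sumI[OF n(1), of "w - n"] by simp
  qed
  then show ?thesis using subspace_sum_subset[OF W S(3) orth_subset] by blast
qed

lemma pos_on_null:
  assumes "pos_on h S" "x \<in> S" "h x x = 0" shows "x = 0"
  using assms unfolding pos_on_def by fastforce

lemma orth_complement_pos:
  assumes h: "hermitian_form h" and W: "subspace W" "fin_dim W" and S: "subspace S" "S \<subseteq> W" "pos_on h S"
  shows "S \<oplus>\<^sub>s orth h S W = W" "S \<inter> orth h S W = {0}" "dim W = dim S + dim (orth h S W)"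
proof -
  have d: "h x w = 0" if "x \<in> S" "w \<in> W" "h x x = 0" for x w
    using pos_on_null[OF S(3) that(1,3)] form_zero_left[OF h] by simp
  show 1: "S \<oplus>\<^sub>s orth h S W = W"
    using orth_complement[OF h W(1) S(1) fin_dim_subset[OF W(2) S(2)] S(2) d] .
  show 2: "S \<inter> orth h S W = {0}"
  proof -
    have "x = 0" if "x \<in> S" "x \<in> orth h S W" for x
      using pos_on_null[OF S(3)] that unfolding orth_def by blast
    then show ?thesis using subspace_0 S(1) subspace_orth[OF h W(1)] by blast
  qed
  show "dim W = dim S + dim (orth h S W)"
    using dim_complement[OF S(1) subspace_orth[OF h W(1)] W(2) 2 1] .
qed

text \<open>A degenerate case of Cauchy-Schwarz. Along \<open>z + k y\<close> the value of the form
  has no quadratic term in \<open>k\<close>, so a nonzero cross term would make it negative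
  somewhere.\<close>

lemma nonneg_null_orth:
  assumes h: "hermitian_form h" and Y: "subspace Y" "nonneg_on h Y" and y: "y \<in> Y" "h y y = 0" "z \<in> Y"
  shows "h y z = 0"
proof (rule ccontr)
  let ?c = "h z y"
  assume "h y z \<noteq> 0"
  then have c: "?c \<noteq> 0" using form_sym_zero[OF h] by blast
  \<comment> \<open>Chosen so that the cross term becomes \<open>- Re (h z z) - 1\<close> and the
    total value is -1.\<close>
  define r where "r = - (Re (h z z) + 1) / (2 * (cmod ?c)\<^sup>2)"
  define k where "k = complex_of_real r * h z y"
  have "Re (h (z + k *s y) (z + k *s y)) = Re (h z z) + 2 * Re (cnj k * h z y)"
    using form_expand[OF h, of z k y] y(2) by simp
  also have "cnj k * h z y = complex_of_real (r * (cmod ?c)\<^sup>2)"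
    by (simp add: k_def complex_norm_square mult.commute del: of_real_power)
  also have "Re (h z z) + 2 * Re (complex_of_real (r * (cmod ?c)\<^sup>2)) = -1"
    using c by (simp add: r_def) (simp add: field_simps)
  finally have "Re (h (z + k *s y) (z + k *s y)) < 0" by simp
  moreover have "z + k *s y \<in> Y" using Y(1) y by (blast intro: subspace_add subspace_scale)
  ultimately show False using Y(2) unfolding nonneg_on_def by force
qed

lemma pos_on_sum:
  assumes h: "hermitian_form h" and S: "pos_on h S" and T: "pos_on h T"
    and o: "\<And>x y. x \<in> S \<Longrightarrow> y \<in> T \<Longrightarrow> h x y = 0"
  shows "pos_on h (S \<oplus>\<^sub>s T)"
  unfolding pos_on_def
proof (intro ballI impI)
  fix x assume x: "x \<in> S \<oplus>\<^sub>s T" "x \<noteq> 0"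
  obtain y z where yz: "x = y + z" "y \<in> S" "z \<in> T" using x(1) by (rule subspace_sumE)
  then have "Re (h x x) = Re (h y y) + Re (h z z)" using form_expand_orth[OF h o] by simp
  moreover have "0 \<le> Re (h y y)" "0 \<le> Re (h z z)"
    using S T yz form_zero_left[OF h, of 0] unfolding pos_on_def by (metis order.refl less_imp_le zero_complex.sel(1))+
  moreover have "0 < Re (h y y) \<or> 0 < Re (h z z)"
    using S T yz x(2) unfolding pos_on_def by (metis add.right_neutral)
  ultimately show "0 < Re (h x x)" by linarith
qed

text \<open>A vector of positive value orthogonal to \<open>P\<close> would enlarge the maximal
  positive subspace.\<close>

lemma orth_max_pos_nonpos:
  assumes h: "hermitian_form h" and W: "subspace W" "fin_dim W"
    and P: "subspace P" "P \<subseteq> W" "pos_on h P" "dim P = pos_index h W"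
    and x: "x \<in> orth h P W"
  shows "Re (h x x) \<le> 0"
proof (rule ccontr)
  assume n: "\<not> Re (h x x) \<le> 0"
  have xW: "x \<in> W" using x orth_subset by blast
  have pos: "pos_on h (span {x})"
    unfolding pos_on_def
  proof (intro ballI impI)
    fix y assume "y \<in> span {x}" "y \<noteq> 0"
    then obtain k where "y = k *s x" "k \<noteq> 0" unfolding span_singleton by auto
    then show "0 < Re (h y y)" using form_expand[OF h, of 0 k x] n by (simp add: form_simps[OF h])
  qed
  have o: "h p y = 0" if p: "p \<in> P" and y: "y \<in> span {x}" for p y
  proof -
    obtain k where "y = k *s x" using y unfolding span_singleton by auto
    moreover have "h p x = 0" using x p form_sym_zero[OF h] unfolding orth_def by blast
    ultimately show ?thesis by (simp add: form_simps[OF h])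
  qed
  have sub: "span {x} \<subseteq> W" using xW W(1) by (simp add: span_minimal)
  have "x \<noteq> 0" using n by (auto simp: form_simps[OF h])
  have "P \<inter> span {x} \<subseteq> {0}" using o pos_on_null[OF P(3)] by blast
  then have "dim (P \<oplus>\<^sub>s span {x}) = dim P + dim (span {x})"
    using dim_subspace_sum[OF P(1) subspace_span] fin_dim_subset[OF W(2)] P(2) sub by blast
  moreover have "dim (span {x}) = 1"
    using dim_span_eq_card_independent[of "{x}"] \<open>x \<noteq> 0\<close> by simp
  moreover have "dim (P \<oplus>\<^sub>s span {x}) \<le> pos_index h W"
    using pos_index_ge[OF W(2,1) subspace_sum_subspace[OF P(1) subspace_span] subspace_sum_subset[OF W(1) P(2) sub]
      pos_on_sum[OF h P(3) pos o]] by blast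
  ultimately show False using P(4) by simp
qed

text \<open>A subspace on which the form is nonnegative may contain null vectors; those outside the
  radical still contribute to the index.\<close>

lemma dim_nonneg_le:
  assumes h: "hermitian_form h" and W: "subspace W" "fin_dim W"
    and S: "subspace S" "S \<subseteq> W" "nonneg_on h S"
  shows "dim S \<le> pos_index h W + dim (S \<inter> radical h W)"
proof -
  obtain P where P: "subspace P" "P \<subseteq> W" "pos_on h P" "dim P = pos_index h W"
    using pos_index_attained[OF W(2,1)] .
  let ?O = "orth h P W"
  have np: "Re (h x x) \<le> 0" if "x \<in> ?O" for x using orth_max_pos_nonpos[OF h W P that] .
  have sO: "subspace ?O" using subspace_orth[OF h W(1)] .
  have W2: "P \<oplus>\<^sub>s ?O = W" "dim W = dim P + dim ?O"
    using orth_complement_pos[OF h W P(1-3)] by simp_all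
  \<comment> \<open>A vector of \<open>S\<close> in the nonpositive space \<open>?O\<close> is
    isotropic. It is orthogonal to \<open>?O\<close> by semidefiniteness and to \<open>P\<close> by
    construction, hence to all of \<open>W\<close>.\<close>
  have "S \<inter> ?O \<subseteq> S \<inter> radical h W"
  proof
    fix x assume x: "x \<in> S \<inter> ?O"
    then have "Re (h x x) = 0" using S(3) np unfolding nonneg_on_def by force
    then have x0: "h x x = 0" using form_self_zero[OF h] by blast
    have "h x w = 0" if "w \<in> W" for w
    proof -
      have "w \<in> P \<oplus>\<^sub>s ?O" using W2(1) that by simp
      then obtain p z where pz: "w = p + z" "p \<in> P" "z \<in> ?O" by (rule subspace_sumE)
      have "nonneg_on (\<lambda>x y. - h x y) ?O" using np unfolding nonneg_on_def by simp
      then have "h x z = 0"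
        using nonneg_null_orth[OF hermitian_form_uminus[OF h] sO, of x z] x x0 pz by simp
      moreover have "h x p = 0" using x pz unfolding orth_def by blast
      ultimately show ?thesis using pz by (simp add: form_simps[OF h])
    qed
    then show "x \<in> S \<inter> radical h W" using x S(2) unfolding orth_def by blast
  qed
  moreover have "fin_dim (S \<inter> radical h W)" using fin_dim_subset[OF W(2)] S(2) by blast
  ultimately have "dim (S \<inter> ?O) \<le> dim (S \<inter> radical h W)" by (rule dim_subspace_mono)
  then show ?thesis using dim_Int_ge[OF S(1) sO W(1) S(2) orth_subset W(2)] W2(2) P(4) by simp
qed

text \<open>One inequality counts the nonpositive complement of a maximal positive subspace with
  \<open>dim_nonneg_le\<close>; the other uses that a maximal negative subspace together with the
  radical is nonpositive.\<close>

theorem inertia_sum: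
  assumes h: "hermitian_form h" and W: "subspace W" "fin_dim W"
  shows "pos_index h W + neg_index h W + dim (radical h W) = dim W"
proof (rule antisym)
  obtain P where P: "subspace P" "P \<subseteq> W" "pos_on h P" "dim P = pos_index h W"
    using pos_index_attained[OF W(2,1)] .
  let ?O = "orth h P W"
  have "nonneg_on (\<lambda>x y. - h x y) ?O"
    using orth_max_pos_nonpos[OF h W P] unfolding nonneg_on_def by auto
  then have "dim ?O \<le> neg_index h W + dim (?O \<inter> radical h W)"
    using dim_nonneg_le[OF hermitian_form_uminus[OF h] W subspace_orth[OF h W(1)] orth_subset] by simp
  moreover have "dim (?O \<inter> radical h W) \<le> dim (radical h W)"
    using dim_subspace_mono[OF Int_lower2 fin_dim_subset[OF W(2) orth_subset]] .
  ultimately show "dim W \<le> pos_index h W + neg_index h W + dim (radical h W)"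
    using orth_complement_pos(3)[OF h W P(1-3)] P(4) by linarith
next
  obtain N where N: "subspace N" "N \<subseteq> W" "pos_on (\<lambda>x y. - h x y) N" "dim N = neg_index h W"
    using pos_index_attained[OF W(2,1)] .
  have sR: "subspace (radical h W)" using subspace_orth[OF h W(1)] .
  have NR: "N \<inter> radical h W \<subseteq> {0}"
    using pos_on_null[OF N(3)] N(2) unfolding orth_def by auto
  have np: "Re (h x x) \<le> 0" if "x \<in> N \<oplus>\<^sub>s radical h W" for x
  proof -
    obtain y z where yz: "x = y + z" "y \<in> N" "z \<in> radical h W" using \<open>x \<in> _\<close> by (rule subspace_sumE)
    have "h z y = 0" "h z z = 0" using yz N(2) unfolding orth_def by blast+
    then have "Re (h x x) = Re (h y y)"
      using form_expand_orth[OF h form_sym_zero[OF h, of z y]] yz by simp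
    then show ?thesis using N(3) yz(2) form_zero_left[OF h, of 0] unfolding pos_on_def by (cases "y = 0") force+
  qed
  have "pos_index h W + dim (N \<oplus>\<^sub>s radical h W) \<le> dim W"
    using pos_index_le[OF W(2,1) subspace_sum_subspace[OF N(1) sR] subspace_sum_subset[OF W(1) N(2) orth_subset] np] .
  moreover have "dim (N \<oplus>\<^sub>s radical h W) = dim N + dim (radical h W)"
    using dim_subspace_sum[OF N(1) sR fin_dim_subset[OF W(2) N(2)] fin_dim_subset[OF W(2) orth_subset] NR] .
  ultimately show "pos_index h W + neg_index h W + dim (radical h W) \<le> dim W"
    using N(4) by simp
qed

text \<open>The induction step of the two bounds that follow: the last generator is made orthogonal
  to the others. \<open>b'\<close> is 0 when \<open>b\<close> already lies in
  \<open>span B\<close>.\<close>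

lemma pos_on_orth_split:
  assumes q: "hermitian_form q" and B: "finite B" and pos: "pos_on q (span (insert b B))"
  obtains b' where "b' \<in> span (insert b B)" "\<And>y. y \<in> span B \<Longrightarrow> q y b' = 0"
    "\<And>x. x \<in> span (insert b B) \<Longrightarrow> \<exists>y\<in>span B. \<exists>k. x = y + k *s b'"
proof -
  have sub: "span B \<subseteq> span (insert b B)" by (rule span_mono) blast
  have d: "q x w = 0" if "x \<in> span B" "w \<in> UNIV" "q x x = 0" for x w
    using pos_on_null[OF pos _ that(3)] that(1) sub form_zero_left[OF q] by blast
  obtain n where n: "n \<in> span B" "\<And>y. y \<in> span B \<Longrightarrow> q (b - n) y = 0"
    using orth_projection[OF q subspace_UNIV B subset_UNIV d UNIV_I, of b] by blast
  have 1: "b - n \<in> span (insert b B)" using n(1) sub span_base[of b "insert b B"] by (blast intro: span_diff)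
  have 2: "\<exists>y\<in>span B. \<exists>k. x = y + k *s (b - n)" if x: "x \<in> span (insert b B)" for x
  proof -
    obtain k where k: "x - k *s b \<in> span B" using x span_breakdown_eq by blast
    have "x - k *s b + k *s n \<in> span B" using k n(1) by (intro span_add span_scale)
    moreover have "x = (x - k *s b + k *s n) + k *s (b - n)" by (simp add: scale_right_diff_distrib)
    ultimately show ?thesis by blast
  qed
  show thesis using that[OF 1 form_sym_zero[OF q n(2)] 2] .
qed

text \<open>Boundedness of a linear functional in finite dimension, by induction on generators
  instead of compactness; \<open>q\<close> acts as the squared norm.\<close>

lemma functional_bound:
  assumes q: "hermitian_form q" and B: "finite B" and pos: "pos_on q (span B)"
    and add: "\<And>x y. \<phi> (x + y) = \<phi> x + \<phi> y" and scale: "\<And>c x. \<phi> (c *s x) = c * \<phi> x"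
  shows "\<exists>\<mu>\<ge>0. \<forall>x\<in>span B. (cmod (\<phi> x))\<^sup>2 \<le> \<mu> * Re (q x x)"
  using B pos
proof (induction B rule: finite_induct)
  case empty
  then show ?case using scale[of 0 0] form_zero_left[OF q] by auto
next
  case (insert b B)
  have posB: "pos_on q (span B)"
    using insert.prems span_mono[of B "insert b B"] unfolding pos_on_def by blast
  obtain \<mu> where \<mu>: "\<mu> \<ge> 0" "\<And>x. x \<in> span B \<Longrightarrow> (cmod (\<phi> x))\<^sup>2 \<le> \<mu> * Re (q x x)"
    using insert.IH[OF posB] by blast
  obtain b' where b': "b' \<in> span (insert b B)" "\<And>y. y \<in> span B \<Longrightarrow> q y b' = 0"
    "\<And>x. x \<in> span (insert b B) \<Longrightarrow> \<exists>y\<in>span B. \<exists>k. x = y + k *s b'"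
    using pos_on_orth_split[OF q insert.hyps(1) insert.prems] by metis
  show ?case
  proof (cases "b' = 0")
    case True
    then have "span (insert b B) \<subseteq> span B" using b'(3) by fastforce
    then show ?thesis using \<mu> by blast
  next
    case False
    let ?d = "Re (q b' b')"
    have d: "0 < ?d" using False b'(1) insert.prems unfolding pos_on_def by blast
    \<comment> \<open>The factors 2 come from \<open>(a + b)^2 <= 2 a^2 + 2 b^2\<close>; dividing by
      \<open>?d\<close> converts the coefficient of \<open>b'\<close> into its share of
      \<open>q\<close>.\<close>
    let ?\<nu> = "2 * \<mu> + 2 * (cmod (\<phi> b'))\<^sup>2 / ?d"
    have "(cmod (\<phi> x))\<^sup>2 \<le> ?\<nu> * Re (q x x)" if x: "x \<in> span (insert b B)" for x
    proof -
      obtain y k where y: "y \<in> span B" and xy: "x = y + k *s b'" using b'(3)[OF x] by blast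
      let ?q = "Re (q y y)"
      have q0: "0 \<le> ?q" using posB y form_zero_left[OF q, of 0] unfolding pos_on_def by (cases "y = 0") force+
      have qx: "Re (q x x) = ?q + (cmod k)\<^sup>2 * ?d"
        using form_expand[OF q, of y k b'] b'(2)[OF y] xy by simp
      have "cmod (\<phi> x) \<le> cmod (\<phi> y) + cmod k * cmod (\<phi> b')"
        using norm_triangle_ineq[of "\<phi> y" "k * \<phi> b'"] by (simp add: xy add scale norm_mult)
      then have "(cmod (\<phi> x))\<^sup>2 \<le> (cmod (\<phi> y) + cmod k * cmod (\<phi> b'))\<^sup>2" by (simp add: power_mono)
      also have "\<dots> \<le> 2 * (cmod (\<phi> y))\<^sup>2 + 2 * (cmod k * cmod (\<phi> b'))\<^sup>2"
        using zero_le_power2[of "cmod (\<phi> y) - cmod k * cmod (\<phi> b')"]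
        by (simp add: power2_sum power2_diff)
      also have "\<dots> \<le> 2 * (\<mu> * ?q) + 2 * (cmod k * cmod (\<phi> b'))\<^sup>2" using \<mu>(2)[OF y] by simp
      also have "\<dots> \<le> 2 * \<mu> * (?q + (cmod k)\<^sup>2 * ?d) + 2 * (cmod (\<phi> b'))\<^sup>2 / ?d * (?q + (cmod k)\<^sup>2 * ?d)"
      proof -
        have "0 \<le> \<mu> * ((cmod k)\<^sup>2 * ?d)" "0 \<le> 2 * (cmod (\<phi> b'))\<^sup>2 / ?d * ?q"
          using \<mu>(1) d q0 by simp_all
        moreover have "2 * (cmod (\<phi> b'))\<^sup>2 / ?d * ((cmod k)\<^sup>2 * ?d) = 2 * (cmod k * cmod (\<phi> b'))\<^sup>2"
          using d by (simp add: power_mult_distrib)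
        ultimately show ?thesis unfolding distrib_left by linarith
      qed
      finally show ?thesis unfolding qx by (simp only: distrib_right)
    qed
    moreover have "0 \<le> ?\<nu>" using \<mu>(1) d by simp
    ultimately show ?thesis by blast
  qed
qed

lemma form_bound:
  assumes q: "hermitian_form q" and f: "hermitian_form f" and B: "finite B" and pos: "pos_on q (span B)"
  shows "\<exists>\<mu>\<ge>0. \<forall>x\<in>span B. Re (f x x) \<le> \<mu> * Re (q x x)"
  using B pos
proof (induction B rule: finite_induct)
  case empty
  then show ?case using form_zero_left[OF q] form_zero_left[OF f] by auto
next
  case (insert b B)
  have posB: "pos_on q (span B)"
    using insert.prems span_mono[of B "insert b B"] unfolding pos_on_def by blast
  obtain \<mu> where \<mu>: "\<mu> \<ge> 0" "\<And>x. x \<in> span B \<Longrightarrow> Re (f x x) \<le> \<mu> * Re (q x x)"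
    using insert.IH[OF posB] by blast
  obtain b' where b': "b' \<in> span (insert b B)" "\<And>y. y \<in> span B \<Longrightarrow> q y b' = 0"
    "\<And>x. x \<in> span (insert b B) \<Longrightarrow> \<exists>y\<in>span B. \<exists>k. x = y + k *s b'"
    using pos_on_orth_split[OF q insert.hyps(1) insert.prems] by metis
  obtain \<nu> where \<nu>: "\<nu> \<ge> 0" "\<And>x. x \<in> span B \<Longrightarrow> (cmod (f x b'))\<^sup>2 \<le> \<nu> * Re (q x x)"
    using functional_bound[OF q insert.hyps(1) posB, of "\<lambda>x. f x b'", OF form_add_left[OF f] form_scale_left[OF f]]
    by blast
  show ?case
  proof (cases "b' = 0")
    case True
    then have "span (insert b B) \<subseteq> span B" using b'(3) by fastforce
    then show ?thesis using \<mu> by blast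
  next
    case False
    \<comment> \<open>The cross term is split by \<open>2 a b <= a^2 + b^2\<close>: the 1 in
      \<open>?e\<close> pays for \<open>(cmod k)^2\<close>, and \<open>\<nu>\<close> for the other
      square.\<close>
    let ?d = "Re (q b' b')" and ?e = "\<bar>Re (f b' b')\<bar> + 1"
    have d: "0 < ?d" using False b'(1) insert.prems unfolding pos_on_def by blast
    let ?\<kappa> = "\<mu> + \<nu> + ?e / ?d"
    have "Re (f x x) \<le> ?\<kappa> * Re (q x x)" if x: "x \<in> span (insert b B)" for x
    proof -
      obtain y k where y: "y \<in> span B" and xy: "x = y + k *s b'" using b'(3)[OF x] by blast
      let ?q = "Re (q y y)"
      have q0: "0 \<le> ?q" using posB y form_zero_left[OF q, of 0] unfolding pos_on_def by (cases "y = 0") force+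
      have qx: "Re (q x x) = ?q + (cmod k)\<^sup>2 * ?d"
        using form_expand[OF q, of y k b'] b'(2)[OF y] xy by simp
      have "Re (cnj k * f y b') \<le> cmod k * cmod (f y b')"
        using complex_Re_le_cmod[of "cnj k * f y b'"] by (simp add: norm_mult)
      moreover have "2 * (cmod k * cmod (f y b')) \<le> (cmod k)\<^sup>2 + (cmod (f y b'))\<^sup>2"
        using sum_squares_bound[of "cmod k" "cmod (f y b')"] by simp
      moreover have "(cmod k)\<^sup>2 * Re (f b' b') \<le> (cmod k)\<^sup>2 * \<bar>Re (f b' b')\<bar>"
        by (simp add: mult_left_mono)
      ultimately have "Re (f x x) \<le> \<mu> * ?q + \<nu> * ?q + (cmod k)\<^sup>2 * ?e"
        using form_expand[OF f, of y k b'] \<mu>(2)[OF y] \<nu>(2)[OF y] xy by (simp add: distrib_left)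
      also have "\<dots> \<le> ?\<kappa> * (?q + (cmod k)\<^sup>2 * ?d)"
      proof -
        have "0 \<le> \<mu> * ((cmod k)\<^sup>2 * ?d)" "0 \<le> \<nu> * ((cmod k)\<^sup>2 * ?d)" "0 \<le> ?e / ?d * ?q"
          using \<mu>(1) \<nu>(1) d q0 by simp_all
        moreover have "?e / ?d * ((cmod k)\<^sup>2 * ?d) = (cmod k)\<^sup>2 * ?e" using d by simp
        ultimately show ?thesis unfolding distrib_left distrib_right by linarith
      qed
      finally show ?thesis unfolding qx .
    qed
    moreover have "0 \<le> ?\<kappa>" using \<mu>(1) \<nu>(1) d by simp
    ultimately show ?thesis by blast
  qed
qed

text \<open>A large multiple of \<open>q\<close> makes all directions outside \<open>Z\<close>
  positive without touching \<open>f\<close> on \<open>Z\<close>, so the index gains at least the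
  codimension of \<open>Z\<close>.\<close>

lemma penalty_index:
  assumes f: "hermitian_form f" and q: "hermitian_form q" and W: "subspace W" "fin_dim W"
    and Z: "subspace Z" "Z \<subseteq> W"
    and null: "\<And>z w. z \<in> Z \<Longrightarrow> w \<in> W \<Longrightarrow> q z w = 0"
    and pos: "\<And>w. w \<in> W \<Longrightarrow> w \<notin> Z \<Longrightarrow> 0 < Re (q w w)"
  shows "\<exists>\<mu>\<ge>0. pos_index f Z + dim W \<le> pos_index (\<lambda>x y. f x y + complex_of_real \<mu> * q x y) W + dim Z"
proof -
  have fZ: "fin_dim Z" using fin_dim_subset[OF W(2) Z(2)] .
  obtain P where P: "subspace P" "P \<subseteq> Z" "pos_on f P" "dim P = pos_index f Z"
    using pos_index_attained[OF fZ Z(1)] .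
  have PW: "P \<subseteq> W" using P(2) Z(2) by blast
  let ?O = "orth f P W"
  have sO: "subspace ?O" using subspace_orth[OF f W(1)] .
  have fO: "fin_dim ?O" using fin_dim_subset[OF W(2) orth_subset] .
  have OZ: "orth f P Z = Z \<inter> ?O" using Z(2) unfolding orth_def by blast
  have dW: "dim W = dim P + dim ?O" and dZ: "dim Z = dim P + dim (Z \<inter> ?O)"
    using orth_complement_pos(3)[OF f W P(1) PW P(3)] orth_complement_pos(3)[OF f Z(1) fZ P(1-3)] OZ by simp_all
  \<comment> \<open>\<open>C\<close> completes \<open>Z\<close> in the orthogonal complement of
    \<open>P\<close>, not just in \<open>W\<close>, so that \<open>P\<close> and \<open>C\<close>
    are orthogonal for \<open>f\<close>. Since \<open>q\<close> vanishes on \<open>Z\<close>, adding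
    it does not disturb this.\<close>
  obtain C where C: "subspace C" "C \<subseteq> ?O" "(Z \<inter> ?O) \<inter> C = {0}" "(Z \<inter> ?O) \<oplus>\<^sub>s C = ?O"
    using complement_exists[OF subspace_inter[OF Z(1) sO] sO Int_lower2] .
  have fC: "fin_dim C" using fin_dim_subset[OF fO C(2)] .
  have CW: "C \<subseteq> W" using C(2) orth_subset by blast
  have dO: "dim ?O = dim (Z \<inter> ?O) + dim C"
    using dim_complement[OF subspace_inter[OF Z(1) sO] C(1) fO C(3,4)] .
  obtain B where B: "finite B" "span B = C" using finite_basis[OF C(1) fC] by metis
  have qC: "pos_on q C" unfolding pos_on_def
  proof (intro ballI impI)
    fix x assume x: "x \<in> C" "x \<noteq> 0"
    have "x \<in> Z \<inter> ?O \<inter> C \<Longrightarrow> x = 0" unfolding C(3) by simp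
    then have "x \<notin> Z" using x C(2) by blast
    then show "0 < Re (q x x)" using pos CW x by blast
  qed
  obtain \<mu> where \<mu>: "\<mu> \<ge> 0" "\<And>x. x \<in> C \<Longrightarrow> Re (- f x x) \<le> \<mu> * Re (q x x)"
    using form_bound[OF q hermitian_form_uminus[OF f] B(1)] qC B(2) by auto
  \<comment> \<open>The bound \<open>\<mu>\<close> only gives a nonnegative sum on \<open>C\<close>;
    the extra 1 makes it positive.\<close>
  let ?g = "\<lambda>x y. f x y + complex_of_real (\<mu> + 1) * q x y"
  have g: "hermitian_form ?g" using hermitian_form_add[OF f hermitian_form_scale[OF q]] .
  have gP: "pos_on ?g P" using P(2,3) Z(2) null unfolding pos_on_def by (simp add: subset_iff)
  have gC: "pos_on ?g C" unfolding pos_on_def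
  proof (intro ballI impI)
    fix x assume x: "x \<in> C" "x \<noteq> 0"
    have "0 < Re (q x x)" using qC x unfolding pos_on_def by blast
    then show "0 < Re (?g x x)" using \<mu>(2)[OF x(1)] by (simp add: algebra_simps)
  qed
  have o: "?g x y = 0" if "x \<in> P" "y \<in> C" for x y
  proof -
    have "f y x = 0" using that C(2) unfolding orth_def by blast
    then have "f x y = 0" using form_sym_zero[OF f] by blast
    moreover have "q x y = 0" using null that P(2) CW by blast
    ultimately show ?thesis by simp
  qed
  have "P \<inter> C \<subseteq> {0}"
    using orth_complement_pos(2)[OF f W P(1) PW P(3)] C(2) by blast
  then have "dim (P \<oplus>\<^sub>s C) = dim P + dim C"
    using dim_subspace_sum[OF P(1) C(1) fin_dim_subset[OF fZ P(2)] fC] by blast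
  moreover have "dim (P \<oplus>\<^sub>s C) \<le> pos_index ?g W"
    using pos_index_ge[OF W(2,1) subspace_sum_subspace[OF P(1) C(1)] subspace_sum_subset[OF W(1) PW CW]
      pos_on_sum[OF g gP gC o]] by blast
  ultimately have "pos_index f Z + dim W \<le> pos_index ?g W + dim Z" using dW dZ dO P(4) by linarith
  then show ?thesis using \<mu>(1) by (intro exI[of _ "\<mu> + 1"]) simp
qed

text \<open>Maximal positive subspaces of the summands add up to a positive subspace, and their
  orthogonal complements within the summands to a nonpositive one.\<close>

lemma pos_index_orth_sum:
  assumes h: "hermitian_form h" and S: "subspace S" "fin_dim S" and T: "subspace T" "fin_dim T"
    and ST: "S \<inter> T = {0}" and o: "\<And>x y. x \<in> S \<Longrightarrow> y \<in> T \<Longrightarrow> h x y = 0"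
    and W: "fin_dim (S \<oplus>\<^sub>s T)"
  shows "pos_index h (S \<oplus>\<^sub>s T) = pos_index h S + pos_index h T"
proof -
  let ?W = "S \<oplus>\<^sub>s T"
  have sW: "subspace ?W" by (rule subspace_sum_subspace[OF S(1) T(1)])
  have SW: "S \<subseteq> ?W" and TW: "T \<subseteq> ?W" using subspace_sum_left[OF T(1)] subspace_sum_right[OF S(1)] by auto
  obtain P where P: "subspace P" "P \<subseteq> S" "pos_on h P" "dim P = pos_index h S"
    using pos_index_attained[OF S(2,1)] .
  obtain Q where Q: "subspace Q" "Q \<subseteq> T" "pos_on h Q" "dim Q = pos_index h T"
    using pos_index_attained[OF T(2,1)] .
  have fP: "fin_dim P" and fQ: "fin_dim Q" using fin_dim_subset[OF S(2) P(2)] fin_dim_subset[OF T(2) Q(2)] .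
  have PQ: "P \<inter> Q \<subseteq> {0}" using P(2) Q(2) ST by blast
  have posPQ: "pos_on h (P \<oplus>\<^sub>s Q)" using o P(2) Q(2) by (intro pos_on_sum[OF h P(3) Q(3)]) blast
  have "P \<oplus>\<^sub>s Q \<subseteq> ?W" using P(2) Q(2) SW TW by (intro subspace_sum_subset[OF sW]) auto
  then have 1: "dim P + dim Q \<le> pos_index h ?W"
    using pos_index_ge[OF W sW subspace_sum_subspace[OF P(1) Q(1)] _ posPQ]
      dim_subspace_sum[OF P(1) Q(1) fP fQ PQ] by simp
  let ?P = "orth h P S" and ?Q = "orth h Q T"
  have sP: "subspace ?P" and sQ: "subspace ?Q" using subspace_orth[OF h] S(1) T(1) by auto
  have fP': "fin_dim ?P" and fQ': "fin_dim ?Q"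
    using fin_dim_subset[OF S(2) orth_subset] fin_dim_subset[OF T(2) orth_subset] .
  have PQ': "?P \<inter> ?Q \<subseteq> {0}" using ST orth_subset by blast
  have sub: "?P \<oplus>\<^sub>s ?Q \<subseteq> ?W"
    using order_trans[OF orth_subset SW] order_trans[OF orth_subset TW] by (rule subspace_sum_subset[OF sW])
  have "pos_index h ?W + dim (?P \<oplus>\<^sub>s ?Q) \<le> dim ?W"
  proof (rule pos_index_le[OF W sW subspace_sum_subspace[OF sP sQ] sub])
    fix x assume "x \<in> ?P \<oplus>\<^sub>s ?Q"
    then obtain y z where yz: "x = y + z" "y \<in> ?P" "z \<in> ?Q" by (rule subspace_sumE)
    have "h y z = 0" using o yz(2,3) orth_subset by blast
    then have "Re (h x x) = Re (h y y) + Re (h z z)" using form_expand_orth[OF h] yz(1) by blast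
    then show "Re (h x x) \<le> 0"
      using orth_max_pos_nonpos[OF h S P yz(2)] orth_max_pos_nonpos[OF h T Q yz(3)] by linarith
  qed
  then have "pos_index h ?W + (dim ?P + dim ?Q) \<le> dim S + dim T"
    using dim_subspace_sum[OF sP sQ fP' fQ' PQ'] dim_subspace_sum[OF S(1) T(1) S(2) T(2)] ST by simp
  then show ?thesis
    using 1 orth_complement_pos(3)[OF h S P(1-3)] orth_complement_pos(3)[OF h T Q(1-3)] P(4) Q(4) by linarith
qed

lemma pos_index_image:
  assumes f: "lin f" and S: "subspace S" "fin_dim S" and i: "\<And>x. x \<in> S \<Longrightarrow> f x = 0 \<Longrightarrow> x = 0"
  shows "pos_index h (f ` S) = pos_index (\<lambda>x y. h (f x) (f y)) S"
proof (rule antisym)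
  interpret f: Vector_Spaces.linear scale scale f by (rule f)
  have fS: "subspace (f ` S)" "fin_dim (f ` S)" using f.subspace_image[OF S(1)] fin_dim_image[OF f S(2)] .
  obtain P where P: "subspace P" "P \<subseteq> f ` S" "pos_on h P" "dim P = pos_index h (f ` S)"
    using pos_index_attained[OF fS(2,1)] .
  let ?Q = "S \<inter> {x. f x \<in> P}"
  have Q: "subspace ?Q" using subspace_inter[OF S(1) f.subspace_linear_preimage[OF P(1)]] .
  have "f ` ?Q = P" using P(2) by blast
  then have "dim ?Q = dim P" using dim_image_inj[OF f Q] i by auto
  moreover have "pos_on (\<lambda>x y. h (f x) (f y)) ?Q"
    using P(3) i unfolding pos_on_def by blast
  ultimately show "pos_index h (f ` S) \<le> pos_index (\<lambda>x y. h (f x) (f y)) S"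
    using pos_index_ge[OF S(2,1) Q Int_lower1] P(4) by simp
next
  interpret f: Vector_Spaces.linear scale scale f by (rule f)
  have fS: "subspace (f ` S)" "fin_dim (f ` S)" using f.subspace_image[OF S(1)] fin_dim_image[OF f S(2)] .
  obtain P where P: "subspace P" "P \<subseteq> S" "pos_on (\<lambda>x y. h (f x) (f y)) P"
    "dim P = pos_index (\<lambda>x y. h (f x) (f y)) S"
    using pos_index_attained[OF S(2,1)] .
  have "dim (f ` P) = dim P" using i P(2) by (intro dim_image_inj[OF f P(1)]) blast
  moreover have "pos_on h (f ` P)"
    unfolding pos_on_def
  proof (intro ballI impI)
    fix y assume "y \<in> f ` P" "y \<noteq> 0"
    then obtain x where "y = f x" "x \<in> P" "x \<noteq> 0" using f.zero by blast
    then show "0 < Re (h y y)" using P(3) unfolding pos_on_def by blast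
  qed
  ultimately show "pos_index (\<lambda>x y. h (f x) (f y)) S \<le> pos_index h (f ` S)"
    using pos_index_ge[OF fS(2,1) f.subspace_image[OF P(1)] image_mono[OF P(2)]] P(4) by simp
qed

lemma dim_zero_subset: "S \<subseteq> {0} \<Longrightarrow> dim S = 0"
  using dim_le_card[of S "{}"] by simp

lemma pos_index_zero_iff:
  assumes h: "hermitian_form h" and W: "subspace W" "fin_dim W"
  shows "pos_index h W = 0 \<longleftrightarrow> (\<forall>x\<in>W. Re (h x x) \<le> 0)"
proof
  assume z: "pos_index h W = 0"
  have "pos_on h {0}" "{0} \<subseteq> W" using subspace_0[OF W(1)] by (auto simp: pos_on_def)
  then show "\<forall>x\<in>W. Re (h x x) \<le> 0"
    using orth_max_pos_nonpos[OF h W subspace_single_0] z form_zero_right[OF h] unfolding orth_def by auto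
next
  assume "\<forall>x\<in>W. Re (h x x) \<le> 0"
  then show "pos_index h W = 0" using pos_index_le[OF W(2,1) W(1) order_refl] by simp
qed

lemma pos_index_full_iff:
  assumes h: "hermitian_form h" and W: "subspace W" "fin_dim W"
  shows "pos_index h W = dim W \<longleftrightarrow> pos_on h W"
proof
  assume f: "pos_index h W = dim W"
  obtain P where P: "subspace P" "P \<subseteq> W" "pos_on h P" "dim P = pos_index h W"
    using pos_index_attained[OF W(2,1)] .
  then have "P = W" using dim_subspace_eq[OF P(1) W(1) P(2) W(2)] f by simp
  then show "pos_on h W" using P(3) by simp
next
  assume "pos_on h W"
  then have "dim W \<le> pos_index h W" using pos_index_ge[OF W(2,1) W(1) order_refl] by simp
  then show "pos_index h W = dim W" using inertia_sum[OF h W] by simp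
qed

section \<open>Inertia of forms with a prescribed part and an upper bound\<close>

text \<open>Positivity only sees the diagonal of a form.\<close>

lemma pos_index_cong:
  assumes "\<And>x. x \<in> W \<Longrightarrow> Re (h x x) = Re (k x x)"
  shows "pos_index h W = pos_index k W"
proof -
  have "pos_on h S = pos_on k S" if "S \<subseteq> W" for S
    using assms that unfolding pos_on_def by (metis subsetD)
  then show ?thesis unfolding pos_index_def by (metis (lifting))
qed

lemma dim_add_le:
  assumes "subspace S" "subspace T" "S \<subseteq> W" "T \<subseteq> W" "subspace W" "fin_dim W" "S \<inter> T \<subseteq> {0}"
  shows "dim S + dim T \<le> dim W"
proof -
  have "dim (S \<oplus>\<^sub>s T) = dim S + dim T"
    using dim_subspace_sum[OF assms(1,2) fin_dim_subset[OF assms(6,3)] fin_dim_subset[OF assms(6,4)] assms(7)] .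
  moreover have "dim (S \<oplus>\<^sub>s T) \<le> dim W"
    using dim_subspace_mono[OF subspace_sum_subset[OF assms(5,3,4)] assms(6)] .
  ultimately show ?thesis by simp
qed

text \<open>Replacing \<open>h\<close> by the form that agrees with it on the sum of the kernel of \<open>\<beta>\<close> and a maximal
  negative subspace, and vanishes on an \<open>h\<close>-orthogonal complement, keeps the negative index and
  makes the positive index minimal.\<close>

lemma minimal_pos_index_below:
  assumes h: "hermitian_form h" and \<beta>: "lin \<beta>" and W: "subspace W" "fin_dim W"
  defines "K \<equiv> {u \<in> W. \<beta> u = 0}"
  obtains y where "hermitian_form y" "\<forall>z. 0 \<le> Re (y z z)"
    "neg_index (\<lambda>u v. h u v - y (\<beta> u) (\<beta> v)) W \<le> neg_index h W"
    "pos_index (\<lambda>u v. h u v - y (\<beta> u) (\<beta> v)) W + neg_index h K + dim (K \<inter> radical h W) \<le> dim K"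
proof -
  interpret \<beta>: Vector_Spaces.linear scale scale \<beta> by (rule \<beta>)
  let ?mh = "\<lambda>x y. - h x y"
  have mh: "hermitian_form ?mh" using hermitian_form_uminus[OF h] .
  have K: "subspace K" "K \<subseteq> W" unfolding K_def using subspace_kernel_on[OF \<beta> W(1)] by auto
  have fK: "fin_dim K" using fin_dim_subset[OF W(2) K(2)] .
  obtain NK where NK: "subspace NK" "NK \<subseteq> K" "pos_on ?mh NK" "dim NK = neg_index h K"
    using pos_index_attained[OF fK K(1)] .
  have NKW: "NK \<subseteq> W" using NK(2) K(2) by blast
  let ?O = "orth h NK W"
  have sO: "subspace ?O" using subspace_orth[OF h W(1)] .
  have fO: "fin_dim ?O" using fin_dim_subset[OF W(2) orth_subset] .
  obtain N' where N': "subspace N'" "N' \<subseteq> ?O" "pos_on ?mh N'" "dim N' = neg_index h ?O"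
    using pos_index_attained[OF fO sO] .
  define N where "N = NK \<oplus>\<^sub>s N'"
  have N'W: "N' \<subseteq> W" using N'(2) orth_subset by blast
  have N: "subspace N" "N \<subseteq> W" "NK \<subseteq> N" "N' \<subseteq> N"
    unfolding N_def using subspace_sum_subspace[OF NK(1) N'(1)] subspace_sum_subset[OF W(1) NKW N'W]
      subspace_sum_left[OF N'(1)] subspace_sum_right[OF NK(1)] by auto
  have "h x y = 0" if "x \<in> NK" "y \<in> N'" for x y
  proof -
    have "h y x = 0" using that N'(2) unfolding orth_def by blast
    then show ?thesis using form_sym_zero[OF h] by blast
  qed
  then have posN: "pos_on ?mh N" unfolding N_def by (intro pos_on_sum[OF mh NK(3) N'(3)]) simp
  let ?Y = "orth h N W"
  have sY: "subspace ?Y" using subspace_orth[OF h W(1)] .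
  have YW: "?Y \<subseteq> W" by (rule orth_subset)
  have fY: "fin_dim ?Y" using fin_dim_subset[OF W(2) YW] .
  have nnY: "0 \<le> Re (h x x)" if x: "x \<in> ?Y" for x
  proof -
    have "x \<in> orth ?mh N' ?O" using x N(3,4) unfolding orth_def by auto
    then show ?thesis using orth_max_pos_nonpos[OF mh sO fO N'] by simp
  qed
  have NY: "N \<oplus>\<^sub>s ?Y = W" "N \<inter> ?Y = {0}" "dim W = dim N + dim ?Y"
    using orth_complement_pos[OF mh W N(1,2) posN] by simp_all
  obtain \<rho> where \<rho>: "lin \<rho>" "\<And>x. \<rho> x \<in> ?Y" "\<And>x. x \<in> ?Y \<Longrightarrow> \<rho> x = x" "\<And>x. x \<in> N \<Longrightarrow> \<rho> x = 0"
    "\<And>x. x \<in> W \<Longrightarrow> x - \<rho> x \<in> N"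
    using projection_along[OF N(1) sY NY(2)] unfolding NY(1) by metis
  interpret \<rho>: Vector_Spaces.linear scale scale \<rho> by (rule \<rho>(1))
  \<comment> \<open>The shadow of \<open>K\<close> in the nonnegative part \<open>?Y\<close> along
    \<open>N\<close>. Its dimension is at most \<open>dim K - dim NK\<close> because
    \<open>NK\<close> is projected to 0; this will bound the positive index.\<close>
  define K' where "K' = \<rho> ` K"
  have K': "subspace K'" "K' \<subseteq> ?Y" unfolding K'_def using \<rho>.subspace_image[OF K(1)] \<rho>(2) by auto
  have fK': "fin_dim K'" using fin_dim_subset[OF fY K'(2)] .
  have K'W: "K' \<subseteq> W" using K'(2) YW by blast
  have dK': "dim NK + dim K' \<le> dim K"
  proof -
    have "NK \<subseteq> {x \<in> K. \<rho> x = 0}" using NK(2) N(3) \<rho>(4) by blast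
    then have "dim NK \<le> dim {x \<in> K. \<rho> x = 0}"
      by (rule dim_subspace_mono) (rule fin_dim_subset[OF fK Collect_restrict])
    then show ?thesis using rank_nullity[OF \<rho>(1) K(1) fK] unfolding K'_def by simp
  qed
  let ?P = "orth h K' ?Y"
  have sP: "subspace ?P" using subspace_orth[OF h sY] .
  have nn: "nonneg_on h ?Y" using nnY unfolding nonneg_on_def by blast
  have KP: "K' \<oplus>\<^sub>s ?P = ?Y"
  proof (rule orth_complement[OF h sY K'(1) fK' K'(2)])
    show "h x w = 0" if "x \<in> K'" "w \<in> ?Y" "h x x = 0" for x w
      using nonneg_null_orth[OF h sY nn, of x w] that K'(2) by blast
  qed
  \<comment> \<open>\<open>K'\<close> and \<open>?P\<close> share the null vectors of
    \<open>h\<close> in \<open>K'\<close>, so only a complement of the overlap leads to a direct sum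
    of \<open>S\<close> and \<open>T\<close>.\<close>
  obtain T where T: "subspace T" "T \<subseteq> ?P" "(K' \<inter> ?P) \<inter> T = {0}" "(K' \<inter> ?P) \<oplus>\<^sub>s T = ?P"
    using complement_exists[OF subspace_inter[OF K'(1) sP] sP Int_lower2] .
  have TY: "T \<subseteq> ?Y" using T(2) orth_subset by blast
  have TW: "T \<subseteq> W" using TY YW by blast
  define S where "S = N \<oplus>\<^sub>s K'"
  have S: "subspace S" "S \<subseteq> W" "N \<subseteq> S" "K' \<subseteq> S" 
    unfolding S_def using subspace_sum_subspace[OF N(1) K'(1)] subspace_sum_subset[OF W(1) N(2) K'W]
      subspace_sum_left[OF K'(1)] subspace_sum_right[OF N(1)] by auto
  have KS: "K \<subseteq> S"
  proof
    fix k assume k: "k \<in> K"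
    have "k - \<rho> k \<in> N" "\<rho> k \<in> K'" using \<rho>(5) k K(2) unfolding K'_def by auto
    then show "k \<in> S" using subspace_sumI[of "k - \<rho> k" N "\<rho> k" K'] unfolding S_def by simp
  qed
  have ST0: "h x y = 0" if x: "x \<in> S" and y: "y \<in> T" for x y
  proof -
    obtain n k where nk: "x = n + k" "n \<in> N" "k \<in> K'" using x unfolding S_def by (rule subspace_sumE)
    have "h y n = 0" "h y k = 0" using y T(2) TY nk unfolding orth_def by blast+
    then have "h y x = 0" using nk by (simp add: form_simps[OF h])
    then show ?thesis using form_sym_zero[OF h] by blast
  qed
  have ST: "S \<inter> T = {0}"
  proof -
    have "x = 0" if x: "x \<in> S" "x \<in> T" for x
    proof -
      obtain n k where nk: "x = n + k" "n \<in> N" "k \<in> K'" using x(1) unfolding S_def by (rule subspace_sumE)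
      have "\<rho> x = k" using nk \<rho>(3,4) K'(2) by (simp add: \<rho>.add subset_iff)
      moreover have "\<rho> x = x" using \<rho>(3) x(2) TY by blast
      ultimately have "x \<in> (K' \<inter> ?P) \<inter> T" using nk x(2) T(2) by auto
      then show ?thesis unfolding T(3) by simp
    qed
    then show ?thesis using subspace_0[OF S(1)] subspace_0[OF T(1)] by blast
  qed
  have STW: "S \<oplus>\<^sub>s T = W"
  proof
    show "W \<subseteq> S \<oplus>\<^sub>s T"
    proof
      fix w assume "w \<in> W"
      then have "w \<in> N \<oplus>\<^sub>s ?Y" using NY(1) by simp
      then obtain n y where ny: "w = n + y" "n \<in> N" "y \<in> ?Y" by (rule subspace_sumE)
      have "y \<in> K' \<oplus>\<^sub>s ?P" using KP ny(3) by simp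
      then obtain k p where kp: "y = k + p" "k \<in> K'" "p \<in> ?P" by (rule subspace_sumE)
      have "p \<in> (K' \<inter> ?P) \<oplus>\<^sub>s T" using T(4) kp(3) by simp
      then obtain k' z where kz: "p = k' + z" "k' \<in> K' \<inter> ?P" "z \<in> T" by (rule subspace_sumE)
      have "n + (k + k') \<in> S" unfolding S_def
        using subspace_sumI[OF ny(2) subspace_add[OF K'(1) kp(2)]] kz(2) by blast
      moreover have "w = (n + (k + k')) + z" using ny kp kz by (simp add: algebra_simps)
      ultimately show "w \<in> S \<oplus>\<^sub>s T" using subspace_sumI kz(3) by metis
    qed
  qed (rule subspace_sum_subset[OF W(1) S(2) TW])
  obtain \<tau> where \<tau>: "lin \<tau>" "\<And>x. \<tau> x \<in> T" "\<And>x. x \<in> T \<Longrightarrow> \<tau> x = x" "\<And>x. x \<in> S \<Longrightarrow> \<tau> x = 0"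
    "\<And>x. x \<in> W \<Longrightarrow> x - \<tau> x \<in> S"
    using projection_along[OF S(1) T(1) ST] unfolding STW by metis
  interpret \<tau>: Vector_Spaces.linear scale scale \<tau> by (rule \<tau>(1))
  obtain \<gamma> where \<gamma>: "lin \<gamma>" "\<And>x. \<gamma> x \<in> W" "\<And>y. y \<in> \<beta> ` W \<Longrightarrow> \<beta> (\<gamma> y) = y"
    using linear_section[OF \<beta> W(1)] by metis
  interpret \<gamma>: Vector_Spaces.linear scale scale \<gamma> by (rule \<gamma>(1))
  \<comment> \<open>A preimage under \<open>\<beta>\<close> is determined up to \<open>K\<close>,
    and \<open>\<tau>\<close> kills \<open>K\<close>. So the form of \<open>h\<close> on
    \<open>T\<close>-components depends on \<open>\<beta> u\<close> and \<open>\<beta> v\<close>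
    alone and can be subtracted as \<open>y (\<beta> u) (\<beta> v)\<close>.\<close>
  have \<tau>\<gamma>: "\<tau> (\<gamma> (\<beta> w)) = \<tau> w" if w: "w \<in> W" for w
  proof -
    have "\<gamma> (\<beta> w) - w \<in> K"
      unfolding K_def using subspace_diff[OF W(1) \<gamma>(2) w] \<gamma>(3) w by (simp add: \<beta>.diff)
    then have "\<tau> (\<gamma> (\<beta> w) - w) = 0" using \<tau>(4) KS by blast
    then show ?thesis by (simp add: \<tau>.diff)
  qed
  define y where "y = (\<lambda>z z'. h (\<tau> (\<gamma> z)) (\<tau> (\<gamma> z')))"
  have y: "hermitian_form y" unfolding y_def
    using hermitian_form_pullback[OF hermitian_form_pullback[OF h \<tau>(1)] \<gamma>(1)] .
  have y0: "\<forall>z. 0 \<le> Re (y z z)" unfolding y_def using nnY \<tau>(2) TY by blast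
  let ?g = "\<lambda>u v. h u v - y (\<beta> u) (\<beta> v)"
  have g: "hermitian_form ?g" using hermitian_form_diff[OF h hermitian_form_pullback[OF y \<beta>]] .
  have mg: "hermitian_form (\<lambda>u v. - ?g u v)" using hermitian_form_uminus[OF g] .
  have gW: "?g u v = h u v - h (\<tau> u) (\<tau> v)" if "u \<in> W" "v \<in> W" for u v
    unfolding y_def using \<tau>\<gamma> that by simp
  have gS: "?g u v = h (u - \<tau> u) (v - \<tau> v)" if u: "u \<in> W" and v: "v \<in> W" for u v
  proof -
    have "h (u - \<tau> u) (\<tau> v) = 0" using ST0[OF \<tau>(5)[OF u] \<tau>(2)] .
    moreover have "h (v - \<tau> v) (\<tau> u) = 0" using ST0[OF \<tau>(5)[OF v] \<tau>(2)] .
    then have "h (\<tau> u) (v - \<tau> v) = 0" using form_sym_zero[OF h] by blast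
    ultimately show ?thesis unfolding gW[OF u v] by (simp add: form_diff_left[OF h] form_diff_right[OF h])
  qed
  have negg: "neg_index ?g W + dim ?Y \<le> dim W"
  proof (rule pos_index_le[OF W(2,1) sY YW])
    fix x assume x: "x \<in> ?Y"
    then have xW: "x \<in> W" using YW by blast
    have "x - \<tau> x \<in> ?Y" using subspace_diff[OF sY x] \<tau>(2) TY by blast
    then show "Re (- ?g x x) \<le> 0" using nnY gS[OF xW xW] by simp
  qed
  have dimN: "dim N \<le> neg_index h W" using pos_index_ge[OF W(2,1) N(1,2) posN] .
  have "pos_on (\<lambda>u v. - ?g u v) N" unfolding pos_on_def
  proof (intro ballI impI)
    fix x assume x: "x \<in> N" "x \<noteq> 0"
    have "?g x x = h x x" using gS[of x x] x N(2) \<tau>(4) S(3) by (simp add: subset_iff)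
    then show "0 < Re (- ?g x x)" using posN x unfolding pos_on_def by simp
  qed
  then have dimN': "dim N \<le> neg_index ?g W" using pos_index_ge[OF W(2,1) N(1,2)] by blast
  let ?K1 = "K \<inter> radical h W"
  have sK1: "subspace ?K1" using subspace_inter[OF K(1) subspace_orth[OF h W(1)]] .
  \<comment> \<open>The subtraction makes \<open>T\<close> null. With \<open>T\<close> and
    \<open>?K1\<close> in the radical and \<open>N\<close> negative, \<open>inertia_sum\<close>
    leaves at most \<open>dim K' - dim ?K1\<close> for the positive index.\<close>
  have "T \<subseteq> radical ?g W"
  proof
    fix x assume x: "x \<in> T"
    have "?g x w = 0" if "w \<in> W" for w
      using gS[of x w] x TW that \<tau>(3) by (simp add: subset_iff form_zero_left[OF h])
    then show "x \<in> radical ?g W" using x TW unfolding orth_def by blast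
  qed
  moreover have "?K1 \<subseteq> radical ?g W"
  proof
    fix x assume x: "x \<in> ?K1"
    have "?g x w = 0" if "w \<in> W" for w
      using x that form_zero_left[OF y] unfolding orth_def K_def by simp
    then show "x \<in> radical ?g W" using x K(2) unfolding orth_def by blast
  qed
  moreover have "T \<inter> ?K1 \<subseteq> {0}" using ST KS by blast
  ultimately have "dim T + dim ?K1 \<le> dim (radical ?g W)"
    by (rule dim_add_le[OF T(1) sK1 _ _ subspace_orth[OF g W(1)] fin_dim_subset[OF W(2) orth_subset]])
  moreover have "dim W = dim S + dim T" using dim_complement[OF S(1) T(1) W(2) ST STW] .
  moreover have "N \<inter> K' \<subseteq> {0}" using NY(2) K'(2) by blast
  then have "dim S = dim N + dim K'"
    unfolding S_def by (rule dim_subspace_sum[OF N(1) K'(1) fin_dim_subset[OF W(2) N(2)] fK'])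
  moreover note inertia_sum[OF g W]
  ultimately have "pos_index ?g W + neg_index h K + dim ?K1 \<le> dim K" using dimN' dK' NK(4) by linarith
  moreover have "neg_index ?g W \<le> neg_index h W" using negg dimN NY(3) by linarith
  ultimately show thesis using that[OF y y0] by blast
qed

end

section \<open>Extremal indices of a form completed under a one-sided bound\<close>

locale bounded_form_completion = complex_vector_space scale
  for scale :: "complex \<Rightarrow> 'b::ab_group_add \<Rightarrow> 'b" (infixr \<open>*s\<close> 75) +
  fixes a s ip :: "'b \<Rightarrow> 'b \<Rightarrow> complex" and \<beta> :: "'b \<Rightarrow> 'b" and W V U :: "'b set"
  assumes a: "hermitian_form a" and s: "hermitian_form s" and ip: "hermitian_form ip"
    and \<beta>: "lin \<beta>" and W: "subspace W" "fin_dim W" and V: "subspace V" "V \<subseteq> U"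
    and U: "subspace U" "pos_on ip U" "\<beta> ` W \<subseteq> U"
begin

sublocale \<beta>: Vector_Spaces.linear scale scale \<beta> by (rule \<beta>)

abbreviation "K \<equiv> {u \<in> W. \<beta> u = 0}"
abbreviation "W0 \<equiv> {u \<in> W. \<beta> u \<in> V}"
abbreviation "F x \<equiv> \<lambda>u v. a u v - x (\<beta> u) (\<beta> v)"
text \<open>The two defects of \<open>K\<close>: in matrix terms \<open>k1 = m1 - r[A1, B1]\<close>
  and \<open>k2 = m1 + r[B1; B2] - r(N)\<close>, see \<open>rank_A1B1\<close> and
  \<open>rank_N\<close>.\<close>

abbreviation "k1 \<equiv> dim (K \<inter> radical a W)"
abbreviation "k2 \<equiv> dim (K \<inter> radical (F s) W0)"

definition admissible :: "('b \<Rightarrow> 'b \<Rightarrow> complex) \<Rightarrow> bool" where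
  "admissible x \<longleftrightarrow> hermitian_form x \<and> (\<forall>y\<in>V. Re (s y y) \<le> Re (x y y))"

lemma F_hermitian: "hermitian_form x \<Longrightarrow> hermitian_form (F x)"
  by (rule hermitian_form_diff[OF a hermitian_form_pullback[OF _ \<beta>]])

lemma K_subspace: "subspace K" by (rule subspace_kernel_on[OF \<beta> W(1)])

lemma K_fin: "fin_dim K" by (rule fin_dim_subset[OF W(2) Collect_restrict])

lemma W0_subspace: "subspace W0"
proof -
  have "W0 = W \<inter> {u. \<beta> u \<in> V}" by blast
  then show ?thesis using subspace_inter[OF W(1) \<beta>.subspace_linear_preimage[OF V(1)]] by simp
qed

lemma W0_fin: "fin_dim W0" by (rule fin_dim_subset[OF W(2) Collect_restrict])

lemma K_W0: "K \<subseteq> W0" using subspace_0[OF V(1)] by auto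

lemma F_K: "hermitian_form x \<Longrightarrow> \<beta> k = 0 \<Longrightarrow> F x k u = a k u"
  by (simp add: form_zero_left)

text \<open>\<open>x\<close> is invisible on \<open>K\<close>, so these vectors are null for every
  choice of \<open>x\<close>; their dimension is a rank defect that cannot be avoided.\<close>

lemma K_radical: "hermitian_form x \<Longrightarrow> K \<inter> radical a W \<subseteq> radical (F x) W"
  unfolding orth_def by (auto simp: form_zero_left)

lemma radical_ge: "hermitian_form x \<Longrightarrow> k1 \<le> dim (radical (F x) W)"
  using dim_subspace_mono[OF K_radical fin_dim_subset[OF W(2) orth_subset]] .

text \<open>A negative subspace of \<open>F s\<close> on \<open>W0\<close> stays negative because
  \<open>F x\<close> lies below \<open>F s\<close> there. Adding \<open>?Z\<close> does not change
  the values, yet vectors of the sum are null for \<open>F x\<close> on all of \<open>W\<close> only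
  if they lie in \<open>K \<inter> radical a W\<close>; \<open>dim_nonneg_le\<close> counts the
  others as negative directions.\<close>

lemma neg_index_ge:
  assumes x: "admissible x"
  shows "neg_index (F s) W0 + k2 \<le> neg_index (F x) W + k1"
proof -
  have hx: "hermitian_form x" and xs: "\<And>y. y \<in> V \<Longrightarrow> Re (s y y) \<le> Re (x y y)"
    using x unfolding admissible_def by auto
  have hF: "hermitian_form (\<lambda>u v. - F x u v)" using hermitian_form_uminus[OF F_hermitian[OF hx]] .
  obtain N where N: "subspace N" "N \<subseteq> W0" "pos_on (\<lambda>u v. - F s u v) N" "dim N = neg_index (F s) W0"
    using pos_index_attained[OF W0_fin W0_subspace] .
  let ?Z = "K \<inter> radical (F s) W0"
  have sZ: "subspace ?Z" using subspace_inter[OF K_subspace subspace_orth[OF F_hermitian[OF s] W0_subspace]] .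
  have NZ: "N \<inter> ?Z \<subseteq> {0}"
    using pos_on_null[OF N(3)] N(2) unfolding orth_def by auto
  have NW: "N \<subseteq> W" using N(2) by blast
  let ?S = "N \<oplus>\<^sub>s ?Z"
  have S: "subspace ?S" "?S \<subseteq> W"
    using subspace_sum_subspace[OF N(1) sZ] subspace_sum_subset[OF W(1) NW, of ?Z] by auto
  have val: "Re (F x n n) \<le> Re (F s n n)" "F x (n + z) (n + z) = F x n n" 
    if n: "n \<in> N" and z: "z \<in> ?Z" for n z
  proof -
    show "Re (F x n n) \<le> Re (F s n n)" using xs n N(2) by auto
    have zn: "a z w = 0" if "w \<in> W0" for w
      using z that unfolding orth_def by (auto simp: form_zero_left[OF s])
    have "F x z n = 0" "F x z z = 0" using zn n z N(2) K_W0 by (auto simp: form_zero_left[OF hx])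
    moreover then have "F x n z = 0" using form_sym_zero[OF F_hermitian[OF hx]] by blast
    ultimately show "F x (n + z) (n + z) = F x n n"
      by (simp only: form_add_left[OF F_hermitian[OF hx]] form_add_right[OF F_hermitian[OF hx]]) simp
  qed
  have Fsn: "Re (F s n n) \<le> 0" if "n \<in> N" for n
    using N(3) that form_zero_left[OF F_hermitian[OF s], of 0] unfolding pos_on_def by (cases "n = 0") force+
  have nn: "nonneg_on (\<lambda>u v. - F x u v) ?S"
    unfolding nonneg_on_def
  proof
    fix w assume "w \<in> ?S"
    then obtain n z where w: "w = n + z" "n \<in> N" "z \<in> ?Z" by (rule subspace_sumE)
    then show "0 \<le> Re (- F x w w)" using val[OF w(2,3)] Fsn[OF w(2)] by simp
  qed
  \<comment> \<open>A vector of \<open>?S\<close> has the value of its \<open>N\<close>-component,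
    which is negative unless that component is 0. A null vector therefore lies in \<open>?Z\<close>,
    hence in \<open>K\<close>, where \<open>F x\<close> is \<open>a\<close>.\<close>
  have "?S \<inter> radical (\<lambda>u v. - F x u v) W \<subseteq> K \<inter> radical a W"
  proof
    fix w assume w: "w \<in> ?S \<inter> radical (\<lambda>u v. - F x u v) W"
    then obtain n z where nz: "w = n + z" "n \<in> N" "z \<in> ?Z" by (blast elim: subspace_sumE)
    have r: "F x w u = 0" if "u \<in> W" for u using w that unfolding orth_def by auto
    have "F x n n = 0" using r[of w] w S(2) val(2)[OF nz(2,3)] nz(1) by auto
    then have "Re (F s n n) \<ge> 0" using val(1)[OF nz(2,3)] by simp
    then have "n = 0" using N(3) nz(2) unfolding pos_on_def by force
    then have "w \<in> K" using nz by simp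
    moreover then have "a w u = 0" if "u \<in> W" for u
      using r[OF that] by (simp add: form_zero_left[OF hx])
    ultimately show "w \<in> K \<inter> radical a W" unfolding orth_def by blast
  qed
  then have "dim (?S \<inter> radical (\<lambda>u v. - F x u v) W) \<le> k1"
    by (rule dim_subspace_mono) (rule fin_dim_subset[OF K_fin Int_lower1])
  moreover have "dim ?S = dim N + k2"
    by (rule dim_subspace_sum[OF N(1) sZ fin_dim_subset[OF W(2) NW] fin_dim_subset[OF K_fin Int_lower1] NZ])
  ultimately show ?thesis using dim_nonneg_le[OF hF W S nn] N(4) by linarith
qed

text \<open>All \<open>F x\<close> agree with \<open>a\<close> on \<open>K\<close>. There
  \<open>?Q\<close> is nonnegative of dimension \<open>dim K - neg_index a K\<close>, which limits
  the negative index from above and, through \<open>dim_nonneg_le\<close>, the positive index from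
  below.\<close>

lemma neg_index_upper:
  assumes x: "hermitian_form x"
  shows "neg_index (F x) W + dim K \<le> dim W + neg_index a K"
    and pos_index_lower: "dim K \<le> pos_index (F x) W + neg_index a K + k1"
proof -
  have ma: "hermitian_form (\<lambda>u v. - a u v)" using hermitian_form_uminus[OF a] .
  obtain N where N: "subspace N" "N \<subseteq> K" "pos_on (\<lambda>u v. - a u v) N" "dim N = neg_index a K"
    using pos_index_attained[OF K_fin K_subspace] .
  let ?Q = "orth a N K"
  have sQ: "subspace ?Q" using subspace_orth[OF a K_subspace] .
  have dK: "dim K = dim N + dim ?Q" using orth_complement_pos(3)[OF ma K_subspace K_fin N(1-3)] by simp
  have QW: "?Q \<subseteq> W" unfolding orth_def by blast
  have FQ: "F x q q = a q q" if "q \<in> ?Q" for q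
    using that by (intro F_K[OF x]) (simp add: orth_def)
  have aQ: "0 \<le> Re (a q q)" if "q \<in> ?Q" for q
    using orth_max_pos_nonpos[OF ma K_subspace K_fin N, of q] that by simp
  have "neg_index (F x) W + dim ?Q \<le> dim W"
    by (rule pos_index_le[OF W(2,1) sQ QW]) (use FQ aQ in simp)
  then show "neg_index (F x) W + dim K \<le> dim W + neg_index a K" using dK N(4) by simp
  have "?Q \<inter> radical (F x) W \<subseteq> K \<inter> radical a W"
    unfolding orth_def by (auto simp: form_zero_left[OF x])
  then have "dim (?Q \<inter> radical (F x) W) \<le> k1"
    by (rule dim_subspace_mono) (rule fin_dim_subset[OF K_fin Int_lower1])
  moreover have "nonneg_on (F x) ?Q" unfolding nonneg_on_def using FQ aQ by simp
  ultimately show "dim K \<le> pos_index (F x) W + neg_index a K + k1"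
    using dim_nonneg_le[OF F_hermitian[OF x] W sQ QW] dK N(4) by linarith
qed

text \<open>A positive subspace of \<open>F x\<close> cut down to \<open>W0\<close> is positive for
  the larger form \<open>F s\<close>, and the cut loses at most the codimension of
  \<open>W0\<close>.\<close>

lemma pos_index_upper:
  assumes x: "admissible x"
  shows "pos_index (F x) W + dim W0 \<le> dim W + pos_index (F s) W0"
proof -
  obtain P where P: "subspace P" "P \<subseteq> W" "pos_on (F x) P" "dim P = pos_index (F x) W"
    using pos_index_attained[OF W(2,1)] .
  have "pos_on (F s) (P \<inter> W0)"
    unfolding pos_on_def
  proof (intro ballI impI)
    fix u assume u: "u \<in> P \<inter> W0" "u \<noteq> 0"
    have "0 < Re (F x u u)" using P(3) u unfolding pos_on_def by blast
    moreover have "Re (s (\<beta> u) (\<beta> u)) \<le> Re (x (\<beta> u) (\<beta> u))" using x u unfolding admissible_def by blast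
    ultimately show "0 < Re (F s u u)" by simp
  qed
  then have "dim (P \<inter> W0) \<le> pos_index (F s) W0"
    by (rule pos_index_ge[OF W0_fin W0_subspace subspace_inter[OF P(1) W0_subspace] Int_lower2])
  then show ?thesis using dim_Int_ge[OF P(1) W0_subspace W(1) P(2) Collect_restrict W(2)] P(4) by simp
qed

lemma inner_nonneg: "y \<in> U \<Longrightarrow> 0 \<le> Re (ip y y)"
  using U(2) form_zero_left[OF ip, of 0] unfolding pos_on_def by (cases "y = 0") force+

text \<open>The witness is \<open>s\<close> plus a multiple of \<open>ip\<close>, where
  \<open>penalty_index\<close> applied to \<open>- F s\<close> with \<open>Z = K\<close> provides
  the factor. Adding a nonnegative form respects the constraint.\<close>

lemma neg_index_max_attained:
  "\<exists>x. admissible x \<and> dim W + neg_index a K \<le> neg_index (F x) W + dim K"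
proof -
  let ?q = "\<lambda>u v. ip (\<beta> u) (\<beta> v)"
  have "\<exists>\<mu>\<ge>0. pos_index (\<lambda>u v. - F s u v) K + dim W
      \<le> pos_index (\<lambda>u v. - F s u v + complex_of_real \<mu> * ?q u v) W + dim K"
  proof (rule penalty_index[OF hermitian_form_uminus[OF F_hermitian[OF s]] hermitian_form_pullback[OF ip \<beta>]
        W K_subspace Collect_restrict])
    show "?q z w = 0" if "z \<in> K" "w \<in> W" for z w using that form_zero_left[OF ip] by simp
    show "0 < Re (?q w w)" if "w \<in> W" "w \<notin> K" for w
      using that U(2,3) unfolding pos_on_def by blast
  qed
  then obtain \<mu> where \<mu>: "\<mu> \<ge> 0" "neg_index (F s) K + dim W
      \<le> pos_index (\<lambda>u v. - F s u v + complex_of_real \<mu> * ?q u v) W + dim K" by blast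
  let ?x = "\<lambda>y z. s y z + complex_of_real \<mu> * ip y z"
  have "neg_index (F s) K = neg_index a K"
    by (rule pos_index_cong) (simp add: form_zero_left[OF s])
  moreover have "(\<lambda>u v. - F s u v + complex_of_real \<mu> * ?q u v) = (\<lambda>u v. - F ?x u v)"
    by (simp add: fun_eq_iff algebra_simps)
  moreover have "admissible ?x"
    unfolding admissible_def
  proof (intro conjI ballI)
    show "hermitian_form ?x" using hermitian_form_add[OF s hermitian_form_scale[OF ip]] .
    fix y assume "y \<in> V"
    then have "0 \<le> Re (ip y y)" using inner_nonneg V(2) by blast
    then show "Re (s y y) \<le> Re (?x y y)" using \<mu>(1) by simp
  qed
  ultimately show ?thesis using \<mu>(2) by (intro exI[of _ ?x]) simp
qed

lemma pos_index_max_attained: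
  obtains x where "admissible x" "dim W + pos_index (F s) W0 \<le> pos_index (F x) W + dim W0"
    "neg_index (F x) W + k1 \<le> neg_index (F s) W0 + k2"
proof -
  let ?t = "F s" and ?R = "radical (F s) W0"
  have ht: "hermitian_form ?t" using F_hermitian[OF s] .
  have sR: "subspace ?R" using subspace_orth[OF ht W0_subspace] .
  have fR: "fin_dim ?R" using fin_dim_subset[OF W0_fin orth_subset] .
  have sKR: "subspace (K \<inter> ?R)" using subspace_inter[OF K_subspace sR] .
  \<comment> \<open>\<open>\<beta>\<close> is injective on \<open>R'\<close> (this is
    \<open>R'0\<close>), so values of a form can be prescribed on its image. On
    \<open>K \<inter> ?R\<close> no choice of \<open>x\<close> has any effect.\<close>
  obtain R' where R': "subspace R'" "R' \<subseteq> ?R" "(K \<inter> ?R) \<inter> R' = {0}" "(K \<inter> ?R) \<oplus>\<^sub>s R' = ?R"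
    using complement_exists[OF sKR sR Int_lower2] .
  have dR: "dim ?R = k2 + dim R'" using dim_complement[OF sKR R'(1) fR R'(3,4)] .
  have R'W0: "R' \<subseteq> W0" using R'(2) orth_subset by blast
  have sbW: "subspace (\<beta> ` W)" using \<beta>.subspace_image[OF W(1)] .
  \<comment> \<open>\<open>C\<close> supplements \<open>V\<close> inside the range of
    \<open>\<beta>\<close>; there the constraint says nothing, and the projection
    \<open>\<kappa>\<close> measures how far \<open>\<beta> w\<close> is from
    \<open>V\<close>.\<close>
  obtain C where C: "subspace C" "C \<subseteq> \<beta> ` W" "(\<beta> ` W \<inter> V) \<inter> C = {0}" "(\<beta> ` W \<inter> V) \<oplus>\<^sub>s C = \<beta> ` W"
    using complement_exists[OF subspace_inter[OF sbW V(1)] sbW Int_lower1] .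
  have VC: "V \<inter> C = {0}"
  proof -
    have "V \<inter> C = (\<beta> ` W \<inter> V) \<inter> C" using C(2) by blast
    then show ?thesis using C(3) by simp
  qed
  have sVC: "subspace (V \<oplus>\<^sub>s C)" using subspace_sum_subspace[OF V(1) C(1)] .
  have VCU: "V \<oplus>\<^sub>s C \<subseteq> U" using subspace_sum_subset[OF U(1) V(2)] C(2) U(3) by blast
  have bWVC: "\<beta> ` W \<subseteq> V \<oplus>\<^sub>s C"
    using C(4) unfolding subspace_sum_def by blast
  obtain \<kappa> where \<kappa>: "lin \<kappa>" "\<And>x. \<kappa> x \<in> C" "\<And>x. x \<in> C \<Longrightarrow> \<kappa> x = x" "\<And>x. x \<in> V \<Longrightarrow> \<kappa> x = 0"
    "\<And>x. x \<in> V \<oplus>\<^sub>s C \<Longrightarrow> x - \<kappa> x \<in> V"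
    using projection_along[OF V(1) C(1) VC] by metis
  interpret \<kappa>: Vector_Spaces.linear scale scale \<kappa> by (rule \<kappa>(1))
  have CV: "C \<inter> V = {0}" using VC by blast
  obtain \<pi> where \<pi>: "lin \<pi>" "\<And>x. \<pi> x \<in> V" "\<And>x. x \<in> V \<Longrightarrow> \<pi> x = x" "\<And>x. x \<in> C \<Longrightarrow> \<pi> x = 0"
    using projection_along[OF C(1) V(1) CV] by metis
  interpret \<pi>: Vector_Spaces.linear scale scale \<pi> by (rule \<pi>(1))
  obtain \<gamma> where \<gamma>: "lin \<gamma>" "\<And>x. \<gamma> x \<in> W" "\<And>y. y \<in> \<beta> ` W \<Longrightarrow> \<beta> (\<gamma> y) = y"
    using linear_section[OF \<beta> W(1)] by metis
  interpret \<gamma>: Vector_Spaces.linear scale scale \<gamma> by (rule \<gamma>(1))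
  have R'0: "r = 0" if r: "r \<in> R'" "\<beta> r = 0" for r
  proof -
    have "r \<in> (K \<inter> ?R) \<inter> R'" using r R'(2) R'W0 by blast
    then show ?thesis unfolding R'(3) by simp
  qed
  obtain \<delta> where \<delta>: "lin \<delta>" "\<And>x. \<delta> x \<in> R'" "\<And>y. y \<in> R' \<Longrightarrow> \<delta> (\<beta> y) = y"
    using linear_left_inverse[OF \<beta> R'(1) R'0] by metis
  interpret \<delta>: Vector_Spaces.linear scale scale \<delta> by (rule \<delta>(1))
  \<comment> \<open>\<open>s\<close> on \<open>V\<close>, plus cross terms between \<open>V\<close>
    and \<open>C\<close>. They are the values \<open>a r (\<gamma> c)\<close> forced by the wish
    that \<open>F x' r u\<close> vanish for \<open>r\<close> in \<open>R'\<close>;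
    \<open>\<delta>\<close> recovers \<open>r\<close> from \<open>\<beta> r\<close>.\<close>
  define x' where "x' = (\<lambda>y z. s (\<pi> y) (\<pi> z) + (a (\<delta> (\<pi> y)) (\<gamma> (\<kappa> z)) + a (\<gamma> (\<kappa> y)) (\<delta> (\<pi> z))))"
  have hx': "hermitian_form x'"
    unfolding x'_def
  proof (rule hermitian_form_add[OF hermitian_form_pullback[OF s \<pi>(1)]], rule hermitian_formI)
    fix y z
    show "a (\<delta> (\<pi> z)) (\<gamma> (\<kappa> y)) + a (\<gamma> (\<kappa> z)) (\<delta> (\<pi> y)) = cnj (a (\<delta> (\<pi> y)) (\<gamma> (\<kappa> z)) + a (\<gamma> (\<kappa> y)) (\<delta> (\<pi> z)))"
      using form_cnj[OF a, of "\<delta> (\<pi> z)" "\<gamma> (\<kappa> y)"] form_cnj[OF a, of "\<gamma> (\<kappa> z)" "\<delta> (\<pi> y)"] by simp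
  qed (simp_all add: \<pi>.add \<delta>.add \<kappa>.add \<gamma>.add \<pi>.scale \<delta>.scale \<kappa>.scale \<gamma>.scale
      form_add_left[OF a] form_scale_left[OF a] algebra_simps)
  have x'V: "x' y z = s y z" if "y \<in> V" "z \<in> V" for y z
    using that \<pi>(3) \<kappa>(4) by (simp add: x'_def \<gamma>.zero form_zero_left[OF a] form_zero_right[OF a])
  \<comment> \<open>Modulo \<open>K\<close>, where \<open>a r\<close> vanishes, \<open>u\<close>
    equals \<open>u0 + \<gamma> c\<close> with \<open>u0\<close> in \<open>W0\<close>. On
    \<open>u0\<close> the vector \<open>r\<close> is null for \<open>F s\<close>; on
    \<open>\<gamma> c\<close> the cross term of \<open>x'\<close> cancels
    \<open>a r\<close>.\<close>
  have x'R: "F x' r u = 0" if r: "r \<in> R'" and u: "u \<in> W" for r u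
  proof -
    have rV: "\<beta> r \<in> V" using r R'W0 by blast
    obtain w c where wc: "\<beta> u = w + c" "w \<in> \<beta> ` W \<inter> V" "c \<in> C"
      using u C(4) by (metis imageI subspace_sumE)
    obtain u0 where u0: "u0 \<in> W" "w = \<beta> u0" using wc(2) by blast
    then have u0W: "u0 \<in> W0" using wc(2) by blast
    have rt: "F s r v = 0" if "v \<in> W0" for v using r R'(2) that unfolding orth_def by blast
    have "\<gamma> c \<in> W" "\<beta> (\<gamma> c) = c" using \<gamma>(2,3) wc(3) C(2) by blast+
    then have "u - u0 - \<gamma> c \<in> K"
      using u u0 wc(1) by (simp add: subspace_diff[OF W(1)] \<beta>.diff)
    then have "F s r (u - u0 - \<gamma> c) = 0" "\<beta> (u - u0 - \<gamma> c) = 0" using rt K_W0 by blast+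
    then have "a r (u - u0 - \<gamma> c) = 0" by (simp add: form_zero_right[OF s])
    then have "a r u = a r u0 + a r (\<gamma> c)" by (simp add: form_diff_right[OF a] diff_eq_eq add.commute)
    moreover have "a r u0 = s (\<beta> r) w" using rt[OF u0W] u0 by simp
    moreover have "\<pi> (\<beta> r) = \<beta> r" "\<kappa> (\<beta> r) = 0" "\<delta> (\<beta> r) = r" using rV r \<pi>(3) \<kappa>(4) \<delta>(3) by auto
    moreover have "\<pi> (\<beta> u) = w" "\<kappa> (\<beta> u) = c"
      using wc \<pi>(3,4) \<kappa>(3,4) by (auto simp: \<pi>.add \<kappa>.add)
    ultimately show ?thesis by (simp add: x'_def \<gamma>.zero form_zero_left[OF a])
  qed
  define q where "q = (\<lambda>u v. ip (\<kappa> (\<beta> u)) (\<kappa> (\<beta> v)))"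
  have hq0: "hermitian_form (\<lambda>y z. ip (\<kappa> y) (\<kappa> z))" using hermitian_form_pullback[OF ip \<kappa>(1)] .
  have hq: "hermitian_form q" unfolding q_def using hermitian_form_pullback[OF hq0 \<beta>] .
  have q0: "q z w = 0" if "z \<in> W0" for z w
    using that \<kappa>(4) by (simp add: q_def form_zero_left[OF ip])
  have "\<exists>\<mu>\<ge>0. pos_index (F x') W0 + dim W \<le> pos_index (\<lambda>u v. F x' u v + complex_of_real \<mu> * q u v) W + dim W0"
  proof (rule penalty_index[OF F_hermitian[OF hx'] hq W W0_subspace Collect_restrict])
    show "q z w = 0" if "z \<in> W0" for z w by (rule q0[OF that])
    show "0 < Re (q w w)" if w: "w \<in> W" "w \<notin> W0" for w
    proof -
      have "\<beta> w - \<kappa> (\<beta> w) \<in> V" using \<kappa>(5) bWVC w(1) by blast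
      then have "\<kappa> (\<beta> w) \<noteq> 0" using w by auto
      moreover have "\<kappa> (\<beta> w) \<in> U" using \<kappa>(2) C(2) U(3) by blast
      ultimately show ?thesis using U(2) unfolding q_def pos_on_def by blast
    qed
  qed
  then obtain \<mu> where \<mu>: "\<mu> \<ge> 0"
    "pos_index (F x') W0 + dim W \<le> pos_index (\<lambda>u v. F x' u v + complex_of_real \<mu> * q u v) W + dim W0"
    by blast
  \<comment> \<open>The penalty sees only the \<open>C\<close>-component, so on \<open>V\<close> the
    constraint holds with equality.\<close>
  define x where "x = (\<lambda>y z. x' y z - complex_of_real \<mu> * ip (\<kappa> y) (\<kappa> z))"
  have hx: "hermitian_form x" unfolding x_def using hermitian_form_diff[OF hx' hermitian_form_scale[OF hq0]] .
  have Fx: "F x = (\<lambda>u v. F x' u v + complex_of_real \<mu> * q u v)"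
    by (simp add: x_def q_def fun_eq_iff algebra_simps)
  have "admissible x"
    unfolding admissible_def using hx x'V \<kappa>(4) by (simp add: x_def form_zero_left[OF ip])
  moreover have "pos_index (F x') W0 = pos_index (F s) W0"
    by (rule pos_index_cong) (simp add: x'V)
  then have p: "dim W + pos_index (F s) W0 \<le> pos_index (F x) W + dim W0" using \<mu>(2) Fx by simp
  moreover have "neg_index (F x) W + k1 \<le> neg_index (F s) W0 + k2"
  proof -
    have sK1: "subspace (K \<inter> radical a W)" using subspace_inter[OF K_subspace subspace_orth[OF a W(1)]] .
    have "R' \<subseteq> radical (F x) W"
    proof
      fix r assume r: "r \<in> R'"
      have "F x r u = 0" if u: "u \<in> W" for u
      proof -
        have "F x r u = F x' r u + complex_of_real \<mu> * q r u" by (simp add: x_def q_def)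
        moreover have "r \<in> W0" using r R'W0 by blast
        ultimately show ?thesis using x'R[OF r u] q0[of r u] by simp
      qed
      then show "r \<in> radical (F x) W" using r R'W0 unfolding orth_def by blast
    qed
    moreover have "R' \<inter> (K \<inter> radical a W) \<subseteq> {0}" using R'0 by blast
    ultimately have "dim R' + k1 \<le> dim (radical (F x) W)"
      using K_radical[OF hx]
      by (intro dim_add_le[OF R'(1) sK1 _ _ subspace_orth[OF F_hermitian[OF hx] W(1)] fin_dim_subset[OF W(2) orth_subset]])
    then show ?thesis
      using inertia_sum[OF F_hermitian[OF hx] W] inertia_sum[OF ht W0_subspace W0_fin] dR p by linarith
  qed
  ultimately show thesis using that by blast
qed

text \<open>Adding a nonnegative \<open>y\<close> to an admissible \<open>x\<close> keeps it
  admissible, and \<open>minimal_pos_index_below\<close> supplies one that lowers the positive index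
  without raising the negative one.\<close>

lemma min_attained:
  obtains x where "admissible x" "neg_index (F x) W + k1 \<le> neg_index (F s) W0 + k2"
    "pos_index (F x) W + neg_index a K + k1 \<le> dim K"
proof -
  obtain x where x: "admissible x" "neg_index (F x) W + k1 \<le> neg_index (F s) W0 + k2"
    using pos_index_max_attained by blast
  have hx: "hermitian_form x" using x(1) unfolding admissible_def by blast
  obtain y where y: "hermitian_form y" "\<forall>z. 0 \<le> Re (y z z)"
    "neg_index (\<lambda>u v. F x u v - y (\<beta> u) (\<beta> v)) W \<le> neg_index (F x) W"
    "pos_index (\<lambda>u v. F x u v - y (\<beta> u) (\<beta> v)) W + neg_index (F x) K + dim (K \<inter> radical (F x) W) \<le> dim K"
    using minimal_pos_index_below[OF F_hermitian[OF hx] \<beta> W] .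
  let ?x = "\<lambda>u v. x u v + y u v"
  have e1: "neg_index (F x) K = neg_index a K"
    by (rule pos_index_cong) (simp add: form_zero_left[OF hx])
  have e2: "K \<inter> radical (F x) W = K \<inter> radical a W"
    unfolding orth_def by (auto simp: form_zero_left[OF hx])
  have e3: "neg_index (F ?x) W = neg_index (\<lambda>u v. F x u v - y (\<beta> u) (\<beta> v)) W"
    by (rule pos_index_cong) simp
  have e4: "pos_index (F ?x) W = pos_index (\<lambda>u v. F x u v - y (\<beta> u) (\<beta> v)) W"
    by (rule pos_index_cong) simp
  have adm: "admissible ?x"
    using x(1) y(2) hermitian_form_add[OF hx y(1)] unfolding admissible_def by (simp add: add_increasing2)
  show thesis
  proof (rule that[OF adm])
    show "neg_index (F ?x) W + k1 \<le> neg_index (F s) W0 + k2" using e3 y(3) x(2) by linarith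
    show "pos_index (F ?x) W + neg_index a K + k1 \<le> dim K" using y(4) unfolding e1 e2 e4 .
  qed
qed

end

section \<open>Matrices as forms on coordinate space\<close>

text \<open>Vectors of length \<open>n\<close> are represented by functions that vanish from \<open>n\<close> on. All coordinate spaces
  are then subspaces of one type, and the type-based vector space library applies.\<close>

definition vscale :: "complex \<Rightarrow> (nat \<Rightarrow> complex) \<Rightarrow> nat \<Rightarrow> complex" where
  "vscale c f = (\<lambda>i. c * f i)"

interpretation cv: complex_vector_space vscale
  by unfold_locales (simp_all add: vscale_def fun_eq_iff algebra_simps)

text \<open>General index sets serve \<open>diagonal_form_index\<close>, where coordinates are
  grouped by sign.\<close>

definition coords :: "nat set \<Rightarrow> (nat \<Rightarrow> complex) set" where
  "coords I = {f. \<forall>i. i \<notin> I \<longrightarrow> f i = 0}"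

definition unit_fun :: "nat \<Rightarrow> nat \<Rightarrow> complex" where
  "unit_fun i = (\<lambda>j. if j = i then 1 else 0)"

lemma vscale_apply [simp]: "vscale c f i = c * f i"
  by (simp add: vscale_def)

lemma sum_fun_apply: "(\<Sum>x\<in>A. f x) i = (\<Sum>x\<in>A. (f x :: nat \<Rightarrow> complex) i)"
  by (induction A rule: infinite_finite_induct) auto

lemma coords_subspace: "cv.subspace (coords I)"
  by (auto simp: coords_def cv.subspace_def)

lemma coords_mono: "I \<subseteq> J \<Longrightarrow> coords I \<subseteq> coords J"
  by (auto simp: coords_def)

lemma coords_expansion:
  assumes "finite I" "f \<in> coords I" shows "f = (\<Sum>i\<in>I. vscale (f i) (unit_fun i))"
proof
  fix j
  have "(\<Sum>i\<in>I. vscale (f i) (unit_fun i)) j = (\<Sum>i\<in>I. if i = j then f j else 0)"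
    unfolding sum_fun_apply by (intro sum.cong) (auto simp: unit_fun_def)
  then show "f j = (\<Sum>i\<in>I. vscale (f i) (unit_fun i)) j"
    using assms by (auto simp: coords_def sum.delta)
qed

lemma unit_fun_coords: "i \<in> I \<Longrightarrow> unit_fun i \<in> coords I"
  by (auto simp: coords_def unit_fun_def)

lemma unit_fun_inj: "inj unit_fun"
  by (rule injI) (metis unit_fun_def zero_neq_one)

lemma
  assumes "finite I"
  shows coords_span: "cv.span (unit_fun ` I) = coords I"
    and coords_fin_dim: "cv.fin_dim (coords I)"
    and dim_coords: "cv.dim (coords I) = card I"
proof -
  have sub: "unit_fun ` I \<subseteq> coords I" using unit_fun_coords by blast
  have sup: "coords I \<subseteq> cv.span (unit_fun ` I)"
  proof
    fix f assume "f \<in> coords I"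
    then have "f = (\<Sum>i\<in>I. vscale (f i) (unit_fun i))" using coords_expansion assms by blast
    moreover have "(\<Sum>i\<in>I. vscale (f i) (unit_fun i)) \<in> cv.span (unit_fun ` I)"
      by (intro cv.span_sum cv.span_scale cv.span_base) auto
    ultimately show "f \<in> cv.span (unit_fun ` I)" by simp
  qed
  show "cv.span (unit_fun ` I) = coords I" using cv.span_subspace[OF sub sup coords_subspace] .
  show "cv.fin_dim (coords I)" unfolding cv.fin_dim_def using sup assms by blast
  have "cv.independent (unit_fun ` I)"
  proof (rule cv.independent_if_scalars_zero)
    fix u x assume z: "(\<Sum>x\<in>unit_fun ` I. vscale (u x) x) = 0" and "x \<in> unit_fun ` I"
    then obtain j where j: "j \<in> I" "x = unit_fun j" by blast
    have "(\<Sum>x\<in>unit_fun ` I. vscale (u x) x) j = (\<Sum>i\<in>I. vscale (u (unit_fun i)) (unit_fun i) j)"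
      unfolding sum_fun_apply by (subst sum.reindex) (auto intro: inj_on_subset[OF unit_fun_inj])
    also have "\<dots> = (\<Sum>i\<in>I. if i = j then u (unit_fun j) else 0)"
      by (intro sum.cong) (auto simp: unit_fun_def)
    finally show "u x = 0" using z j assms by (simp add: sum.delta)
  qed (use assms in simp)
  then have "cv.dim (coords I) = card (unit_fun ` I)"
    using cv.basis_card_eq_dim[OF sub sup] by simp
  then show "cv.dim (coords I) = card I"
    using card_image[OF inj_on_subset[OF unit_fun_inj subset_UNIV]] by simp
qed

abbreviation cspace :: "nat \<Rightarrow> (nat \<Rightarrow> complex) set" where
  "cspace n \<equiv> coords {..<n}"

lemma cspace_iff: "f \<in> cspace n \<longleftrightarrow> (\<forall>i\<ge>n. f i = 0)"
  by (auto simp: coords_def not_less)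

lemma cspace_fin: "cv.fin_dim (cspace n)" and dim_cspace: "cv.dim (cspace n) = n"
  using coords_fin_dim dim_coords by auto

definition inner :: "nat \<Rightarrow> (nat \<Rightarrow> complex) \<Rightarrow> (nat \<Rightarrow> complex) \<Rightarrow> complex" where
  "inner n f g = (\<Sum>i<n. f i * cnj (g i))"

lemma inner_hermitian: "cv.hermitian_form (inner n)"
  by (rule cv.hermitian_formI)
    (simp_all add: inner_def sum.distrib sum_distrib_left algebra_simps)

lemma inner_self: "inner n f f = complex_of_real (\<Sum>i<n. (cmod (f i))\<^sup>2)"
  unfolding inner_def of_real_sum by (intro sum.cong refl) (rule complex_norm_square[symmetric])

lemma inner_pos: "cv.pos_on (inner n) (cspace n)"
  unfolding cv.pos_on_def
proof (intro ballI impI)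
  fix f assume f: "f \<in> cspace n" "f \<noteq> 0"
  then obtain i where "f i \<noteq> 0" by (auto simp: fun_eq_iff)
  moreover have "i < n" using f(1) \<open>f i \<noteq> 0\<close> by (auto simp: cspace_iff not_less[symmetric])
  ultimately have "0 < (\<Sum>i<n. (cmod (f i))\<^sup>2)" by (intro sum_pos2[of _ i]) auto
  then show "0 < Re (inner n f f)" by (simp add: inner_self)
qed

lemma inner_pos_subspace: "S \<subseteq> cspace n \<Longrightarrow> cv.pos_on (inner n) S"
  using inner_pos unfolding cv.pos_on_def by blast

lemma inner_unit: "i < n \<Longrightarrow> inner n f (unit_fun i) = f i"
proof -
  assume i: "i < n"
  have "inner n f (unit_fun i) = (\<Sum>j<n. if j = i then f i else 0)"
    unfolding inner_def by (intro sum.cong) (auto simp: unit_fun_def)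
  then show ?thesis using i by simp
qed

lemma inner_eq_0_imp:
  assumes "f \<in> cspace n" "\<And>g. g \<in> cspace n \<Longrightarrow> inner n f g = 0" shows "f = 0"
  using cv.pos_on_null[OF inner_pos assms(1)] assms by blast

lemma orth_dim:
  assumes "cv.subspace S" "S \<subseteq> cspace n"
  shows "cv.dim S + cv.dim (cv.orth (inner n) S (cspace n)) = n"
  using cv.orth_complement_pos(3)[OF inner_hermitian coords_subspace cspace_fin assms inner_pos_subspace[OF assms(2)]]
  by (simp add: dim_cspace)

text \<open>\<open>S\<close> lies in its double orthogonal complement, and the dimensions
  agree.\<close>

lemma orth_orth:
  assumes "cv.subspace S" "S \<subseteq> cspace n"
  shows "cv.orth (inner n) (cv.orth (inner n) S (cspace n)) (cspace n) = S"
proof (rule sym, rule cv.dim_subspace_eq)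
  let ?O = "cv.orth (inner n) S (cspace n)"
  have O: "cv.subspace ?O" "?O \<subseteq> cspace n"
    using cv.subspace_orth[OF inner_hermitian coords_subspace] cv.orth_subset by auto
  show "cv.subspace S" "cv.subspace (cv.orth (inner n) ?O (cspace n))"
    using assms cv.subspace_orth[OF inner_hermitian coords_subspace] by auto
  show "cv.fin_dim (cv.orth (inner n) ?O (cspace n))"
    by (rule cv.fin_dim_subset[OF cspace_fin cv.orth_subset])
  show "cv.dim (cv.orth (inner n) ?O (cspace n)) \<le> cv.dim S"
    using orth_dim[OF assms] orth_dim[OF O] by linarith
  show "S \<subseteq> cv.orth (inner n) ?O (cspace n)"
  proof
    fix s assume s: "s \<in> S"
    have "inner n s x = 0" if "x \<in> ?O" for x
    proof -
      have "inner n x s = 0" using that s unfolding cv.orth_def by blast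
      then show ?thesis by (rule cv.form_sym_zero[OF inner_hermitian])
    qed
    then show "s \<in> cv.orth (inner n) ?O (cspace n)" using s assms(2) unfolding cv.orth_def by blast
  qed
qed

text \<open>The input is read only below \<open>dim_col A\<close> and the output is cut off at
  \<open>dim_row A\<close>, so identities such as \<open>mat_fun_mult\<close> hold for all
  functions, not just for those in a coordinate space.\<close>

definition mat_fun :: "complex mat \<Rightarrow> (nat \<Rightarrow> complex) \<Rightarrow> nat \<Rightarrow> complex" where
  "mat_fun A f = (\<lambda>i. if i < dim_row A then \<Sum>j<dim_col A. A $$ (i, j) * f j else 0)"

definition mat_form :: "complex mat \<Rightarrow> (nat \<Rightarrow> complex) \<Rightarrow> (nat \<Rightarrow> complex) \<Rightarrow> complex" where
  "mat_form A f g = inner (dim_row A) (mat_fun A f) g"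

lemma mat_fun_coords: "mat_fun A f \<in> cspace (dim_row A)"
  by (simp add: cspace_iff mat_fun_def)

lemma mat_fun_carrier: "A \<in> carrier_mat m n \<Longrightarrow> mat_fun A f \<in> cspace m"
  using mat_fun_coords[of A f] by auto

lemma mat_fun_linear: "cv.lin (mat_fun A)"
  by (rule cv.linearI') (auto simp: mat_fun_def fun_eq_iff sum.distrib sum_distrib_left algebra_simps)

lemma mat_fun_add: "mat_fun A (f + g) = mat_fun A f + mat_fun A g"
  and mat_fun_scale: "mat_fun A (vscale c f) = vscale c (mat_fun A f)"
  using mat_fun_linear[of A] unfolding Vector_Spaces.linear_iff by auto

lemma mat_fun_0 [simp]: "mat_fun A 0 = 0"
  by (simp add: mat_fun_def fun_eq_iff)

lemma mat_adjoint_index [simp]: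
  "dim_row (mat_adjoint A) = dim_col A" "dim_col (mat_adjoint A) = dim_row A"
  "i < dim_col A \<Longrightarrow> j < dim_row A \<Longrightarrow> mat_adjoint (A :: complex mat) $$ (i, j) = cnj (A $$ (j, i))"
  unfolding mat_adjoint_def by (auto simp: mat_of_rows_def)

lemma mat_adjoint_carrier: "(A :: complex mat) \<in> carrier_mat m n \<Longrightarrow> mat_adjoint A \<in> carrier_mat n m"
  by (auto intro: carrier_matI)

lemma mat_adjoint_adjoint: "mat_adjoint (mat_adjoint A) = (A :: complex mat)"
  by (rule eq_matI) auto

lemma mat_fun_mult:
  assumes "A \<in> carrier_mat m k" "B \<in> carrier_mat k n"
  shows "mat_fun (A * B) f = mat_fun A (mat_fun B f)"
proof
  fix i
  show "mat_fun (A * B) f i = mat_fun A (mat_fun B f) i"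
  proof (cases "i < m")
    case True
    have "mat_fun (A * B) f i = (\<Sum>j<n. \<Sum>l<k. A $$ (i, l) * B $$ (l, j) * f j)"
      using True assms by (auto simp: mat_fun_def scalar_prod_def sum_distrib_right atLeast0LessThan intro!: sum.cong)
    also have "\<dots> = (\<Sum>l<k. \<Sum>j<n. A $$ (i, l) * B $$ (l, j) * f j)" by (rule sum.swap)
    also have "\<dots> = mat_fun A (mat_fun B f) i"
      using True assms by (auto simp: mat_fun_def sum_distrib_left mult.assoc intro!: sum.cong)
    finally show ?thesis .
  qed (use assms in \<open>auto simp: mat_fun_def\<close>)
qed

lemma mat_fun_minus:
  assumes "A \<in> carrier_mat m n" "B \<in> carrier_mat m n"
  shows "mat_fun (A - B) f = mat_fun A f - mat_fun B f"
  using assms by (auto simp: mat_fun_def fun_eq_iff sum_subtractf algebra_simps)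

lemma mat_fun_uminus: "mat_fun (- A) f = - mat_fun A f"
  by (auto simp: mat_fun_def fun_eq_iff sum_negf)

lemma mat_fun_adjoint:
  assumes "A \<in> carrier_mat m n"
  shows "inner m (mat_fun A f) g = inner n f (mat_fun (mat_adjoint A) g)"
proof -
  have "inner m (mat_fun A f) g = (\<Sum>i<m. \<Sum>j<n. A $$ (i, j) * f j * cnj (g i))"
    using assms by (auto simp: inner_def mat_fun_def sum_distrib_right intro!: sum.cong)
  also have "\<dots> = (\<Sum>j<n. \<Sum>i<m. A $$ (i, j) * f j * cnj (g i))" by (rule sum.swap)
  also have "\<dots> = inner n f (mat_fun (mat_adjoint A) g)"
    using assms by (auto simp: inner_def mat_fun_def sum_distrib_left cnj_sum intro!: sum.cong)
  finally show ?thesis .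
qed

lemma hermitian_matsD:
  assumes "A \<in> hermitian_mats m"
  shows "A \<in> carrier_mat m m" "mat_adjoint A = A" "dim_row A = m" "dim_col A = m"
  using assms unfolding hermitian_mats_def by auto

lemma mat_form_hermitian:
  assumes "A \<in> hermitian_mats m" shows "cv.hermitian_form (mat_form A)"
proof (rule cv.hermitian_formI)
  note A = hermitian_matsD[OF assms]
  fix f g
  have "mat_form A g f = inner m g (mat_fun A f)"
    unfolding mat_form_def A(3) using mat_fun_adjoint[OF A(1)] A(2) by simp
  then show "mat_form A g f = cnj (mat_form A f g)"
    using cv.form_cnj[OF inner_hermitian, of m g "mat_fun A f"] by (simp add: mat_form_def A)
qed (simp_all add: mat_form_def mat_fun_add mat_fun_scale cv.form_add_left[OF inner_hermitian]
    cv.form_scale_left[OF inner_hermitian])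

lemma mat_form_sandwich:
  assumes "A \<in> carrier_mat m m" "X \<in> carrier_mat n n" "B \<in> carrier_mat m n"
  shows "mat_form (A - B * X * mat_adjoint B) f g
    = mat_form A f g - mat_form X (mat_fun (mat_adjoint B) f) (mat_fun (mat_adjoint B) g)"
proof -
  have BX: "B * X \<in> carrier_mat m n" using assms by simp
  have c: "B * X * mat_adjoint B \<in> carrier_mat m m" using assms mat_adjoint_carrier by (meson mult_carrier_mat)
  have "mat_fun (B * X * mat_adjoint B) f = mat_fun B (mat_fun X (mat_fun (mat_adjoint B) f))"
    using mat_fun_mult[OF BX mat_adjoint_carrier[OF assms(3)]] mat_fun_mult[OF assms(3,2)] by simp
  then have "mat_form (A - B * X * mat_adjoint B) f g
      = inner m (mat_fun A f - mat_fun B (mat_fun X (mat_fun (mat_adjoint B) f))) g"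
    unfolding mat_form_def using mat_fun_minus[OF assms(1) c] assms c by simp
  also have "\<dots> = inner m (mat_fun A f) g - inner n (mat_fun X (mat_fun (mat_adjoint B) f)) (mat_fun (mat_adjoint B) g)"
    by (simp add: cv.form_diff_left[OF inner_hermitian] mat_fun_adjoint[OF assms(3)])
  finally show ?thesis using assms by (simp add: mat_form_def)
qed

lemma hermitian_matsI:
  assumes "A \<in> carrier_mat m m" "\<And>i j. i < m \<Longrightarrow> j < m \<Longrightarrow> A $$ (i, j) = cnj (A $$ (j, i))"
  shows "A \<in> hermitian_mats m"
proof -
  have "mat_adjoint A = A"
  proof (rule eq_matI)
    fix i j assume ij: "i < dim_row A" "j < dim_col A"
    then show "mat_adjoint A $$ (i, j) = A $$ (i, j)" using assms(1) assms(2)[of i j] by simp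
  qed (use assms(1) in auto)
  then show ?thesis using assms(1) unfolding hermitian_mats_def by simp
qed

text \<open>The order of the unit vectors is swapped because forms are linear in the first
  argument.\<close>

lemma mat_form_entry:
  assumes "A \<in> carrier_mat m m" "i < m" "j < m"
  shows "mat_form A (unit_fun j) (unit_fun i) = A $$ (i, j)"
proof -
  have "mat_form A (unit_fun j) (unit_fun i) = mat_fun A (unit_fun j) i"
    using assms by (simp add: mat_form_def inner_unit)
  also have "\<dots> = (\<Sum>k<m. A $$ (i, k) * unit_fun j k)" using assms by (simp add: mat_fun_def)
  also have "\<dots> = (\<Sum>k<m. if k = j then A $$ (i, j) else 0)"
    by (intro sum.cong) (auto simp: unit_fun_def)
  finally show ?thesis using assms by simp
qed

lemma hermitian_form_eqI:
  assumes x: "cv.hermitian_form x" and y: "cv.hermitian_form y"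
    and e: "\<And>i j. i < n \<Longrightarrow> j < n \<Longrightarrow> x (unit_fun i) (unit_fun j) = y (unit_fun i) (unit_fun j)"
    and f: "f \<in> cspace n" and g: "g \<in> cspace n"
  shows "x f g = y f g"
proof -
  have 1: "x f (unit_fun j) = y f (unit_fun j)" if j: "j < n" for j
  proof -
    have "f \<in> cv.span (unit_fun ` {..<n})" using f coords_span by blast
    then show ?thesis
    proof (induction rule: cv.span_induct_alt)
      case base
      then show ?case by (simp only: cv.form_zero_left[OF x] cv.form_zero_left[OF y])
    next
      case (step c b z)
      then have "x b (unit_fun j) = y b (unit_fun j)" using e j by blast
      with step show ?case
        by (simp only: cv.form_add_left[OF x] cv.form_add_left[OF y] cv.form_scale_left[OF x] cv.form_scale_left[OF y])
    qed
  qed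
  have "g \<in> cv.span (unit_fun ` {..<n})" using g coords_span by blast
  then show ?thesis
  proof (induction rule: cv.span_induct_alt)
    case base
    then show ?case by (simp only: cv.form_zero_right[OF x] cv.form_zero_right[OF y])
  next
    case (step c b z)
    then have "x f b = y f b" using 1 by blast
    with step show ?case
      by (simp only: cv.form_add_right[OF x] cv.form_add_right[OF y] cv.form_scale_right[OF x] cv.form_scale_right[OF y])
  qed
qed

text \<open>This turns abstractly constructed forms into matrices \<open>X\<close>. Agreement on
  \<open>cspace n\<close> is all one can expect, since \<open>mat_form X\<close> ignores later
  coordinates.\<close>

lemma matrix_of_form:
  assumes x: "cv.hermitian_form x"
  obtains X where "X \<in> hermitian_mats n" "\<And>f g. f \<in> cspace n \<Longrightarrow> g \<in> cspace n \<Longrightarrow> mat_form X f g = x f g"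
proof -
  let ?X = "Matrix.mat n n (\<lambda>(i, j). x (unit_fun j) (unit_fun i))"
  have X: "?X \<in> hermitian_mats n"
    by (rule hermitian_matsI) (auto intro: cv.form_cnj[OF x])
  moreover have "mat_form ?X f g = x f g" if "f \<in> cspace n" "g \<in> cspace n" for f g
    by (rule hermitian_form_eqI[OF mat_form_hermitian[OF X] x _ that]) (subst mat_form_entry[of _ n], auto)
  ultimately show thesis using that by blast
qed

section \<open>Transfer from the vectors, ranks and ranges of the matrix library\<close>

definition vec_fun :: "complex vec \<Rightarrow> nat \<Rightarrow> complex" where
  "vec_fun v = (\<lambda>i. if i < dim_vec v then v $ i else 0)"

lemma vec_fun_coords: "v \<in> carrier_vec n \<Longrightarrow> vec_fun v \<in> cspace n"
  by (auto simp: vec_fun_def cspace_iff)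

lemma vec_fun_inj: "v \<in> carrier_vec n \<Longrightarrow> w \<in> carrier_vec n \<Longrightarrow> vec_fun v = vec_fun w \<Longrightarrow> v = w"
  by (rule eq_vecI) (auto simp: vec_fun_def fun_eq_iff split: if_splits)

lemma vec_fun_surj: "f \<in> cspace n \<Longrightarrow> vec_fun (vec n f) = f"
  by (auto simp: vec_fun_def cspace_iff fun_eq_iff)

lemma cspace_vec: "cspace n = vec_fun ` carrier_vec n"
  using vec_fun_coords vec_fun_surj by (metis (no_types, lifting) imageI image_subsetI subsetI subset_antisym vec_carrier)

lemma vec_fun_mult: "v \<in> carrier_vec (dim_col A) \<Longrightarrow> vec_fun (A *\<^sub>v v) = mat_fun A (vec_fun v)"
  by (auto simp: vec_fun_def mat_fun_def fun_eq_iff scalar_prod_def atLeast0LessThan intro!: sum.cong)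

lemma vec_fun_cscalar:
  "v \<in> carrier_vec n \<Longrightarrow> w \<in> carrier_vec n \<Longrightarrow> v \<bullet>c w = inner n (vec_fun v) (vec_fun w)"
  by (auto simp: vec_fun_def inner_def scalar_prod_def atLeast0LessThan intro!: sum.cong)

lemma mat_form_vec:
  "A \<in> carrier_mat m m \<Longrightarrow> v \<in> carrier_vec m \<Longrightarrow> (A *\<^sub>v v) \<bullet>c v = mat_form A (vec_fun v) (vec_fun v)"
  using vec_fun_cscalar[of "A *\<^sub>v v" m v] vec_fun_mult[of v A] by (auto simp: mat_form_def)

lemma pos_semidef_iff:
  assumes "A \<in> hermitian_mats m"
  shows "pos_semidef A \<longleftrightarrow> cv.nonneg_on (mat_form A) (cspace m)"
  using assms mat_form_vec[of A m] unfolding pos_semidef_def cv.nonneg_on_def cspace_vec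
  by (auto simp: hermitian_matsD)

lemma pos_def_iff:
  assumes "A \<in> hermitian_mats m"
  shows "pos_def A \<longleftrightarrow> cv.pos_on (mat_form A) (cspace m)"
proof -
  have "vec_fun v = 0 \<longleftrightarrow> v = 0\<^sub>v m" if "v \<in> carrier_vec m" for v
    using vec_fun_inj[OF that, of "0\<^sub>v m"] by (auto simp: vec_fun_def fun_eq_iff)
  then show ?thesis
    using assms mat_form_vec[of A m] unfolding pos_def_def cv.pos_on_def cspace_vec
    by (auto simp: hermitian_matsD)
qed

lemma vec_fun_lincomb:
  assumes "finite X" "X \<subseteq> carrier_vec n"
  shows "vec_fun (module.lincomb (module_vec TYPE(complex) n) a X) = (\<Sum>x\<in>X. vscale (a x) (vec_fun x))"
proof
  interpret vec_space "TYPE(complex)" n .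
  fix i
  have "dim_vec (lincomb a X) = n" by (rule lincomb_dim[OF assms])
  moreover have "lincomb a X $ i = (\<Sum>x\<in>X. a x * x $ i)" if "i < n" by (rule lincomb_index[OF that assms(2)])
  moreover have "dim_vec x = n" if "x \<in> X" for x using assms(2) that by auto
  ultimately show "vec_fun (lincomb a X) i = (\<Sum>x\<in>X. vscale (a x) (vec_fun x)) i"
    unfolding sum_fun_apply by (auto simp: vec_fun_def intro!: sum.cong)
qed

lemma lin_indpt_iff:
  assumes X: "finite X" "X \<subseteq> carrier_vec n"
  shows "module.lin_dep class_ring (module_vec TYPE(complex) n) X \<longleftrightarrow> cv.dependent (vec_fun ` X)"
proof -
  interpret vec_space "TYPE(complex)" n .
  have inj: "inj_on vec_fun X" using vec_fun_inj X(2) by (meson inj_onI subsetD)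
  have zero: "vec_fun v = 0 \<longleftrightarrow> v = 0\<^sub>v n" if "v \<in> carrier_vec n" for v
    using vec_fun_inj[OF that, of "0\<^sub>v n"] by (auto simp: vec_fun_def fun_eq_iff)
  have lc: "lincomb a X = 0\<^sub>v n \<longleftrightarrow> (\<Sum>x\<in>X. vscale (a x) (vec_fun x)) = 0" for a
    using zero[of "lincomb a X"] vec_fun_lincomb[OF X, of a] lincomb_dim[OF X, of a] by (auto intro: carrier_vecI)
  show ?thesis
  proof
    assume "lin_dep X"
    then obtain a v where av: "v \<in> X" "a v \<noteq> 0" "lincomb a X = 0\<^sub>v n"
      using finite_lin_dep[OF X(1)] X(2) by auto
    have "(\<Sum>y\<in>vec_fun ` X. vscale (a (the_inv_into X vec_fun y)) y) = 0"
      using lc[of a] av(3) by (subst sum.reindex[OF inj]) (simp add: the_inv_into_f_f[OF inj])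
    moreover have "a (the_inv_into X vec_fun (vec_fun v)) \<noteq> 0" using av by (simp add: the_inv_into_f_f[OF inj])
    ultimately show "cv.dependent (vec_fun ` X)"
      unfolding cv.dependent_finite[OF finite_imageI[OF X(1)]] using av(1)
      by (intro exI[of _ "\<lambda>y. a (the_inv_into X vec_fun y)"]) blast
  next
    assume "cv.dependent (vec_fun ` X)"
    then obtain u where u: "\<exists>v\<in>vec_fun ` X. u v \<noteq> 0" "(\<Sum>v\<in>vec_fun ` X. vscale (u v) v) = 0"
      using cv.dependent_finite[OF finite_imageI[OF X(1)], of vec_fun] by blast
    then have "(\<Sum>x\<in>X. vscale (u (vec_fun x)) (vec_fun x)) = 0" by (simp add: sum.reindex[OF inj])
    then have "lincomb (\<lambda>x. u (vec_fun x)) X = 0\<^sub>v n" using lc by simp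
    then show "lin_dep X" using finite_lin_indpt2[OF X(1), of] u(1) X
      unfolding lin_dep_def by fastforce
  qed
qed

lemma vec_fun_col:
  "j < dim_col A \<Longrightarrow> vec_fun (col A j) = mat_fun A (unit_fun j)"
proof
  fix i assume j: "j < dim_col A"
  have "(\<Sum>k<dim_col A. A $$ (i, k) * unit_fun j k) = (\<Sum>k<dim_col A. if k = j then A $$ (i, j) else 0)"
    by (intro sum.cong) (auto simp: unit_fun_def)
  then show "vec_fun (col A j) i = mat_fun A (unit_fun j) i" using j by (simp add: vec_fun_def mat_fun_def)
qed

lemma span_cols: "cv.span (vec_fun ` set (cols A)) = mat_fun A ` cspace (dim_col A)"
proof -
  interpret A: Vector_Spaces.linear vscale vscale "mat_fun A" by (rule mat_fun_linear)
  have "vec_fun ` set (cols A) = (\<lambda>j. vec_fun (col A j)) ` {..<dim_col A}"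
    by (simp add: cols_def lessThan_atLeast0 image_image)
  also have "\<dots> = mat_fun A ` unit_fun ` {..<dim_col A}"
    unfolding image_image by (intro image_cong) (simp_all add: vec_fun_col)
  finally have "vec_fun ` set (cols A) = mat_fun A ` unit_fun ` {..<dim_col A}" .
  then show ?thesis using A.span_image coords_span[of "{..<dim_col A}"] by simp
qed

text \<open>The library rank is the size of a maximal independent set of columns; by maximality its
  transfer spans the image of the map.\<close>

lemma mat_rank_eq_dim: "mat_rank A = cv.dim (mat_fun A ` cspace (dim_col A))"
proof -
  interpret vec_space "TYPE(complex)" "dim_row A" .
  have c: "set (cols A) \<subseteq> carrier_vec (dim_row A)" using cols_dim by blast
  have e: "lin_indpt {}" unfolding lin_dep_def by auto
  obtain S where S: "maximal S (\<lambda>T. T \<subseteq> set (cols A) \<and> lin_indpt T)" "finite S"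
    using maximal_exists_superset[of "set (cols A)" "\<lambda>T. T \<subseteq> set (cols A) \<and> lin_indpt T" "{}"]
      e by auto
  have S1: "S \<subseteq> set (cols A)" "lin_indpt S" using S(1) unfolding maximal_def by auto
  have r: "rank A = card S" by (rule rank_card_indpt[OF carrier_matI[OF refl refl] S(1)])
  have Sc: "S \<subseteq> carrier_vec (dim_row A)" using S1 c by blast
  have ind: "cv.independent (vec_fun ` S)" using lin_indpt_iff[OF S(2) Sc] S1(2) by simp
  have inj: "inj_on vec_fun (set (cols A))" using vec_fun_inj c by (meson inj_onI subsetD)
  have "vec_fun ` set (cols A) \<subseteq> cv.span (vec_fun ` S)"
  proof
    fix y assume "y \<in> vec_fun ` set (cols A)"
    then obtain v where v: "y = vec_fun v" "v \<in> set (cols A)" by blast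
    show "y \<in> cv.span (vec_fun ` S)"
    proof (rule ccontr)
      assume n: "y \<notin> cv.span (vec_fun ` S)"
      then have "cv.independent (vec_fun ` insert v S)"
        using cv.independent_insertI[OF n ind] v by simp
      moreover have "insert v S \<subseteq> carrier_vec (dim_row A)" using Sc v(2) c by blast
      ultimately have "lin_indpt (insert v S)" using lin_indpt_iff[of "insert v S" "dim_row A"] S(2) by blast
      then have "insert v S = S" using S(1) S1(1) v(2) unfolding maximal_def by blast
      then have "y \<in> vec_fun ` S" using v(1) by blast
      then show False using n cv.span_base by blast
    qed
  qed
  then have sp: "cv.span (vec_fun ` set (cols A)) = cv.span (vec_fun ` S)"
    using S1(1) by (meson cv.span_eq cv.span_superset image_mono order_trans)
  have "cv.dim (mat_fun A ` cspace (dim_col A)) = card (vec_fun ` S)"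
    unfolding span_cols[symmetric] sp by (rule cv.dim_span_eq_card_independent[OF ind])
  also have "\<dots> = card S" using card_image[OF inj_on_subset[OF inj S1(1)]] .
  finally show ?thesis using r by simp
qed

text \<open>The orthogonal complement of the column space. Ranks are computed through it because for
  block matrices it is given by linear equations in the blocks.\<close>

definition left_kernel :: "complex mat \<Rightarrow> (nat \<Rightarrow> complex) set" where
  "left_kernel A = {w \<in> cspace (dim_row A). mat_fun (mat_adjoint A) w = 0}"

lemma mat_rank_left_kernel: "mat_rank A + cv.dim (left_kernel A) = dim_row A"
proof -
  interpret A: Vector_Spaces.linear vscale vscale "mat_fun A" by (rule mat_fun_linear)
  let ?m = "dim_row A" and ?n = "dim_col A"
  let ?S = "mat_fun A ` cspace ?n"
  have A: "A \<in> carrier_mat ?m ?n" by simp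
  have S: "cv.subspace ?S" "?S \<subseteq> cspace ?m"
    using A.subspace_image[OF coords_subspace] mat_fun_coords by auto
  have "cv.orth (inner ?m) ?S (cspace ?m) = left_kernel A"
  proof -
    have "(\<forall>s\<in>?S. inner ?m w s = 0) \<longleftrightarrow> mat_fun (mat_adjoint A) w = 0" if "w \<in> cspace ?m" for w
    proof -
      have e: "inner ?m w (mat_fun A f) = inner ?n (mat_fun (mat_adjoint A) w) f" for f
        using mat_fun_adjoint[OF mat_adjoint_carrier[OF A], of w f] by (simp add: mat_adjoint_adjoint)
      have "mat_fun (mat_adjoint A) w \<in> cspace ?n" using mat_fun_coords[of "mat_adjoint A" w] by simp
      then have "mat_fun (mat_adjoint A) w = 0 \<longleftrightarrow> (\<forall>f\<in>cspace ?n. inner ?n (mat_fun (mat_adjoint A) w) f = 0)"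
        using inner_eq_0_imp cv.form_zero_left[OF inner_hermitian] by metis
      then show ?thesis using e by simp
    qed
    then show ?thesis unfolding cv.orth_def left_kernel_def by blast
  qed
  then show ?thesis using orth_dim[OF S] mat_rank_eq_dim[of A] by simp
qed

lemma mat_range_eq: "vec_fun ` mat_range A = mat_fun A ` cspace (dim_col A)"
proof -
  interpret vec_space "TYPE(complex)" "dim_row A" .
  have "col_space A = (\<lambda>v. A *\<^sub>v v) ` carrier_vec (dim_col A)"
    unfolding col_space_eq[OF carrier_matI[OF refl refl]] by (auto intro: carrier_vecI)
  then show ?thesis unfolding cspace_vec by (simp add: image_image vec_fun_mult cong: image_cong)
qed

lemma mat_range_subset_iff:
  assumes "dim_row A = dim_row B"
  shows "mat_range A \<subseteq> mat_range B \<longleftrightarrow> mat_fun A ` cspace (dim_col A) \<subseteq> mat_fun B ` cspace (dim_col B)"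
proof -
  interpret vec_space "TYPE(complex)" "dim_row A" .
  have A: "mat_range A \<subseteq> carrier_vec (dim_row A)" unfolding col_space_eq[OF carrier_matI[OF refl refl]] by auto
  have B: "mat_range B \<subseteq> carrier_vec (dim_row A)" 
    using vec_space.col_space_eq[OF carrier_matI[OF refl refl], of B] assms by auto
  have "x \<in> mat_range B"
    if sub: "vec_fun ` mat_range A \<subseteq> vec_fun ` mat_range B" and x: "x \<in> mat_range A" for x
  proof -
    obtain y where "y \<in> mat_range B" "vec_fun x = vec_fun y" using sub x by blast
    then show ?thesis using vec_fun_inj[of x "dim_row A" y] A B x by blast
  qed
  then have "mat_range A \<subseteq> mat_range B \<longleftrightarrow> vec_fun ` mat_range A \<subseteq> vec_fun ` mat_range B"
    by blast
  then show ?thesis unfolding mat_range_eq .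
qed

text \<open>In the coordinates given by \<open>\<Phi>\<close> the form is diagonal: coordinates with
  positive \<open>g\<close> span a positive subspace, the others a nonpositive one, and the
  dimensions add up to \<open>m\<close>.\<close>

lemma diagonal_form_index:
  assumes \<Phi>: "cv.lin \<Phi>" "\<And>c. \<Phi> c \<in> cspace m" "\<And>c. c \<in> cspace m \<Longrightarrow> \<Phi> c = 0 \<Longrightarrow> c = 0"
    and h: "\<And>c. Re (h (\<Phi> c) (\<Phi> c)) = (\<Sum>k<m. g k * (cmod (c k))\<^sup>2)"
  shows "cv.pos_index h (cspace m) = card {k\<in>{..<m}. 0 < g k}"
proof -
  interpret \<Phi>: Vector_Spaces.linear vscale vscale \<Phi> by (rule \<Phi>(1))
  let ?I = "{k\<in>{..<m}. 0 < g k}" and ?J = "{k\<in>{..<m}. g k \<le> 0}"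
  have img: "cv.subspace (\<Phi> ` coords L)" "\<Phi> ` coords L \<subseteq> cspace m" "cv.dim (\<Phi> ` coords L) = card L"
    if L: "L \<subseteq> {..<m}" for L
  proof -
    show "cv.subspace (\<Phi> ` coords L)" by (rule \<Phi>.subspace_image[OF coords_subspace])
    show "\<Phi> ` coords L \<subseteq> cspace m" using \<Phi>(2) by blast
    have "cv.dim (\<Phi> ` coords L) = cv.dim (coords L)"
      using \<Phi>(3) coords_mono[OF L] by (intro cv.dim_image_inj[OF \<Phi>(1) coords_subspace]) blast
    then show "cv.dim (\<Phi> ` coords L) = card L" using dim_coords finite_subset[OF L] by simp
  qed
  have "cv.pos_on h (\<Phi> ` coords ?I)"
    unfolding cv.pos_on_def
  proof (intro ballI impI)
    fix x assume "x \<in> \<Phi> ` coords ?I" "x \<noteq> 0"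
    then obtain c where c: "x = \<Phi> c" "c \<in> coords ?I" "c \<noteq> 0" using \<Phi>.zero by blast
    then obtain k where k: "c k \<noteq> 0" by (auto simp: fun_eq_iff)
    then have kI: "k \<in> ?I" using c(2) unfolding coords_def by blast
    have "0 < (\<Sum>k<m. g k * (cmod (c k))\<^sup>2)"
    proof (rule sum_pos2[of _ k])
      show "0 \<le> g j * (cmod (c j))\<^sup>2" if "j \<in> {..<m}" for j
        using c(2) that by (cases "j \<in> ?I") (auto simp: coords_def)
    qed (use k kI in auto)
    then show "0 < Re (h x x)" using h c(1) by simp
  qed
  then have "card ?I \<le> cv.pos_index h (cspace m)"
    using cv.pos_index_ge[OF cspace_fin coords_subspace img(1,2)[of ?I]] img(3)[of ?I] by auto
  moreover have "cv.pos_index h (cspace m) + cv.dim (\<Phi> ` coords ?J) \<le> cv.dim (cspace m)"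
  proof (rule cv.pos_index_le[OF cspace_fin coords_subspace img(1,2)])
    fix x assume "x \<in> \<Phi> ` coords ?J"
    then obtain c where c: "x = \<Phi> c" "c \<in> coords ?J" by blast
    have "(\<Sum>k<m. g k * (cmod (c k))\<^sup>2) \<le> 0"
    proof (rule sum_nonpos)
      show "g j * (cmod (c j))\<^sup>2 \<le> 0" if "j \<in> {..<m}" for j
        using c(2) that by (cases "j \<in> ?J") (auto simp: coords_def mult_nonpos_nonneg)
    qed
    then show "Re (h x x) \<le> 0" using h c(1) by simp
  qed auto
  moreover have "card ?I + card ?J = m"
  proof -
    have "?I \<union> ?J = {..<m}" "?I \<inter> ?J = {}" by auto
    then show ?thesis using card_Un_disjoint[of ?I ?J] by simp
  qed
  moreover have "cv.dim (\<Phi> ` coords ?J) = card ?J" using img(3)[of ?J] by auto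
  ultimately show ?thesis by (simp add: dim_cspace)
qed

text \<open>Orthogonalizing the columns of the matrix \<open>P\<close> of a Schur decomposition turns the invariant flag
  spanned by them into an orthogonal basis of eigenvectors.\<close>

lemma hermitian_eigenbasis:
  assumes A: "A \<in> hermitian_mats m"
  obtains q :: "nat \<Rightarrow> nat \<Rightarrow> complex" and e :: "nat \<Rightarrow> real" where
    "\<forall>k<m. q k \<in> cspace m \<and> q k \<noteq> 0 \<and> mat_fun A (q k) = vscale (complex_of_real (e k)) (q k)"
    "\<forall>k<m. \<forall>l<m. k \<noteq> l \<longrightarrow> inner m (q k) (q l) = 0"
    "char_poly A = (\<Prod>k\<leftarrow>[0..<m]. [:- complex_of_real (e k), 1:])"
proof -
  note Ad = hermitian_matsD[OF A]
  obtain as where as: "char_poly A = (\<Prod>a\<leftarrow>as. [:- a, 1:])" using char_poly_factorized[OF Ad(1)] by blast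
  obtain B P Q where schur: "schur_decomposition A as = (B, P, Q)" by (cases "schur_decomposition A as") auto
  have sim: "similar_mat_wit A B P Q" and ut: "upper_triangular B"
    using schur_decomposition[OF Ad(1) as schur] by auto
  note w = similar_mat_witD2[OF Ad(1) sim]
  note P = w(6) and B = w(5)
  have dims: "dim_row B = m" "dim_col B = m" using B by auto
  have inj: "f = 0" if "f \<in> cspace m" "mat_fun P f = 0" for f
  proof -
    have "mat_fun (1\<^sub>m m) f = 0" using mat_fun_mult[OF w(7) P, of f] w(2) that(2) by simp
    moreover have "mat_fun (1\<^sub>m m) f = f"
    proof
      fix i
      have "(\<Sum>j<m. 1\<^sub>m m $$ (i, j) * f j) = (\<Sum>j<m. if j = i then f i else 0)" if "i < m"
        using that by (intro sum.cong) auto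
      then show "mat_fun (1\<^sub>m m) f i = f i" using \<open>f \<in> cspace m\<close> by (auto simp: mat_fun_def cspace_iff)
    qed
    ultimately show ?thesis by simp
  qed
  have AP: "mat_fun A (mat_fun P f) = mat_fun P (mat_fun B f)" for f
  proof -
    have PB: "P * B \<in> carrier_mat m m" using P B by simp
    have "A * P = P * B * (Q * P)" unfolding w(3) by (rule assoc_mult_mat[OF PB w(7) P])
    then have "A * P = P * B" unfolding w(2) right_mult_one_mat[OF PB] .
    then show ?thesis unfolding mat_fun_mult[OF Ad(1) P, symmetric] mat_fun_mult[OF P B, symmetric] by simp
  qed
  interpret P: Vector_Spaces.linear vscale vscale "mat_fun P" by (rule mat_fun_linear)
  interpret A: Vector_Spaces.linear vscale vscale "mat_fun A" by (rule mat_fun_linear)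
  let ?W = "\<lambda>k. mat_fun P ` cspace k"
  have W: "cv.subspace (?W k)" "?W k \<subseteq> cspace m" for k
    using P.subspace_image[OF coords_subspace] mat_fun_carrier[OF P] by auto
  have Bk: "mat_fun B f \<in> cspace k" if "f \<in> cspace k" for f k
  proof -
    have "B $$ (i, j) * f j = 0" if "k \<le> i" "i < m" for i j
      using \<open>f \<in> cspace k\<close> upper_triangularD[OF ut, of j i] that dims by (cases "j < k") (auto simp: cspace_iff)
    then show ?thesis using dims by (auto simp: cspace_iff mat_fun_def)
  qed
  have AW: "mat_fun A x \<in> ?W k" if "x \<in> ?W k" for x k using that AP Bk by auto
  have Bu: "mat_fun B (unit_fun k) - vscale (B $$ (k, k)) (unit_fun k) \<in> cspace k" if k: "k < m" for k
  proof -
    have "mat_fun B (unit_fun k) i = B $$ (i, k)" if "i < m" for i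
    proof -
      have "(\<Sum>j<m. B $$ (i, j) * unit_fun k j) = (\<Sum>j<m. if j = k then B $$ (i, k) else 0)"
        by (intro sum.cong) (auto simp: unit_fun_def)
      then show ?thesis using that k dims by (simp add: mat_fun_def)
    qed
    moreover have "mat_fun B (unit_fun k) i = 0" if "\<not> i < m" for i using that dims by (simp add: mat_fun_def)
    ultimately have "mat_fun B (unit_fun k) i - B $$ (k, k) * unit_fun k i = 0" if "k \<le> i" for i
      using that k upper_triangularD[OF ut, of k i] dims by (cases "i < m"; cases "i = k") (auto simp: unit_fun_def)
    then show ?thesis by (auto simp: cspace_iff)
  qed
  \<comment> \<open>\<open>q\<close> will be the component of the \<open>k\<close>-th column of
    \<open>P\<close> orthogonal to the flag space \<open>?W k\<close>.\<close>
  have ex: "\<exists>q. q \<in> ?W (Suc k) \<and> q \<in> cv.orth (inner m) (?W k) (cspace m) \<and> q \<noteq> 0 \<and>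
      mat_fun A q = vscale (B $$ (k, k)) q" if k: "k < m" for k
  proof -
    let ?u = "mat_fun P (unit_fun k)" and ?c = "B $$ (k, k)"
    have "?u \<in> cv.subspace_sum (?W k) (cv.orth (inner m) (?W k) (cspace m))"
      unfolding cv.orth_complement_pos(1)[OF inner_hermitian coords_subspace cspace_fin W inner_pos_subspace[OF W(2)]]
      by (rule mat_fun_carrier[OF P])
    then obtain y q where yq: "?u = y + q" "y \<in> ?W k" "q \<in> cv.orth (inner m) (?W k) (cspace m)"
      by (rule cv.subspace_sumE)
    have Wk: "?W k \<subseteq> ?W (Suc k)" by (intro image_mono coords_mono) auto
    have q: "q = ?u - y" using yq(1) by simp
    have "?u \<in> ?W (Suc k)" by (intro imageI unit_fun_coords) auto
    then have qW: "q \<in> ?W (Suc k)" unfolding q using yq(2) Wk cv.subspace_diff[OF W(1)] by blast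
    have "q \<noteq> 0"
    proof
      assume "q = 0"
      then obtain f where f: "f \<in> cspace k" "?u = mat_fun P f" using yq by auto
      have "f - unit_fun k = 0"
      proof (rule inj)
        show "f - unit_fun k \<in> cspace m"
          using f(1) k by (auto simp: cspace_iff unit_fun_def)
        show "mat_fun P (f - unit_fun k) = 0" using f(2) by (simp add: P.diff)
      qed
      then have "f k = 1" by (simp add: unit_fun_def)
      then show False using f(1) by (simp add: cspace_iff)
    qed
    moreover have "mat_fun A q - vscale ?c q = 0"
    proof -
      \<comment> \<open>\<open>?d\<close> lies in \<open>?W k\<close>, since the flag is invariant
        and the column is an eigenvector modulo it. By self-adjointness \<open>?d\<close> is
        orthogonal to itself: \<open>q\<close> is orthogonal to \<open>?d\<close> and to its image
        under \<open>A\<close>, both in \<open>?W k\<close>.\<close>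
      let ?d = "mat_fun A q - vscale ?c q"
      have "mat_fun A ?u - vscale ?c ?u = mat_fun P (mat_fun B (unit_fun k) - vscale ?c (unit_fun k))"
        by (simp only: AP P.diff P.scale)
      then have 1: "mat_fun A ?u - vscale ?c ?u \<in> ?W k" using Bu[OF k] by blast
      have 2: "mat_fun A y - vscale ?c y \<in> ?W k"
        by (rule cv.subspace_diff[OF W(1) AW[OF yq(2)] cv.subspace_scale[OF W(1) yq(2)]])
      have "?d = (mat_fun A ?u - vscale ?c ?u) - (mat_fun A y - vscale ?c y)"
        unfolding q A.diff cv.scale_right_diff_distrib by (simp add: algebra_simps)
      then have d: "?d \<in> ?W k" using cv.subspace_diff[OF W(1) 1 2] by simp
      have q0: "inner m q x = 0" if "x \<in> ?W k" for x using yq(3) that unfolding cv.orth_def by blast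
      have "inner m ?d ?d = inner m q (mat_fun A ?d) - ?c * inner m q ?d"
        using mat_fun_adjoint[OF Ad(1), of q ?d] Ad(2)
        by (simp only: cv.form_diff_left[OF inner_hermitian] cv.form_scale_left[OF inner_hermitian])
      also have "\<dots> = 0" using q0[OF AW[OF d]] q0[OF d] by simp
      finally show ?thesis using cv.pos_on_null[OF inner_pos] d W(2) by blast
    qed
    then have "mat_fun A q = vscale ?c q" by simp
    ultimately show ?thesis using qW yq(3) by blast
  qed
  define q where "q k = (SOME q. q \<in> ?W (Suc k) \<and> q \<in> cv.orth (inner m) (?W k) (cspace m) \<and> q \<noteq> 0 \<and>
      mat_fun A q = vscale (B $$ (k, k)) q)" for k
  have q: "q k \<in> ?W (Suc k)" "q k \<in> cv.orth (inner m) (?W k) (cspace m)" "q k \<noteq> 0"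
    "mat_fun A (q k) = vscale (B $$ (k, k)) (q k)" if "k < m" for k
    using someI_ex[OF ex[OF that]] unfolding q_def by blast+
  have qm: "q k \<in> cspace m" if "k < m" for k using q(2)[OF that] unfolding cv.orth_def by blast
  have real: "B $$ (k, k) = complex_of_real (Re (B $$ (k, k)))" if k: "k < m" for k
  proof -
    have "B $$ (k, k) * inner m (q k) (q k) = inner m (mat_fun A (q k)) (q k)"
      by (simp only: q(4)[OF k] cv.form_scale_left[OF inner_hermitian])
    also have "\<dots> = inner m (q k) (mat_fun A (q k))" using mat_fun_adjoint[OF Ad(1)] Ad(2) by simp
    also have "\<dots> = cnj (B $$ (k, k)) * inner m (q k) (q k)"
      by (simp only: q(4)[OF k] cv.form_scale_right[OF inner_hermitian])
    finally have "B $$ (k, k) = cnj (B $$ (k, k))"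
      using cv.pos_on_null[OF inner_pos qm[OF k]] q(3)[OF k] by auto
    then show ?thesis by (simp add: complex_eq_iff)
  qed
  have lt: "inner m (q k) (q l) = 0" if "l < k" "k < m" for k l
  proof -
    have "?W (Suc l) \<subseteq> ?W k" using that(1) by (intro image_mono coords_mono) auto
    then have "q l \<in> ?W k" using q(1)[of l] that by auto
    then show ?thesis using q(2)[OF that(2)] unfolding cv.orth_def by blast
  qed
  have orth: "inner m (q k) (q l) = 0" if "k < m" "l < m" "k \<noteq> l" for k l
    using lt[of l k] cv.form_sym_zero[OF inner_hermitian lt[of k l]] that by (cases "l < k") auto
  have "char_poly A = char_poly B" using sim by (intro char_poly_similar) (auto simp: similar_mat_def)
  also have "\<dots> = (\<Prod>a\<leftarrow>diag_mat B. [:- a, 1:])" by (rule char_poly_upper_triangular[OF B ut])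
  also have "\<dots> = (\<Prod>k\<leftarrow>[0..<m]. [:- complex_of_real (Re (B $$ (k, k))), 1:])"
    unfolding diag_mat_def dims map_map using real by (intro arg_cong[of _ _ prod_list] map_cong) auto
  finally have cp: "char_poly A = (\<Prod>k\<leftarrow>[0..<m]. [:- complex_of_real (Re (B $$ (k, k))), 1:])" .
  show thesis
  proof (rule that[OF _ _ cp])
    show "\<forall>k<m. q k \<in> cspace m \<and> q k \<noteq> 0 \<and>
        mat_fun A (q k) = vscale (complex_of_real (Re (B $$ (k, k)))) (q k)"
      using q qm real by metis
  qed (use orth in blast)
qed

lemma order_linear_factors:
  "order a (\<Prod>k\<leftarrow>[0..<m]. [:- f k, 1:]) = card {k\<in>{..<m}. f k = (a :: complex)}"
proof (induction m)
  case (Suc m)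
  let ?p = "\<Prod>k\<leftarrow>[0..<m]. [:- f k, 1:]"
  have "?p \<noteq> 0" "[:- f m, 1:] \<noteq> 0" by (auto simp: prod_list_zero_iff)
  then have "?p * [:- f m, 1:] \<noteq> 0" by (rule no_zero_divisors)
  then have "order a (?p * [:- f m, 1:]) = order a ?p + order a [:- f m, 1:]" by (rule order_mult)
  moreover have "order a [:- f m, 1:] = (if f m = a then 1 else 0)"
    using order_power_n_n[of a 1] order_0I[of "[:- f m, 1:]" a] by auto
  moreover have "{k\<in>{..<Suc m}. f k = a} = {k\<in>{..<m}. f k = a} \<union> (if f m = a then {m} else {})"
    by (auto simp: less_Suc_eq)
  ultimately show ?case using Suc by (simp add: card_insert_if)
qed simp

text \<open>The single place where eigenvalues meet the index: multiplicities count the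
  \<open>k\<close> with \<open>e k\<close> of the given sign, and so does the index in the
  orthogonal eigenbasis.\<close>

lemma inertia_eq_index:
  assumes A: "A \<in> hermitian_mats m"
  shows pos_inertia_eq: "pos_inertia A = cv.pos_index (mat_form A) (cspace m)"
    and neg_inertia_eq: "neg_inertia A = cv.neg_index (mat_form A) (cspace m)"
proof -
  note Ad = hermitian_matsD[OF A]
  obtain q e where qe: "\<forall>k<m. q k \<in> cspace m \<and> q k \<noteq> 0 \<and> mat_fun A (q k) = vscale (complex_of_real (e k)) (q k)"
    "\<forall>k<m. \<forall>l<m. k \<noteq> l \<longrightarrow> inner m (q k) (q l) = 0"
    "char_poly A = (\<Prod>k\<leftarrow>[0..<m]. [:- complex_of_real (e k), 1:])"
    by (rule hermitian_eigenbasis[OF A])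
  have ord: "(\<Sum>t\<in>{t::real. eigenvalue A (complex_of_real t) \<and> R t}. order (complex_of_real t) (char_poly A))
      = card {k\<in>{..<m}. R (e k)}" for R
  proof -
    have ev: "eigenvalue A (complex_of_real t) \<longleftrightarrow> t \<in> e ` {..<m}" for t
      unfolding eigenvalue_root_char_poly[OF Ad(1)] qe(3)
      by (auto simp: poly_prod_list prod_list_zero_iff image_iff)
    let ?T = "{t. t \<in> e ` {..<m} \<and> R t}"
    have "(\<Sum>t\<in>?T. order (complex_of_real t) (char_poly A)) = (\<Sum>t\<in>?T. card {k\<in>{..<m}. e k = t})"
      unfolding qe(3) order_linear_factors by simp
    also have "\<dots> = card (\<Union>t\<in>?T. {k\<in>{..<m}. e k = t})"
      by (subst card_UN_disjoint) auto
    also have "(\<Union>t\<in>?T. {k\<in>{..<m}. e k = t}) = {k\<in>{..<m}. R (e k)}" by auto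
    finally show ?thesis unfolding ev .
  qed
  define \<Phi> where "\<Phi> c = (\<Sum>k<m. vscale (c k) (q k))" for c
  have \<Phi>l: "cv.lin \<Phi>"
    by (rule cv.linearI')
      (simp_all add: \<Phi>_def fun_eq_iff sum_fun_apply sum.distrib sum_distrib_left algebra_simps)
  have \<Phi>m: "\<Phi> c \<in> cspace m" for c
    unfolding \<Phi>_def using qe(1) by (intro cv.subspace_sum[OF coords_subspace] cv.subspace_scale[OF coords_subspace]) auto
  have left: "inner m (\<Phi> c) y = (\<Sum>k<m. c k * inner m (q k) y)" for c y
  proof -
    have "inner m (\<Sum>k\<in>L. vscale (c k) (q k)) y = (\<Sum>k\<in>L. c k * inner m (q k) y)" if "finite L" for L
      using that by (induction L rule: finite_induct)
        (simp_all only: sum.empty sum.insert cv.form_zero_left[OF inner_hermitian]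
          cv.form_add_left[OF inner_hermitian] cv.form_scale_left[OF inner_hermitian] simp_thms)
    then show ?thesis by (simp add: \<Phi>_def)
  qed
  have right: "inner m (q k) (\<Phi> c) = cnj (c k) * inner m (q k) (q k)" if k: "k < m" for k c
  proof -
    have "inner m (\<Phi> c) (q k) = (\<Sum>l<m. if l = k then c k * inner m (q k) (q k) else 0)"
      unfolding left using qe(2) k by (intro sum.cong) auto
    then show ?thesis
      using cv.form_cnj[OF inner_hermitian, of m "q k" "\<Phi> c"] cv.form_cnj[OF inner_hermitian, of m "q k" "q k"] k by simp
  qed
  have \<Phi>i: "c = 0" if "c \<in> cspace m" "\<Phi> c = 0" for c
  proof
    fix k
    show "c k = 0 k"
    proof (cases "k < m")
      case True
      have "inner m (q k) (\<Phi> c) = 0" using that(2) cv.form_zero_right[OF inner_hermitian] by metis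
      then show ?thesis using right[OF True] cv.pos_on_null[OF inner_pos] qe(1) True by auto
    qed (use that(1) in \<open>auto simp: cspace_iff\<close>)
  qed
  \<comment> \<open>The eigenvectors are orthogonal but not normalized; the positive factor
    \<open>?d k\<close> does not affect the sign of \<open>e k\<close>.\<close>
  let ?d = "\<lambda>k. Re (inner m (q k) (q k))"
  have d: "0 < ?d k" if "k < m" for k using inner_pos qe(1) that unfolding cv.pos_on_def by blast
  have A\<Phi>: "mat_fun A (\<Phi> c) = \<Phi> (\<lambda>k. complex_of_real (e k) * c k)" for c
  proof -
    interpret A: Vector_Spaces.linear vscale vscale "mat_fun A" by (rule mat_fun_linear)
    show ?thesis unfolding \<Phi>_def A.sum A.scale using qe(1) by (intro sum.cong) (auto simp: fun_eq_iff)
  qed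
  have val: "Re (mat_form A (\<Phi> c) (\<Phi> c)) = (\<Sum>k<m. e k * ?d k * (cmod (c k))\<^sup>2)" for c
  proof -
    have "mat_form A (\<Phi> c) (\<Phi> c) = (\<Sum>k<m. complex_of_real (e k) * c k * (cnj (c k) * inner m (q k) (q k)))"
      unfolding mat_form_def Ad(3) A\<Phi> left by (intro sum.cong) (auto simp: right)
    also have "\<dots> = (\<Sum>k<m. complex_of_real (e k * ?d k * (cmod (c k))\<^sup>2))"
    proof (intro sum.cong refl)
      fix k
      have "inner m (q k) (q k) = complex_of_real (?d k)" by (rule cv.form_self[OF inner_hermitian])
      then show "complex_of_real (e k) * c k * (cnj (c k) * inner m (q k) (q k))
          = complex_of_real (e k * ?d k * (cmod (c k))\<^sup>2)"
        using complex_norm_square[of "c k"] by (simp add: ac_simps)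
    qed
    finally show ?thesis by simp
  qed
  have "{k\<in>{..<m}. 0 < e k * ?d k} = {k\<in>{..<m}. 0 < e k}"
    using d by (auto simp: zero_less_mult_iff dest: less_asym)
  then show "pos_inertia A = cv.pos_index (mat_form A) (cspace m)"
    unfolding pos_inertia_def ord using diagonal_form_index[where h = "mat_form A" and g = "\<lambda>k. e k * ?d k", OF \<Phi>l \<Phi>m \<Phi>i val] by simp
  have val': "Re (- mat_form A (\<Phi> c) (\<Phi> c)) = (\<Sum>k<m. - (e k * ?d k) * (cmod (c k))\<^sup>2)" for c
    using val[of c] by (simp add: sum_negf)
  have "{k\<in>{..<m}. 0 < - (e k * ?d k)} = {k\<in>{..<m}. e k < 0}"
    using d by (auto simp: mult_less_0_iff dest: less_asym)
  then show "neg_inertia A = cv.neg_index (mat_form A) (cspace m)"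
    unfolding neg_inertia_def ord using diagonal_form_index[where h = "\<lambda>x y. - mat_form A x y" and g = "\<lambda>k. - (e k * ?d k)", OF \<Phi>l \<Phi>m \<Phi>i val'] by simp
qed

section \<open>Block matrices\<close>

text \<open>Block vectors inside one type: a first block of length \<open>m\<close> is embedded as
  it is, a second one by \<open>shift m\<close>; \<open>head m\<close> and \<open>tail m\<close>
  read them back.\<close>

definition head :: "nat \<Rightarrow> (nat \<Rightarrow> complex) \<Rightarrow> nat \<Rightarrow> complex" where
  "head m w = (\<lambda>i. if i < m then w i else 0)"

definition tail :: "nat \<Rightarrow> (nat \<Rightarrow> complex) \<Rightarrow> nat \<Rightarrow> complex" where
  "tail m w = (\<lambda>i. w (m + i))"

definition shift :: "nat \<Rightarrow> (nat \<Rightarrow> complex) \<Rightarrow> nat \<Rightarrow> complex" where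
  "shift m v = (\<lambda>i. if i < m then 0 else v (i - m))"

lemma head_lin: "cv.lin (head m)"
  by (rule cv.linearI') (auto simp: head_def fun_eq_iff)

lemma tail_lin: "cv.lin (tail m)"
  by (rule cv.linearI') (auto simp: tail_def fun_eq_iff)

lemma shift_lin: "cv.lin (shift m)"
  by (rule cv.linearI') (auto simp: shift_def fun_eq_iff)

interpretation head: Vector_Spaces.linear vscale vscale "head m" for m by (rule head_lin)
interpretation tail: Vector_Spaces.linear vscale vscale "tail m" for m by (rule tail_lin)
interpretation shift: Vector_Spaces.linear vscale vscale "shift m" for m by (rule shift_lin)

lemma head_coords: "head m w \<in> cspace m"
  and tail_coords: "w \<in> cspace (m + n) \<Longrightarrow> tail m w \<in> cspace n"
  and shift_coords: "v \<in> cspace n \<Longrightarrow> shift m v \<in> cspace (m + n)"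
  by (auto simp: head_def tail_def shift_def cspace_iff)

lemma head_id: "u \<in> cspace m \<Longrightarrow> head m u = u"
  and tail_0: "u \<in> cspace m \<Longrightarrow> tail m u = 0"
  and head_shift [simp]: "head m (shift m v) = 0"
  and tail_shift [simp]: "tail m (shift m v) = v"
  and head_tail: "head m w + shift m (tail m w) = w"
  by (auto simp: head_def tail_def shift_def cspace_iff fun_eq_iff)

lemma head_tail_eqI: "head m w = head m w' \<Longrightarrow> tail m w = tail m w' \<Longrightarrow> w = w'"
  by (metis head_tail)

lemma head_tail_zero: "head m w = 0 \<Longrightarrow> tail m w = 0 \<Longrightarrow> w = 0"
  by (rule head_tail_eqI) (simp_all add: head.zero tail.zero)

lemma cspace_mono: "m \<le> n \<Longrightarrow> cspace m \<subseteq> cspace n"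
  by (auto simp: cspace_iff)

lemma sum_lessThan_add: "(\<Sum>i<m + n. f i) = (\<Sum>i<m. f i) + (\<Sum>i<n. f (m + i))"
  for f :: "nat \<Rightarrow> complex"
  by (induction n) (auto simp: add.assoc)

lemma inner_split: "inner (m + n) w w' = inner m (head m w) (head m w') + inner n (tail m w) (tail m w')"
  unfolding inner_def sum_lessThan_add by (simp add: head_def tail_def)

lemma split_subspace:
  assumes S: "cv.subspace S" "S \<subseteq> cspace m" and T: "cv.subspace T" "T \<subseteq> cspace n"
  shows "cv.subspace {w \<in> cspace (m + n). head m w \<in> S \<and> tail m w \<in> T}" (is "cv.subspace ?W")
    and "cv.dim {w \<in> cspace (m + n). head m w \<in> S \<and> tail m w \<in> T} = cv.dim S + cv.dim T"
proof -
  have "?W = cspace (m + n) \<inter> ({w. head m w \<in> S} \<inter> {w. tail m w \<in> T})" by blast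
  moreover have "cv.subspace (cspace (m + n) \<inter> ({w. head m w \<in> S} \<inter> {w. tail m w \<in> T}))"
    by (intro cv.subspace_inter coords_subspace head.subspace_linear_preimage tail.subspace_linear_preimage S T)
  ultimately show W: "cv.subspace ?W" by simp
  have fW: "cv.fin_dim ?W" by (rule cv.fin_dim_subset[OF cspace_fin Collect_restrict])
  have "{w \<in> ?W. head m w = 0} = shift m ` T"
  proof
    show "{w \<in> ?W. head m w = 0} \<subseteq> shift m ` T"
    proof
      fix w assume w: "w \<in> {w \<in> ?W. head m w = 0}"
      then have "w = shift m (tail m w)" using head_tail[of m w] by simp
      then show "w \<in> shift m ` T" using w by blast
    qed
    show "shift m ` T \<subseteq> {w \<in> ?W. head m w = 0}"
      using T shift_coords cv.subspace_0[OF S(1)] by auto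
  qed
  moreover have "head m ` ?W = S"
  proof
    show "S \<subseteq> head m ` ?W"
    proof
      fix u assume u: "u \<in> S"
      then have um: "u \<in> cspace m" using S(2) by blast
      then have "u \<in> cspace (m + n)" using cspace_mono[of m "m + n"] by auto
      then have "u \<in> ?W" using u um cv.subspace_0[OF T(1)] by (simp add: head_id tail_0)
      then show "u \<in> head m ` ?W" using imageI[of u ?W "head m"] head_id[OF um] by simp
    qed
  qed blast
  moreover have "cv.dim (shift m ` T) = cv.dim T"
    by (rule cv.dim_image_inj[OF shift_lin T(1)]) (metis tail_shift tail.zero)
  ultimately show "cv.dim ?W = cv.dim S + cv.dim T"
    using cv.rank_nullity[OF head_lin W fW, of m] by simp
qed

text \<open>\<open>h\<close> is the form of a Hermitian block matrix with corner \<open>a\<close>,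
  border \<open>\<beta>\<close> and zero corner. Where the head lies in \<open>K\<close> the border
  terms vanish and \<open>h\<close> reduces to \<open>a\<close>, whatever the tail. The remaining
  \<open>m - dim K\<close> directions pair with tails hyperbolically and add one each to the
  index.\<close>

lemma bordered_index:
  assumes a: "cv.hermitian_form a" and \<beta>: "cv.lin \<beta>" "\<And>u. \<beta> u \<in> cspace n"
    and h: "cv.hermitian_form h"
    and hdef: "\<And>w w'. h w w' = a (head m w) (head m w')
      + (inner n (\<beta> (head m w)) (tail m w') + cnj (inner n (\<beta> (head m w')) (tail m w)))"
  defines "K \<equiv> {u \<in> cspace m. \<beta> u = 0}"
  shows "cv.pos_index h (cspace (m + n)) + cv.dim K = m + cv.pos_index a K"
proof -
  interpret \<beta>: Vector_Spaces.linear vscale vscale \<beta> by (rule \<beta>(1))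
  have K: "cv.subspace K" "K \<subseteq> cspace m" unfolding K_def using cv.subspace_kernel_on[OF \<beta>(1) coords_subspace] by auto
  have fK: "cv.fin_dim K" by (rule cv.fin_dim_subset[OF cspace_fin K(2)])
  obtain P where P: "cv.subspace P" "P \<subseteq> K" "cv.pos_on a P" "cv.dim P = cv.pos_index a K"
    using cv.pos_index_attained[OF fK K(1)] .
  let ?B = "\<beta> ` cspace m"
  have B: "cv.subspace ?B" "?B \<subseteq> cspace n" using \<beta>.subspace_image[OF coords_subspace] \<beta>(2) by auto
  have dB: "m = cv.dim K + cv.dim ?B"
    using cv.rank_nullity[OF \<beta>(1) coords_subspace cspace_fin[of m]] unfolding K_def by (simp add: dim_cspace)
  have hK: "h w w = a (head m w) (head m w)" if "head m w \<in> K" for w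
    using that cv.form_zero_left[OF inner_hermitian] unfolding hdef K_def by simp
  have PW: "P \<subseteq> cspace m" using P(2) K(2) by blast
  \<comment> \<open>Tails are restricted to the image of \<open>\<beta>\<close>. The form is only
    nonnegative on \<open>?S\<close>, but a tail \<open>\<beta> u\<close> is detected by pairing
    with \<open>u\<close>, so \<open>?S\<close> meets the radical in 0 and
    \<open>dim_nonneg_le\<close> counts its full dimension.\<close>
  let ?S = "{w \<in> cspace (m + n). head m w \<in> P \<and> tail m w \<in> ?B}"
  note S = split_subspace[OF P(1) PW B]
  have Pnn: "0 \<le> Re (a x x)" if "x \<in> P" for x
    using P(3) that cv.form_zero_left[OF a, of 0] unfolding cv.pos_on_def by (cases "x = 0") force+
  have nn: "cv.nonneg_on h ?S" unfolding cv.nonneg_on_def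
  proof
    fix w assume "w \<in> ?S"
    then have "head m w \<in> P" by blast
    then show "0 \<le> Re (h w w)" using hK[of w] P(2) Pnn by auto
  qed
  have "w = 0" if w: "w \<in> ?S" "w \<in> cv.radical h (cspace (m + n))" for w
  proof -
    have hw: "head m w \<in> P" and tw: "tail m w \<in> ?B" using w(1) by auto
    have "h w w = 0" using w unfolding cv.orth_def by blast
    then have "a (head m w) (head m w) = 0" using hK[of w] hw P(2) by auto
    then have h0: "head m w = 0" using cv.pos_on_null[OF P(3) hw] by blast
    obtain u where u: "u \<in> cspace m" "tail m w = \<beta> u" using tw by blast
    then have "u \<in> cspace (m + n)" using cspace_mono[of m "m + n"] by auto
    then have "h w u = 0" using w(2) unfolding cv.orth_def by blast
    then have "inner n (\<beta> u) (\<beta> u) = 0"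
      unfolding hdef h0 head_id[OF u(1)] tail_0[OF u(1)] u(2) cv.form_zero_left[OF a]
        cv.form_zero_right[OF inner_hermitian] by simp
    then have "tail m w = 0" using cv.pos_on_null[OF inner_pos \<beta>(2)] u(2) by metis
    then show ?thesis using head_tail_zero h0 by blast
  qed
  then have "?S \<inter> cv.radical h (cspace (m + n)) \<subseteq> {0}" by blast
  then have "cv.dim (?S \<inter> cv.radical h (cspace (m + n))) = 0" by (rule cv.dim_zero_subset)
  then have 1: "cv.dim P + cv.dim ?B \<le> cv.pos_index h (cspace (m + n))"
    using cv.dim_nonneg_le[OF h coords_subspace cspace_fin S(1) Collect_restrict nn] S(2) by simp
  let ?Q = "cv.orth a P K"
  have Q: "cv.subspace ?Q" "?Q \<subseteq> cspace m"
    using cv.subspace_orth[OF a K(1)] order_trans[OF cv.orth_subset K(2)] .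
  note T = split_subspace[OF Q coords_subspace order_refl, of n]
  have "cv.pos_index h (cspace (m + n)) + cv.dim {w \<in> cspace (m + n). head m w \<in> ?Q \<and> tail m w \<in> cspace n}
      \<le> cv.dim (cspace (m + n))"
  proof (rule cv.pos_index_le[OF cspace_fin coords_subspace T(1) Collect_restrict])
    fix w assume "w \<in> {w \<in> cspace (m + n). head m w \<in> ?Q \<and> tail m w \<in> cspace n}"
    then have q: "head m w \<in> ?Q" by blast
    then have "head m w \<in> K" using cv.orth_subset by blast
    then show "Re (h w w) \<le> 0" using hK cv.orth_max_pos_nonpos[OF a K(1) fK P q] by simp
  qed
  then have "cv.pos_index h (cspace (m + n)) + (cv.dim ?Q + n) \<le> m + n"
    unfolding T(2) by (simp add: dim_cspace)
  moreover have "cv.dim K = cv.dim P + cv.dim ?Q"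
    by (rule cv.orth_complement_pos(3)[OF a K(1) fK P(1-3)])
  ultimately show ?thesis using 1 dB P(4) by linarith
qed

lemma mat_fun_four_block:
  assumes "A \<in> carrier_mat a c" "B \<in> carrier_mat a d" "C \<in> carrier_mat b c" "D \<in> carrier_mat b d"
  shows "head a (mat_fun (four_block_mat A B C D) w) = mat_fun A (head c w) + mat_fun B (tail c w)"
    and "tail a (mat_fun (four_block_mat A B C D) w) = mat_fun C (head c w) + mat_fun D (tail c w)"
  using assms by (auto simp: mat_fun_def head_def tail_def fun_eq_iff sum_lessThan_add)

lemma hermitian_four_block:
  assumes "A \<in> hermitian_mats m" "B \<in> carrier_mat m n" "D \<in> hermitian_mats n"
  shows "four_block_mat A B (mat_adjoint B) D \<in> hermitian_mats (m + n)"
proof (rule hermitian_matsI)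
  note A = hermitian_matsD[OF assms(1)] and D = hermitian_matsD[OF assms(3)]
  show "four_block_mat A B (mat_adjoint B) D \<in> carrier_mat (m + n) (m + n)" using A D by simp
  fix i j assume "i < m + n" "j < m + n"
  moreover have "A $$ (i, j) = cnj (A $$ (j, i))" if "i < m" "j < m"
    using mat_adjoint_index(3)[of i A j] that A by simp
  moreover have "D $$ (i - m, j - m) = cnj (D $$ (j - m, i - m))" if "i - m < n" "j - m < n"
    using mat_adjoint_index(3)[of "i - m" D "j - m"] that D by simp
  ultimately show "four_block_mat A B (mat_adjoint B) D $$ (i, j) = cnj (four_block_mat A B (mat_adjoint B) D $$ (j, i))"
    using A(3,4) D(3,4) assms(2) by auto
qed

lemma zero_hermitian: "0\<^sub>m n n \<in> hermitian_mats n"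
  by (rule hermitian_matsI) auto

lemma mat_fun_zero [simp]: "mat_fun (0\<^sub>m m n) f = 0"
  by (auto simp: mat_fun_def fun_eq_iff)

lemma bordered_inertia:
  assumes A: "A \<in> hermitian_mats m" and B: "B \<in> carrier_mat m n"
  defines "M \<equiv> four_block_mat A B (mat_adjoint B) (0\<^sub>m n n)"
    and "K \<equiv> {u \<in> cspace m. mat_fun (mat_adjoint B) u = 0}"
  shows "pos_inertia M + cv.dim K = m + cv.pos_index (mat_form A) K"
    and "neg_inertia M + cv.dim K = m + cv.neg_index (mat_form A) K"
proof -
  note Ad = hermitian_matsD[OF A]
  let ?\<beta> = "mat_fun (mat_adjoint B)"
  have B': "mat_adjoint B \<in> carrier_mat n m" using mat_adjoint_carrier[OF B] .
  have M: "M \<in> hermitian_mats (m + n)" unfolding M_def by (rule hermitian_four_block[OF A B zero_hermitian])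
  have a: "cv.hermitian_form (mat_form A)" using mat_form_hermitian[OF A] .
  have h: "cv.hermitian_form (mat_form M)" using mat_form_hermitian[OF M] .
  have \<beta>: "cv.lin ?\<beta>" "\<And>u. ?\<beta> u \<in> cspace n" using mat_fun_linear mat_fun_carrier[OF B'] .
  have hdef: "mat_form M w w' = mat_form A (head m w) (head m w')
      + (inner n (?\<beta> (head m w)) (tail m w') + cnj (inner n (?\<beta> (head m w')) (tail m w)))" for w w'
  proof -
    have "mat_form M w w' = inner m (mat_fun A (head m w) + mat_fun B (tail m w)) (head m w')
        + inner n (?\<beta> (head m w) + mat_fun (0\<^sub>m n n) (tail m w)) (tail m w')"
    proof -
      have "mat_form M w w' = inner (m + n) (mat_fun M w) w'"
        unfolding mat_form_def hermitian_matsD(3)[OF M] ..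
      then show ?thesis
        unfolding inner_split M_def mat_fun_four_block[OF Ad(1) B B' zero_carrier_mat] .
    qed
    moreover have "inner m (mat_fun B (tail m w)) (head m w') = cnj (inner n (?\<beta> (head m w')) (tail m w))"
      unfolding mat_fun_adjoint[OF B] by (rule cv.form_cnj[OF inner_hermitian])
    ultimately show ?thesis
      by (simp add: cv.form_add_left[OF inner_hermitian] mat_form_def Ad del: plus_fun_apply)
  qed
  show "pos_inertia M + cv.dim K = m + cv.pos_index (mat_form A) K"
    unfolding K_def pos_inertia_eq[OF M] by (rule bordered_index[OF a \<beta> h hdef])
  \<comment> \<open>For the negative index the same lemma is applied to the negated form; the sign
    of the border terms moves into the border map, whose kernel is still \<open>K\<close>.\<close>
  let ?\<gamma> = "\<lambda>u. vscale (-1) (?\<beta> u)"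
  have \<gamma>: "cv.lin ?\<gamma>" "\<And>u. ?\<gamma> u \<in> cspace n"
  proof -
    show "cv.lin ?\<gamma>"
      by (rule cv.linearI') (auto simp: mat_fun_add mat_fun_scale fun_eq_iff)
    show "?\<gamma> u \<in> cspace n" for u using cv.subspace_scale[OF coords_subspace \<beta>(2)] .
  qed
  have hdef': "- mat_form M w w' = - mat_form A (head m w) (head m w')
      + (inner n (?\<gamma> (head m w)) (tail m w') + cnj (inner n (?\<gamma> (head m w')) (tail m w)))" for w w'
    unfolding hdef cv.form_scale_left[OF inner_hermitian] by simp
  have K': "K = {u \<in> cspace m. ?\<gamma> u = 0}" unfolding K_def by simp
  show "neg_inertia M + cv.dim K = m + cv.neg_index (mat_form A) K"
    unfolding neg_inertia_eq[OF M] K'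
    by (rule bordered_index[OF cv.hermitian_form_uminus[OF a] \<gamma> cv.hermitian_form_uminus[OF h] hdef'])
qed

section \<open>Row and column block matrices\<close>

lemma append_rows_dim [simp]:
  "dim_row (A @\<^sub>r B) = dim_row A + dim_row B" "dim_col (A @\<^sub>r B) = dim_col A"
  by (simp_all add: append_rows_def)

lemma append_cols_dim [simp]:
  "dim_row (A @\<^sub>c B) = dim_row A" "dim_col (A @\<^sub>c B) = dim_col A + dim_col B"
  by (simp_all add: append_cols_def)

lemma append_rows_index:
  "i < dim_row A + dim_row B \<Longrightarrow> j < dim_col A \<Longrightarrow>
    (A @\<^sub>r B) $$ (i, j) = (if i < dim_row A then A $$ (i, j) else B $$ (i - dim_row A, j))"
  by (simp add: append_rows_def)

lemma append_cols_index:
  "i < dim_row A \<Longrightarrow> j < dim_col A + dim_col B \<Longrightarrow>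
    (A @\<^sub>c B) $$ (i, j) = (if j < dim_col A then A $$ (i, j) else B $$ (i, j - dim_col A))"
  by (simp add: append_cols_def)

lemma append_cols_carrier: "A \<in> carrier_mat m p \<Longrightarrow> B \<in> carrier_mat m q \<Longrightarrow> A @\<^sub>c B \<in> carrier_mat m (p + q)"
  by (auto intro: carrier_matI)

lemma mat_adjoint_append_rows:
  fixes A B :: "complex mat"
  assumes "A \<in> carrier_mat p n" "B \<in> carrier_mat q n"
  shows "mat_adjoint (A @\<^sub>r B) = mat_adjoint A @\<^sub>c mat_adjoint B"
  using assms by (intro eq_matI) (auto simp: append_rows_index append_cols_index)

lemma mat_adjoint_append_cols:
  fixes A B :: "complex mat"
  assumes "A \<in> carrier_mat m p" "B \<in> carrier_mat m q"
  shows "mat_adjoint (A @\<^sub>c B) = mat_adjoint A @\<^sub>r mat_adjoint B"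
  using assms by (intro eq_matI) (auto simp: append_rows_index append_cols_index)

lemma mat_fun_append_rows:
  assumes "A \<in> carrier_mat p n" "B \<in> carrier_mat q n"
  shows "head p (mat_fun (A @\<^sub>r B) f) = mat_fun A f" "tail p (mat_fun (A @\<^sub>r B) f) = mat_fun B f"
  using assms by (auto simp: mat_fun_def head_def tail_def fun_eq_iff append_rows_index)

lemma mat_fun_append_rows_zero:
  assumes "A \<in> carrier_mat p n" "B \<in> carrier_mat q n"
  shows "mat_fun (A @\<^sub>r B) f = 0 \<longleftrightarrow> mat_fun A f = 0 \<and> mat_fun B f = 0"
  using mat_fun_append_rows[OF assms, of f] head_tail_zero[of p "mat_fun (A @\<^sub>r B) f"]
  by (metis head.zero tail.zero)

lemma mat_fun_append_cols:
  assumes "A \<in> carrier_mat m p" "B \<in> carrier_mat m q"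
  shows "mat_fun (A @\<^sub>c B) w = mat_fun A (head p w) + mat_fun B (tail p w)"
  using assms by (auto simp: mat_fun_def head_def tail_def fun_eq_iff sum_lessThan_add append_cols_index)

lemma left_kernel_subspace: "cv.subspace (left_kernel A)"
  unfolding left_kernel_def by (rule cv.subspace_kernel_on[OF mat_fun_linear coords_subspace])

lemma left_kernel_append_cols:
  assumes "A \<in> carrier_mat m p" "B \<in> carrier_mat m q"
  shows "left_kernel (A @\<^sub>c B) = left_kernel A \<inter> left_kernel B"
  using assms mat_adjoint_append_cols[OF assms]
    mat_fun_append_rows_zero[OF mat_adjoint_carrier[OF assms(1)] mat_adjoint_carrier[OF assms(2)]]
  by (auto simp: left_kernel_def)

lemma left_kernel_append_rows:
  assumes "A \<in> carrier_mat p n" "B \<in> carrier_mat q n"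
  shows "left_kernel (A @\<^sub>r B) = {w \<in> cspace (p + q).
    mat_fun (mat_adjoint A) (head p w) + mat_fun (mat_adjoint B) (tail p w) = 0}"
  using assms mat_adjoint_append_rows[OF assms]
    mat_fun_append_cols[OF mat_adjoint_carrier[OF assms(1)] mat_adjoint_carrier[OF assms(2)]]
  by (auto simp: left_kernel_def)

section \<open>The constrained matrix expression\<close>

lemma sandwich_hermitian:
  assumes A: "A \<in> hermitian_mats m" and X: "X \<in> hermitian_mats n" and B: "B \<in> carrier_mat m n"
  shows "A - B * X * mat_adjoint B \<in> hermitian_mats m"
proof (rule hermitian_matsI)
  let ?F = "A - B * X * mat_adjoint B"
  note Ad = hermitian_matsD[OF A] and Xd = hermitian_matsD[OF X]
  have "B * X * mat_adjoint B \<in> carrier_mat m m"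
    using B Xd(1) mat_adjoint_carrier[OF B] by (meson mult_carrier_mat)
  then show F: "?F \<in> carrier_mat m m" by (rule minus_carrier_mat)
  have f: "cv.hermitian_form (mat_form ?F)"
    using cv.hermitian_form_diff[OF mat_form_hermitian[OF A]
        cv.hermitian_form_pullback[OF mat_form_hermitian[OF X] mat_fun_linear[of "mat_adjoint B"]]]
    unfolding mat_form_sandwich[OF Ad(1) Xd(1) B, abs_def] .
  show "?F $$ (i, j) = cnj (?F $$ (j, i))" if "i < m" "j < m" for i j
    unfolding mat_form_entry[OF F that, symmetric] mat_form_entry[OF F that(2,1), symmetric]
    by (rule cv.form_cnj[OF f])
qed

lemma uminus_hermitian:
  assumes "A \<in> hermitian_mats m" shows "- A \<in> hermitian_mats m"
proof (rule hermitian_matsI)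
  note A = hermitian_matsD[OF assms]
  show "- A \<in> carrier_mat m m" using A by simp
  show "(- A) $$ (i, j) = cnj ((- A) $$ (j, i))" if "i < m" "j < m" for i j
    using mat_adjoint_index(3)[of i A j] A that by simp
qed

lemma mat_form_uminus: "mat_form (- A) f g = - mat_form A f g"
  by (simp add: mat_form_def mat_fun_uminus cv.form_minus_left[OF inner_hermitian])

lemma uminus_sandwich:
  assumes "A \<in> carrier_mat m m" "C \<in> carrier_mat m m"
  shows "C - A = - (A - C :: complex mat)"
  using assms by (intro eq_matI) auto

lemma
  assumes H: "H \<in> hermitian_mats m"
  shows pos_def_inertia: "pos_def H \<longleftrightarrow> pos_inertia H = m"
    and pos_def_uminus_inertia: "pos_def (- H) \<longleftrightarrow> neg_inertia H = m"
    and pos_semidef_inertia: "pos_semidef H \<longleftrightarrow> neg_inertia H = 0"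
    and pos_semidef_uminus_inertia: "pos_semidef (- H) \<longleftrightarrow> pos_inertia H = 0"
proof -
  note h = mat_form_hermitian[OF H] and mH = uminus_hermitian[OF H]
  note mh = cv.hermitian_form_uminus[OF h]
  have mf: "mat_form (- H) = (\<lambda>x y. - mat_form H x y)" by (simp add: fun_eq_iff mat_form_uminus)
  show "pos_def H \<longleftrightarrow> pos_inertia H = m"
    using pos_def_iff[OF H] pos_inertia_eq[OF H] cv.pos_index_full_iff[OF h coords_subspace cspace_fin, of m]
    by (simp add: dim_cspace)
  show "pos_def (- H) \<longleftrightarrow> neg_inertia H = m"
    using pos_def_iff[OF mH] neg_inertia_eq[OF H] cv.pos_index_full_iff[OF mh coords_subspace cspace_fin, of m]
    by (simp add: dim_cspace mf)
  show "pos_semidef H \<longleftrightarrow> neg_inertia H = 0"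
    using pos_semidef_iff[OF H] neg_inertia_eq[OF H] cv.pos_index_zero_iff[OF mh coords_subspace cspace_fin, of m]
    by (simp add: cv.nonneg_on_def)
  show "pos_semidef (- H) \<longleftrightarrow> pos_inertia H = 0"
    using pos_semidef_iff[OF mH] pos_inertia_eq[OF H] cv.pos_index_zero_iff[OF h coords_subspace cspace_fin, of m]
    by (simp add: cv.nonneg_on_def mf)
qed

lemma mat_form_radical:
  assumes "A \<in> hermitian_mats m" "f \<in> cspace m" "\<And>g. g \<in> cspace m \<Longrightarrow> mat_form A f g = 0"
  shows "mat_fun A f = 0"
  using inner_eq_0_imp[OF mat_fun_carrier[of A m m]] assms hermitian_matsD[OF assms(1)]
  unfolding mat_form_def by simp

lemma mat_form_eq_0: "mat_fun A f = 0 \<Longrightarrow> mat_form A f g = 0"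
  unfolding mat_form_def by (simp only: cv.form_zero_left[OF inner_hermitian])

lemma left_kernel_hermitian:
  assumes A: "A \<in> hermitian_mats m"
  shows "left_kernel A = cv.radical (mat_form A) (cspace m)"
  using mat_form_radical[OF A] mat_form_eq_0 hermitian_matsD[OF A]
  unfolding left_kernel_def cv.orth_def by auto

text \<open>The radical in \<open>inertia_sum\<close> is the left kernel of the matrix.\<close>

lemma rank_inertia:
  assumes H: "H \<in> hermitian_mats m"
  shows "mat_rank H = pos_inertia H + neg_inertia H"
  using mat_rank_left_kernel[of H] cv.inertia_sum[OF mat_form_hermitian[OF H] coords_subspace cspace_fin, of m]
  by (simp add: left_kernel_hermitian[OF H] pos_inertia_eq[OF H] neg_inertia_eq[OF H] dim_cspace hermitian_matsD[OF H])

lemma hermitian_zero_iff: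
  assumes H: "H \<in> hermitian_mats m"
  shows "H = 0\<^sub>m m m \<longleftrightarrow> (\<forall>f\<in>cspace m. \<forall>g\<in>cspace m. mat_form H f g = 0)"
proof
  assume "H = 0\<^sub>m m m"
  then show "\<forall>f\<in>cspace m. \<forall>g\<in>cspace m. mat_form H f g = 0" using mat_form_eq_0[of H] by simp
next
  assume z: "\<forall>f\<in>cspace m. \<forall>g\<in>cspace m. mat_form H f g = 0"
  note Hd = hermitian_matsD[OF H]
  show "H = 0\<^sub>m m m"
  proof (rule eq_matI)
    fix i j assume "i < dim_row (0\<^sub>m m m :: complex mat)" "j < dim_col (0\<^sub>m m m :: complex mat)"
    then have ij: "i < m" "j < m" by auto
    then have "mat_form H (unit_fun j) (unit_fun i) = 0" using z unit_fun_coords by auto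
    then show "H $$ (i, j) = 0\<^sub>m m m $$ (i, j)" using mat_form_entry[OF Hd(1) ij] ij by simp
  qed (use Hd in auto)
qed

lemma rank_zero_iff:
  assumes H: "H \<in> hermitian_mats m" shows "mat_rank H = 0 \<longleftrightarrow> H = 0\<^sub>m m m"
proof
  assume r: "mat_rank H = 0"
  have "cv.dim (left_kernel H) = m" using mat_rank_left_kernel[of H] r hermitian_matsD[OF H] by simp
  then have "left_kernel H = cspace m"
    using cv.dim_subspace_eq[OF left_kernel_subspace coords_subspace _ cspace_fin, of H m]
      hermitian_matsD[OF H] by (auto simp: dim_cspace left_kernel_def)
  then show "H = 0\<^sub>m m m"
    unfolding hermitian_zero_iff[OF H] left_kernel_hermitian[OF H] cv.orth_def by blast
next
  assume "H = 0\<^sub>m m m"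
  then have "cv.radical (mat_form H) (cspace m) = cspace m"
    using hermitian_zero_iff[OF H] unfolding cv.orth_def by blast
  then show "mat_rank H = 0"
    using mat_rank_left_kernel[of H] left_kernel_hermitian[OF H] hermitian_matsD[OF H] by (simp add: dim_cspace)
qed

lemma invertible_iff_rank:
  assumes A: "A \<in> carrier_mat m m"
  shows "invertible_mat (A :: complex mat) \<longleftrightarrow> mat_rank A = m"
proof -
  interpret vec_space "TYPE(complex)" m .
  have "invertible_mat A \<longleftrightarrow> det A \<noteq> 0"
  proof
    assume "invertible_mat A"
    then obtain B where B: "A * B = 1\<^sub>m m" "B * A = 1\<^sub>m (dim_row B)"
      using A unfolding invertible_mat_def inverts_mat_def by auto
    have "dim_col (A * B) = m" "dim_col (B * A) = dim_row B" unfolding B by simp_all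
    then have "B \<in> carrier_mat m m" using A by (auto intro: carrier_matI)
    then have "det A * det B = 1" using det_mult[OF A] B(1) by (metis det_one)
    then show "det A \<noteq> 0" by auto
  next
    assume "det A \<noteq> 0"
    then have "A \<in> Units (ring_mat TYPE(complex) m ())" by (rule det_non_zero_imp_unit[OF A])
    then show "invertible_mat A"
      using A unfolding Units_def ring_mat_def invertible_mat_def inverts_mat_def by auto
  qed
  then show ?thesis using det_rank_iff[OF A] A by auto
qed

lemma diff_zero_mat_eq:
  assumes "A \<in> carrier_mat m n" "C \<in> carrier_mat m n" "A - C = 0\<^sub>m m n"
  shows "C = (A :: complex mat)"
proof (rule eq_matI)
  fix i j assume "i < dim_row A" "j < dim_col A"
  then have ij: "i < m" "j < n" using assms(1) by auto
  have "(A - C) $$ (i, j) = 0" unfolding assms(3) using ij by simp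
  then show "C $$ (i, j) = A $$ (i, j)" using assms(1,2) ij by simp
qed (use assms in auto)

text \<open>Orthogonal complements reverse the inclusion of ranges, and for Hermitian
  \<open>A\<close> the complement of the range is the kernel.\<close>

lemma range_subset_kernel:
  assumes A: "A \<in> hermitian_mats m" and B: "B \<in> carrier_mat m n"
    and R: "mat_range A \<subseteq> mat_range B" and u: "u \<in> cspace m" "mat_fun (mat_adjoint B) u = 0"
  shows "mat_fun A u = 0"
proof (rule mat_form_radical[OF A u(1)])
  note Ad = hermitian_matsD[OF A]
  fix w assume w: "w \<in> cspace m"
  have "mat_fun A ` cspace m \<subseteq> mat_fun B ` cspace n"
    using R mat_range_subset_iff[of A B] Ad B by simp
  then obtain y where y: "mat_fun A w = mat_fun B y" using w by blast
  have "mat_form A w u = 0"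
    unfolding mat_form_def Ad(3) y mat_fun_adjoint[OF B] u(2) by (rule cv.form_zero_right[OF inner_hermitian])
  then show "mat_form A u w = 0" by (rule cv.form_sym_zero[OF mat_form_hermitian[OF A]])
qed

text \<open>For the converse, \<open>X\<close> is the form of \<open>A\<close> transported to the
  range of the adjoint of \<open>B\<close> by a section. The choice of section does not matter,
  because \<open>A\<close> vanishes on the kernel of that adjoint.\<close>

lemma sandwich_solvable_iff:
  assumes A: "A \<in> hermitian_mats m" and B: "B \<in> carrier_mat m n"
  shows "(\<exists>X\<in>hermitian_mats n. B * X * mat_adjoint B = A) \<longleftrightarrow> mat_range A \<subseteq> mat_range B"
proof
  note Ad = hermitian_matsD[OF A] and B' = mat_adjoint_carrier[OF B]
  assume "\<exists>X\<in>hermitian_mats n. B * X * mat_adjoint B = A"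
  then obtain X where X: "X \<in> hermitian_mats n" "B * X * mat_adjoint B = A" by blast
  have BX: "B * X \<in> carrier_mat m n" using B hermitian_matsD(1)[OF X(1)] by (rule mult_carrier_mat)
  have "mat_fun A f = mat_fun B (mat_fun X (mat_fun (mat_adjoint B) f))" for f
    unfolding X(2)[symmetric] mat_fun_mult[OF BX B'] mat_fun_mult[OF B hermitian_matsD(1)[OF X(1)]] ..
  then have "mat_fun A ` cspace m \<subseteq> mat_fun B ` cspace n"
    using mat_fun_carrier[OF hermitian_matsD(1)[OF X(1)]] by blast
  then show "mat_range A \<subseteq> mat_range B" using mat_range_subset_iff[of A B] Ad B by simp
next
  note Ad = hermitian_matsD[OF A]
  assume R: "mat_range A \<subseteq> mat_range B"
  let ?\<beta> = "mat_fun (mat_adjoint B)"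
  interpret \<beta>: Vector_Spaces.linear vscale vscale ?\<beta> by (rule mat_fun_linear)
  have a: "cv.hermitian_form (mat_form A)" by (rule mat_form_hermitian[OF A])
  obtain \<gamma> where \<gamma>: "cv.lin \<gamma>" "\<And>x. \<gamma> x \<in> cspace m" "\<And>y. y \<in> ?\<beta> ` cspace m \<Longrightarrow> ?\<beta> (\<gamma> y) = y"
    using cv.linear_section[OF mat_fun_linear[of "mat_adjoint B"] coords_subspace] by blast
  have eq: "mat_form A (\<gamma> (?\<beta> f)) g = mat_form A f g" if f: "f \<in> cspace m" for f g
  proof -
    have "?\<beta> (\<gamma> (?\<beta> f) - f) = 0" using \<gamma>(3) f by (simp add: \<beta>.diff)
    moreover have "\<gamma> (?\<beta> f) - f \<in> cspace m" by (rule cv.subspace_diff[OF coords_subspace \<gamma>(2) f])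
    ultimately have "mat_fun A (\<gamma> (?\<beta> f) - f) = 0" by (intro range_subset_kernel[OF A B R])
    then have "mat_form A (\<gamma> (?\<beta> f) - f) g = 0" by (rule mat_form_eq_0)
    then show ?thesis unfolding cv.form_diff_left[OF a] by simp
  qed
  obtain X where X: "X \<in> hermitian_mats n"
    "\<And>f g. f \<in> cspace n \<Longrightarrow> g \<in> cspace n \<Longrightarrow> mat_form X f g = mat_form A (\<gamma> f) (\<gamma> g)"
    using matrix_of_form[OF cv.hermitian_form_pullback[OF a \<gamma>(1)], of n] by blast
  let ?F = "A - B * X * mat_adjoint B"
  have "mat_form ?F f g = 0" if f: "f \<in> cspace m" and g: "g \<in> cspace m" for f g
  proof -
    have \<beta>n: "?\<beta> h \<in> cspace n" for h by (rule mat_fun_carrier[OF mat_adjoint_carrier[OF B]])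
    have "mat_form A f (\<gamma> (?\<beta> g)) = mat_form A f g"
      using eq[OF g, of f] cv.form_cnj[OF a, of f "\<gamma> (?\<beta> g)"] cv.form_cnj[OF a, of f g] by simp
    then show ?thesis
      unfolding mat_form_sandwich[OF Ad(1) hermitian_matsD(1)[OF X(1)] B] X(2)[OF \<beta>n \<beta>n] eq[OF f] by simp
  qed
  then have z: "?F = 0\<^sub>m m m" using hermitian_zero_iff[OF sandwich_hermitian[OF A X(1) B]] by blast
  have "B * X * mat_adjoint B \<in> carrier_mat m m"
    using B hermitian_matsD(1)[OF X(1)] mat_adjoint_carrier[OF B] by (meson mult_carrier_mat)
  then have "B * X * mat_adjoint B = A" using diff_zero_mat_eq[OF Ad(1) _ z] by simp
  then show "\<exists>X\<in>hermitian_mats n. B * X * mat_adjoint B = A" using X(1) by blast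
qed

section \<open>The constraint and its feasibility\<close>

locale lmi =
  fixes A1 A2 B1 B2 :: "complex mat" and m1 m2 n :: nat
  assumes A1: "A1 \<in> hermitian_mats m1" and A2: "A2 \<in> hermitian_mats m2"
    and B1: "B1 \<in> carrier_mat m1 n" and B2: "B2 \<in> carrier_mat m2 n"
begin

abbreviation "\<beta>1 \<equiv> mat_fun (mat_adjoint B1)"
abbreviation "\<beta>2 \<equiv> mat_fun (mat_adjoint B2)"
abbreviation "a1 \<equiv> mat_form A1"
abbreviation "a2 \<equiv> mat_form A2"
abbreviation "K \<equiv> {u \<in> cspace m1. \<beta>1 u = 0}"
abbreviation "L \<equiv> {v \<in> cspace m2. \<beta>2 v = 0}"
abbreviation "V \<equiv> \<beta>2 ` cspace m2"
abbreviation "L0 \<equiv> {v \<in> L. mat_fun A2 v = 0}"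
abbreviation "M \<equiv> four_block_mat
                  (four_block_mat A1 (0\<^sub>m m1 m2) (0\<^sub>m m2 m1) (- A2)) (B1 @\<^sub>r B2)
                  (mat_adjoint B1 @\<^sub>c mat_adjoint B2)               (0\<^sub>m n n)"
abbreviation "N \<equiv> (A1 @\<^sub>c B1 @\<^sub>c 0\<^sub>m m1 m2) @\<^sub>r
                (mat_adjoint B1 @\<^sub>c 0\<^sub>m n n @\<^sub>c mat_adjoint B2)"
abbreviation "M1 \<equiv> four_block_mat A1 B1 (mat_adjoint B1) (0\<^sub>m n n)"
abbreviation "M2 \<equiv> four_block_mat A2 B2 (mat_adjoint B2) (0\<^sub>m n n)"
abbreviation "T1 \<equiv> {X \<in> hermitian_mats n. B2 * X * mat_adjoint B2 \<succeq>\<^sub>L A2}"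
abbreviation "F X \<equiv> A1 - B1 * X * mat_adjoint B1"

lemmas A1d = hermitian_matsD[OF A1] and A2d = hermitian_matsD[OF A2]
lemmas B1' = mat_adjoint_carrier[OF B1] and B2' = mat_adjoint_carrier[OF B2]
lemmas a1 = mat_form_hermitian[OF A1] and a2 = mat_form_hermitian[OF A2]

sublocale \<beta>1: Vector_Spaces.linear vscale vscale \<beta>1 by (rule mat_fun_linear)
sublocale \<beta>2: Vector_Spaces.linear vscale vscale \<beta>2 by (rule mat_fun_linear)

lemma \<beta>1_coords: "\<beta>1 u \<in> cspace n" and \<beta>2_coords: "\<beta>2 u \<in> cspace n"
  using mat_fun_carrier[OF B1'] mat_fun_carrier[OF B2'] .

lemma K: "cv.subspace K" "K \<subseteq> cspace m1" "cv.fin_dim K"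
  and L: "cv.subspace L" "L \<subseteq> cspace m2" "cv.fin_dim L"
  by (rule cv.subspace_kernel_on[OF mat_fun_linear coords_subspace] Collect_restrict
      cv.fin_dim_subset[OF cspace_fin Collect_restrict])+

lemma V: "cv.subspace V" "V \<subseteq> cspace n"
  using \<beta>2.subspace_image[OF coords_subspace] \<beta>2_coords by auto

lemma F_hermitian: "X \<in> hermitian_mats n \<Longrightarrow> F X \<in> hermitian_mats m1"
  by (rule sandwich_hermitian[OF A1 _ B1])

lemma F_form: "X \<in> hermitian_mats n \<Longrightarrow> mat_form (F X) u v = a1 u v - mat_form X (\<beta>1 u) (\<beta>1 v)"
  by (rule mat_form_sandwich[OF A1d(1) _ B1]) (rule hermitian_matsD)

lemma sandwich_carrier:
  "X \<in> hermitian_mats n \<Longrightarrow> B1 * X * mat_adjoint B1 \<in> carrier_mat m1 m1"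
  "X \<in> hermitian_mats n \<Longrightarrow> B2 * X * mat_adjoint B2 \<in> carrier_mat m2 m2"
  using B1 B1' B2 B2' hermitian_matsD(1)[of X n] by (meson mult_carrier_mat)+

lemma loewner_iff:
  assumes X: "X \<in> hermitian_mats n"
  shows "B2 * X * mat_adjoint B2 \<succeq>\<^sub>L A2 \<longleftrightarrow>
    (\<forall>v\<in>cspace m2. Re (a2 v v) \<le> Re (mat_form X (\<beta>2 v) (\<beta>2 v)))"
proof -
  let ?G = "A2 - B2 * X * mat_adjoint B2"
  have "- ?G \<in> hermitian_mats m2" by (rule uminus_hermitian[OF sandwich_hermitian[OF A2 X B2]])
  then show ?thesis
    unfolding loewner_ge_def uminus_sandwich[OF A2d(1) sandwich_carrier(2)[OF X]]
    by (simp add: pos_semidef_iff cv.nonneg_on_def mat_form_uminus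
        mat_form_sandwich[OF A2d(1) hermitian_matsD(1)[OF X] B2])
qed

text \<open>Solvability of the constraint expressed by \<open>A2\<close> and \<open>B2\<close>
  alone. On \<open>L\<close> no \<open>X\<close> has any influence, so the form of \<open>A2\<close>
  must be nonpositive there, and its null vectors in \<open>L\<close> must not couple with anything
  outside.\<close>

definition feasible :: bool where
  "feasible \<longleftrightarrow> (\<forall>v\<in>L. Re (a2 v v) \<le> 0) \<and> (\<forall>v\<in>L. a2 v v = 0 \<longrightarrow> mat_fun A2 v = 0)"

lemma feasibleD:
  assumes feasible
  shows "v \<in> L \<Longrightarrow> Re (a2 v v) \<le> 0" "v \<in> L \<Longrightarrow> a2 v v = 0 \<Longrightarrow> mat_fun A2 v = 0"
  using assms unfolding feasible_def by blast+

lemma left_kernel_B1: "left_kernel B1 = K" and left_kernel_B2: "left_kernel B2 = L"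
  using B1 B2 by (auto simp: left_kernel_def)

lemma left_kernel_A2B2: "left_kernel (A2 @\<^sub>c B2) = L0"
  unfolding left_kernel_append_cols[OF A2d(1) B2] left_kernel_B2 using A2d by (auto simp: left_kernel_def)

lemma rank_A2B2: "mat_rank (A2 @\<^sub>c B2) + cv.dim L0 = m2"
  using mat_rank_left_kernel[of "A2 @\<^sub>c B2"] unfolding left_kernel_A2B2 using A2d by simp

lemma L0: "cv.subspace L0" "L0 \<subseteq> cv.radical a2 L"
  using left_kernel_subspace[of "A2 @\<^sub>c B2"] unfolding left_kernel_A2B2
  by (auto simp: cv.orth_def mat_form_eq_0)

lemma feasible_radical:
  assumes feasible shows "cv.radical a2 L = L0"
  using feasibleD(2)[OF assms] L0(2) unfolding cv.orth_def by blast

lemma feasible_neg_index: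
  assumes feasible shows "cv.neg_index a2 L + cv.dim L0 = cv.dim L" "cv.pos_index a2 L = 0"
proof -
  show p: "cv.pos_index a2 L = 0"
    using cv.pos_index_zero_iff[OF a2 L(1,3)] feasibleD(1)[OF assms] by blast
  show "cv.neg_index a2 L + cv.dim L0 = cv.dim L"
    using cv.inertia_sum[OF a2 L(1,3)] p feasible_radical[OF assms] by simp
qed

text \<open>\<open>L0\<close> always lies in the radical of \<open>a2\<close> on \<open>L\<close>,
  so by \<open>inertia_sum\<close> equality of dimensions leaves room for neither a positive
  direction nor a further null vector.\<close>

lemma feasible_iff_index: "feasible \<longleftrightarrow> cv.neg_index a2 L + cv.dim L0 = cv.dim L"
proof
  assume e: "cv.neg_index a2 L + cv.dim L0 = cv.dim L"
  have fR: "cv.fin_dim (cv.radical a2 L)" by (rule cv.fin_dim_subset[OF L(3) cv.orth_subset])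
  have "cv.dim L0 \<le> cv.dim (cv.radical a2 L)" by (rule cv.dim_subspace_mono[OF L0(2) fR])
  then have p: "cv.pos_index a2 L = 0" "cv.dim (cv.radical a2 L) \<le> cv.dim L0"
    using cv.inertia_sum[OF a2 L(1,3)] e by simp_all
  have R: "L0 = cv.radical a2 L"
    by (rule cv.dim_subspace_eq[OF L0(1) cv.subspace_orth[OF a2 L(1)] L0(2) fR p(2)])
  have np: "\<forall>v\<in>L. Re (a2 v v) \<le> 0" using cv.pos_index_zero_iff[OF a2 L(1,3)] p(1) by blast
  have "mat_fun A2 v = 0" if v: "v \<in> L" "a2 v v = 0" for v
  proof -
    have nn: "cv.nonneg_on (\<lambda>x y. - a2 x y) L" unfolding cv.nonneg_on_def using np by simp
    have "a2 v w = 0" if "w \<in> L" for w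
      using cv.nonneg_null_orth[OF cv.hermitian_form_uminus[OF a2] L(1) nn v(1) _ that] v(2) by simp
    then have "v \<in> cv.radical a2 L" using v(1) unfolding cv.orth_def by blast
    then show ?thesis using R by blast
  qed
  then show feasible unfolding feasible_def using np by blast
qed (use feasible_neg_index in blast)

lemma neg_inertia_M2: "neg_inertia M2 + cv.dim L = m2 + cv.neg_index a2 L"
  using bordered_inertia(2)[OF A2 B2] .

lemma feasible_iff_M2: "feasible \<longleftrightarrow> neg_inertia M2 = mat_rank (A2 @\<^sub>c B2)"
  unfolding feasible_iff_index using neg_inertia_M2 rank_A2B2 by linarith

text \<open>The constraint makes the difference form \<open>?g\<close> nonnegative. On
  \<open>L\<close> its values are those of \<open>- a2\<close>, and its null vectors are orthogonal
  to the whole space.\<close>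

lemma feasible_necessary:
  assumes X: "X \<in> T1" shows feasible
proof -
  have hX: "X \<in> hermitian_mats n" using X by blast
  have G: "0 \<le> Re (mat_form X (\<beta>2 v) (\<beta>2 v) - a2 v v)" if "v \<in> cspace m2" for v
    using X that loewner_iff[OF hX] by auto
  let ?g = "\<lambda>v w. mat_form X (\<beta>2 v) (\<beta>2 w) - a2 v w"
  have g: "cv.hermitian_form ?g"
    by (rule cv.hermitian_form_diff[OF cv.hermitian_form_pullback[OF mat_form_hermitian[OF hX] mat_fun_linear] a2])
  have x0: "mat_form X (\<beta>2 v) z = 0" if "v \<in> L" for v z
    using that cv.form_zero_left[OF mat_form_hermitian[OF hX]] by auto
  have "mat_fun A2 v = 0" if v: "v \<in> L" "a2 v v = 0" for v
  proof (rule mat_form_radical[OF A2])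
    fix w assume w: "w \<in> cspace m2"
    have "?g v w = 0"
      using cv.nonneg_null_orth[OF g coords_subspace[of "{..<m2}"], of v w] G v w x0[OF v(1)]
      by (auto simp: cv.nonneg_on_def)
    then show "a2 v w = 0" using x0[OF v(1)] by simp
  qed (use v in blast)
  moreover have "Re (a2 v v) \<le> 0" if v: "v \<in> L" for v
  proof -
    have "v \<in> cspace m2" using v by blast
    then show ?thesis using G[of v] x0[OF v] by simp
  qed
  ultimately show feasible unfolding feasible_def by blast
qed

text \<open>Feasibility lets \<open>orth_complement\<close> write the space as \<open>L\<close> plus
  its orthogonal complement. Hence each \<open>y\<close> in \<open>V\<close> has a preimage
  orthogonal to \<open>L\<close> for \<open>a2\<close>; this lift carries the Schur
  complement.\<close>

lemma feasible_section:
  assumes feasible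
  obtains \<delta> where "cv.lin \<delta>" "\<forall>y. \<delta> y \<in> cv.orth a2 L (cspace m2)" "\<forall>y\<in>V. \<beta>2 (\<delta> y) = y"
proof -
  let ?O = "cv.orth a2 L (cspace m2)"
  have sO: "cv.subspace ?O" by (rule cv.subspace_orth[OF a2 coords_subspace])
  have LO: "cv.subspace_sum L ?O = cspace m2"
  proof (rule cv.orth_complement[OF a2 coords_subspace L(1,3,2)])
    show "a2 x w = 0" if "x \<in> L" "a2 x x = 0" for x w
      using feasibleD(2)[OF assms that] by (rule mat_form_eq_0)
  qed
  obtain \<delta> where \<delta>: "cv.lin \<delta>" "\<And>x. \<delta> x \<in> ?O" "\<And>y. y \<in> \<beta>2 ` ?O \<Longrightarrow> \<beta>2 (\<delta> y) = y"
    using cv.linear_section[OF mat_fun_linear[of "mat_adjoint B2"] sO] by blast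
  have "V \<subseteq> \<beta>2 ` ?O"
  proof
    fix y assume "y \<in> V"
    then obtain v where v: "y = \<beta>2 v" "v \<in> cspace m2" by blast
    have "v \<in> cv.subspace_sum L ?O" using LO v(2) by simp
    then obtain l x where "v = l + x" "l \<in> L" "x \<in> ?O" by (rule cv.subspace_sumE)
    then have "\<beta>2 v = \<beta>2 x" by (simp add: \<beta>2.add)
    then show "y \<in> \<beta>2 ` ?O" using v(1) \<open>x \<in> ?O\<close> by blast
  qed
  then show thesis using that[of \<delta>] \<delta> by blast
qed

end

section \<open>The Schur complement and the translation into ranks and inertias\<close>

locale feasible_lmi = lmi +
  fixes \<delta> :: "(nat \<Rightarrow> complex) \<Rightarrow> nat \<Rightarrow> complex"
  assumes feasible: feasible
    and \<delta>_lin: "cv.lin \<delta>" and \<delta>_orth: "\<forall>y. \<delta> y \<in> cv.orth a2 L (cspace m2)" and \<delta>_sec: "\<forall>y\<in>V. \<beta>2 (\<delta> y) = y"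
begin

sublocale \<delta>: Vector_Spaces.linear vscale vscale \<delta> by (rule \<delta>_lin)

text \<open>A Schur complement: the constraint on \<open>X\<close> says exactly that its form dominates \<open>s\<close> on \<open>V\<close>.\<close>

definition s :: "(nat \<Rightarrow> complex) \<Rightarrow> (nat \<Rightarrow> complex) \<Rightarrow> complex" where
  "s y z = a2 (\<delta> y) (\<delta> z)"

lemma s: "cv.hermitian_form s"
  unfolding s_def[abs_def] by (rule cv.hermitian_form_pullback[OF a2 \<delta>_lin])

sublocale bfc: bounded_form_completion vscale a1 s "inner n" \<beta>1 "cspace m1" V "cspace n"
  by unfold_locales
    (use a1 s inner_hermitian mat_fun_linear coords_subspace cspace_fin V inner_pos \<beta>1_coords in
      \<open>auto simp: Vector_Spaces.linear_iff cv.vector_space_axioms\<close>)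

lemma \<delta>_coords: "\<delta> y \<in> cspace m2"
  using \<delta>_orth cv.orth_subset by blast

lemma \<delta>_L: "l \<in> L \<Longrightarrow> a2 (\<delta> y) l = 0"
  using \<delta>_orth unfolding cv.orth_def by blast

text \<open>Completing the square: \<open>v\<close> is the lift of \<open>\<beta>2 v\<close> plus a
  vector of \<open>L\<close>, and \<open>a2\<close> has no cross terms between lifts and
  \<open>L\<close>.\<close>

lemma a2_split:
  assumes v: "v \<in> cspace m2" "v - \<delta> (\<beta>2 v) = l" and w: "w \<in> cspace m2" "w - \<delta> (\<beta>2 w) = k"
  shows "l \<in> L" "a2 v w = s (\<beta>2 v) (\<beta>2 w) + a2 l k"
proof -
  have mem: "x - \<delta> (\<beta>2 x) \<in> L" if "x \<in> cspace m2" for x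
    using cv.subspace_diff[OF coords_subspace that \<delta>_coords] \<delta>_sec that by (simp add: \<beta>2.diff)
  show "l \<in> L" using mem v by blast
  have k: "k \<in> L" using mem w by blast
  have "v = \<delta> (\<beta>2 v) + l" "w = \<delta> (\<beta>2 w) + k" using v w by auto
  then have "a2 v w = a2 (\<delta> (\<beta>2 v) + l) (\<delta> (\<beta>2 w) + k)" by simp
  also have "\<dots> = s (\<beta>2 v) (\<beta>2 w) + a2 (\<delta> (\<beta>2 v)) k + (a2 l (\<delta> (\<beta>2 w)) + a2 l k)"
    by (simp only: cv.form_add_left[OF a2] cv.form_add_right[OF a2] s_def add_ac)
  also have "\<dots> = s (\<beta>2 v) (\<beta>2 w) + a2 l k"
    using \<delta>_L[OF k] cv.form_sym_zero[OF a2 \<delta>_L[OF \<open>l \<in> L\<close>]] by simp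
  finally show "a2 v w = s (\<beta>2 v) (\<beta>2 w) + a2 l k" .
qed

text \<open>Since \<open>a2\<close> is nonpositive on \<open>L\<close>, the lift
  \<open>\<delta> y\<close> has the largest value of \<open>a2\<close> among all preimages of
  \<open>y\<close>, namely \<open>s y y\<close>; the constraint need only be tested there.\<close>

lemma T1_iff:
  assumes X: "X \<in> hermitian_mats n"
  shows "X \<in> T1 \<longleftrightarrow> bfc.admissible (mat_form X)"
proof -
  have "(\<forall>v\<in>cspace m2. Re (a2 v v) \<le> Re (mat_form X (\<beta>2 v) (\<beta>2 v))) \<longleftrightarrow>
      (\<forall>y\<in>V. Re (s y y) \<le> Re (mat_form X y y))" (is "?A \<longleftrightarrow> ?B")
  proof
    assume A: ?A
    show ?B
    proof
      fix y assume "y \<in> V"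
      then have "\<beta>2 (\<delta> y) = y" using \<delta>_sec by blast
      then show "Re (s y y) \<le> Re (mat_form X y y)" using A \<delta>_coords[of y] by (auto simp: s_def)
    qed
  next
    assume B: ?B
    show ?A
    proof
      fix v assume v: "v \<in> cspace m2"
      have "Re (a2 v v) \<le> Re (s (\<beta>2 v) (\<beta>2 v))"
        using a2_split[OF v refl v refl] feasibleD(1)[OF feasible] by simp
      also have "\<dots> \<le> Re (mat_form X (\<beta>2 v) (\<beta>2 v))" using B v by blast
      finally show "Re (a2 v v) \<le> Re (mat_form X (\<beta>2 v) (\<beta>2 v))" .
    qed
  qed
  then show ?thesis
    using X loewner_iff[OF X] mat_form_hermitian[OF X] unfolding bfc.admissible_def by blast
qed

lemma F_index:
  assumes X: "X \<in> hermitian_mats n"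
  shows "pos_inertia (F X) = cv.pos_index (bfc.F (mat_form X)) (cspace m1)"
    "neg_inertia (F X) = cv.neg_index (bfc.F (mat_form X)) (cspace m1)"
  unfolding inertia_eq_index[OF F_hermitian[OF X]] F_form[OF X, abs_def] by simp_all

lemma admissible_matrix:
  assumes x: "bfc.admissible x"
  obtains X where "X \<in> T1" "pos_inertia (F X) = cv.pos_index (bfc.F x) (cspace m1)"
    "neg_inertia (F X) = cv.neg_index (bfc.F x) (cspace m1)"
proof -
  obtain X where X: "X \<in> hermitian_mats n" "\<And>f g. f \<in> cspace n \<Longrightarrow> g \<in> cspace n \<Longrightarrow> mat_form X f g = x f g"
    using matrix_of_form[of x n] x unfolding bfc.admissible_def by blast
  have "bfc.admissible (mat_form X)"
    using x mat_form_hermitian[OF X(1)] X(2) V(2) unfolding bfc.admissible_def by (metis subsetD)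
  then have "X \<in> T1" using T1_iff[OF X(1)] by blast
  moreover have "cv.pos_index (bfc.F (mat_form X)) (cspace m1) = cv.pos_index (bfc.F x) (cspace m1)"
    by (rule cv.pos_index_cong) (simp add: X(2) \<beta>1_coords)
  moreover have "cv.neg_index (bfc.F (mat_form X)) (cspace m1) = cv.neg_index (bfc.F x) (cspace m1)"
    by (rule cv.pos_index_cong) (simp add: X(2) \<beta>1_coords)
  ultimately show thesis using that F_index[OF X(1)] by simp
qed

abbreviation "W' \<equiv> left_kernel (B1 @\<^sub>r B2)"
abbreviation "D \<equiv> four_block_mat A1 (0\<^sub>m m1 m2) (0\<^sub>m m2 m1) (- A2)"

lemma mat_adjoint_zero: "mat_adjoint (0\<^sub>m p q :: complex mat) = 0\<^sub>m q p"
  by (rule eq_matI) auto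

lemma D_hermitian: "D \<in> hermitian_mats (m1 + m2)"
  using hermitian_four_block[OF A1 zero_carrier_mat[of m1 m2] uminus_hermitian[OF A2]]
  unfolding mat_adjoint_zero .

lemma D_form: "mat_form D w w' = a1 (head m1 w) (head m1 w') - a2 (tail m1 w) (tail m1 w')"
proof -
  have mA2: "- A2 \<in> carrier_mat m2 m2" using A2d by simp
  have "mat_form D w w' = inner (m1 + m2) (mat_fun D w) w'"
    unfolding mat_form_def hermitian_matsD(3)[OF D_hermitian] ..
  also have "\<dots> = inner m1 (mat_fun A1 (head m1 w)) (head m1 w') + inner m2 (- mat_fun A2 (tail m1 w)) (tail m1 w')"
    unfolding inner_split mat_fun_four_block[OF A1d(1) zero_carrier_mat zero_carrier_mat mA2] mat_fun_zero mat_fun_uminus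
    by (simp only: add_0_left add_0_right)
  finally show ?thesis by (simp add: cv.form_minus_left[OF inner_hermitian] mat_form_def A1d A2d)
qed

lemma W'_iff: "w \<in> W' \<longleftrightarrow> w \<in> cspace (m1 + m2) \<and> \<beta>1 (head m1 w) + \<beta>2 (tail m1 w) = 0"
  unfolding left_kernel_append_rows[OF B1 B2] by simp

lemma rank_B: "mat_rank (B1 @\<^sub>r B2) + cv.dim W' = m1 + m2"
  using mat_rank_left_kernel[of "B1 @\<^sub>r B2"] B1 B2 by simp

text \<open>\<open>M\<close> is \<open>D\<close> bordered by \<open>[B1; B2]\<close>, and
  \<open>W'\<close> is the kernel of the adjoint of the border.\<close>

lemma inertia_M:
  "pos_inertia M + cv.dim W' = m1 + m2 + cv.pos_index (mat_form D) W'"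
  "neg_inertia M + cv.dim W' = m1 + m2 + cv.neg_index (mat_form D) W'"
proof -
  have B: "B1 @\<^sub>r B2 \<in> carrier_mat (m1 + m2) n" using B1 B2 by (rule carrier_append_rows)
  have "{u \<in> cspace (m1 + m2). mat_fun (mat_adjoint (B1 @\<^sub>r B2)) u = 0} = W'"
    unfolding left_kernel_def using B1 B2 by simp
  then show "pos_inertia M + cv.dim W' = m1 + m2 + cv.pos_index (mat_form D) W'"
    "neg_inertia M + cv.dim W' = m1 + m2 + cv.neg_index (mat_form D) W'"
    using bordered_inertia[OF D_hermitian B] unfolding mat_adjoint_append_rows[OF B1 B2] by simp_all
qed

text \<open>A pair \<open>(u, v)\<close> in \<open>W'\<close> splits as
  \<open>(u, - \<delta> (\<beta>1 u))\<close> plus \<open>(0, l)\<close> with \<open>l\<close> in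
  \<open>L\<close>. The parts are orthogonal for \<open>D\<close>, whose values are those of
  \<open>F s\<close> on the first and of \<open>- a2\<close> on the second. By feasibility the
  second contributes \<open>dim L - dim L0\<close> positive directions and no negative ones.\<close>

lemma W'_index:
  "cv.dim W' = cv.dim bfc.W0 + cv.dim L"
  "cv.pos_index (mat_form D) W' + cv.dim L0 = cv.pos_index (bfc.F s) bfc.W0 + cv.dim L"
  "cv.neg_index (mat_form D) W' = cv.neg_index (bfc.F s) bfc.W0"
proof -
  define e where "e u = u - shift m1 (\<delta> (\<beta>1 u))" for u
  have e: "cv.lin e"
  proof (rule cv.linearI')
    show "e (x + y) = e x + e y" for x y
      unfolding e_def \<beta>1.add \<delta>.add shift.add by (simp only: add_diff_add)
    show "e (vscale c x) = vscale c (e x)" for c x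
      unfolding e_def \<beta>1.scale \<delta>.scale shift.scale by (simp only: cv.scale_right_diff_distrib)
  qed
  interpret e: Vector_Spaces.linear vscale vscale e by (rule e)
  have he: "head m1 (e u) = u" and te: "tail m1 (e u) = - \<delta> (\<beta>1 u)" if "u \<in> cspace m1" for u
    using that by (simp_all only: e_def head.diff tail.diff head_shift tail_shift head_id tail_0 diff_0 diff_0_right)
  let ?W0 = bfc.W0
  have e0: "u = 0" if "u \<in> ?W0" "e u = 0" for u
    using he[of u] that head.zero[of m1] by auto
  have s0: "l = 0" if "shift m1 l = 0" for l using that tail_shift[of m1 l] tail.zero[of m1] by simp
  have sE: "cv.subspace (e ` ?W0)" "cv.fin_dim (e ` ?W0)"
    using e.subspace_image[OF bfc.W0_subspace] cv.fin_dim_image[OF e bfc.W0_fin] .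
  have sS: "cv.subspace (shift m1 ` L)" "cv.fin_dim (shift m1 ` L)"
    using shift.subspace_image[OF L(1)] cv.fin_dim_image[OF shift_lin L(3)] .
  have int: "e ` ?W0 \<inter> shift m1 ` L = {0}"
  proof -
    have "x = 0" if x: "x \<in> e ` ?W0" "x \<in> shift m1 ` L" for x
    proof -
      obtain u l where "x = e u" "u \<in> ?W0" "x = shift m1 l" using x by blast
      then have "u = 0" using he[of u] head_shift[of m1 l] by auto
      then show ?thesis using \<open>x = e u\<close> e.zero by simp
    qed
    then show ?thesis using cv.subspace_0[OF sE(1)] cv.subspace_0[OF sS(1)] by blast
  qed
  have sum: "cv.subspace_sum (e ` ?W0) (shift m1 ` L) = W'"
  proof
    have "e ` ?W0 \<subseteq> W'"
    proof
      fix x assume "x \<in> e ` ?W0"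
      then obtain u where u: "x = e u" "u \<in> cspace m1" "\<beta>1 u \<in> V" by blast
      have "u \<in> cspace (m1 + m2)" using u(2) cspace_mono[of m1 "m1 + m2"] by auto
      then have "x \<in> cspace (m1 + m2)"
        unfolding u(1) e_def using shift_coords[OF \<delta>_coords] by (rule cv.subspace_diff[OF coords_subspace])
      moreover have "\<beta>1 (head m1 x) + \<beta>2 (tail m1 x) = 0"
        unfolding u(1) he[OF u(2)] te[OF u(2)] \<beta>2.neg bspec[OF \<delta>_sec u(3)] by (rule right_minus)
      ultimately show "x \<in> W'" unfolding W'_iff by blast
    qed
    moreover have "shift m1 ` L \<subseteq> W'"
    proof
      fix x assume "x \<in> shift m1 ` L"
      then obtain l where l: "x = shift m1 l" "l \<in> L" by blast
      have "\<beta>1 (head m1 x) + \<beta>2 (tail m1 x) = 0"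
        unfolding l(1) head_shift tail_shift \<beta>1.zero using l(2) by simp
      then show "x \<in> W'" unfolding W'_iff using shift_coords[of l m2 m1] l by blast
    qed
    ultimately show "cv.subspace_sum (e ` ?W0) (shift m1 ` L) \<subseteq> W'"
      by (rule cv.subspace_sum_subset[OF left_kernel_subspace])
    show "W' \<subseteq> cv.subspace_sum (e ` ?W0) (shift m1 ` L)"
    proof
      fix w assume "w \<in> W'"
      then have w: "w \<in> cspace (m1 + m2)" "\<beta>1 (head m1 w) + \<beta>2 (tail m1 w) = 0" unfolding W'_iff by auto
      let ?u = "head m1 w" and ?v = "tail m1 w"
      have v: "?v \<in> cspace m2" using tail_coords[OF w(1)] .
      have "\<beta>1 ?u = \<beta>2 (- ?v)" using w(2) by (simp only: \<beta>2.neg eq_neg_iff_add_eq_0)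
      moreover have "- ?v \<in> cspace m2" using cv.subspace_neg[OF coords_subspace v] .
      ultimately have uV: "\<beta>1 ?u \<in> V" by blast
      then have u: "?u \<in> ?W0" using head_coords by blast
      have l: "?v + \<delta> (\<beta>1 ?u) \<in> L"
      proof -
        have "\<beta>2 (?v + \<delta> (\<beta>1 ?u)) = 0" 
          unfolding \<beta>2.add bspec[OF \<delta>_sec uV] using w(2) by (simp only: add.commute)
        then show ?thesis using cv.subspace_add[OF coords_subspace v \<delta>_coords] by blast
      qed
      have "w = ?u + shift m1 ?v" using head_tail[of m1 w] by simp
      also have "\<dots> = e ?u + shift m1 (?v + \<delta> (\<beta>1 ?u))"
        unfolding e_def shift.add by (simp add: fun_eq_iff)
      finally have "\<exists>a\<in>?W0. \<exists>b\<in>L. w = e a + shift m1 b" using u l by blast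
      then obtain a b where ab: "w = e a + shift m1 b" "a \<in> ?W0" "b \<in> L" by blast
      show "w \<in> cv.subspace_sum (e ` ?W0) (shift m1 ` L)"
        unfolding ab(1) by (rule cv.subspace_sumI[OF imageI[OF ab(2)] imageI[OF ab(3)]])
    qed
  qed
  have fW: "cv.fin_dim W'"
    by (rule cv.fin_dim_subset[OF cspace_fin[of "m1 + m2"]]) (use W'_iff in blast)
  have h: "cv.hermitian_form (mat_form D)" using mat_form_hermitian[OF D_hermitian] .
  have orth: "mat_form D x y = 0" if "x \<in> e ` ?W0" "y \<in> shift m1 ` L" for x y
  proof -
    obtain u l where x: "x = e u" "u \<in> cspace m1" and y: "y = shift m1 l" "l \<in> L"
      using \<open>x \<in> e ` ?W0\<close> \<open>y \<in> shift m1 ` L\<close> by blast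
    show ?thesis
      unfolding D_form x(1) y(1) he[OF x(2)] te[OF x(2)] head_shift tail_shift
      using \<delta>_L[OF y(2)] by (simp add: cv.form_zero_right[OF a1] cv.form_minus_left[OF a2])
  qed
  have d1: "cv.dim (e ` ?W0) = cv.dim ?W0" by (rule cv.dim_image_inj[OF e bfc.W0_subspace e0])
  have d2: "cv.dim (shift m1 ` L) = cv.dim L" by (rule cv.dim_image_inj[OF shift_lin L(1) s0])
  show "cv.dim W' = cv.dim ?W0 + cv.dim L"
    using cv.dim_subspace_sum[OF sE(1) sS(1) sE(2) sS(2)] int d1 d2 unfolding sum by simp
  have v1: "mat_form D (e u) (e u) = bfc.F s u u" if "u \<in> ?W0" for u
  proof -
    have u: "u \<in> cspace m1" using that by blast
    show ?thesis unfolding D_form he[OF u] te[OF u] s_def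
      by (simp add: cv.form_minus_left[OF a2] cv.form_minus_right[OF a2])
  qed
  have v2: "mat_form D (shift m1 l) (shift m1 l) = - a2 l l" for l
    unfolding D_form head_shift tail_shift by (simp add: cv.form_zero_left[OF a1])
  have i1: "cv.pos_index g (e ` ?W0) = cv.pos_index (\<lambda>x y. g (e x) (e y)) ?W0" for g
    by (rule cv.pos_index_image[OF e bfc.W0_subspace bfc.W0_fin e0])
  have i2: "cv.pos_index g (shift m1 ` L) = cv.pos_index (\<lambda>x y. g (shift m1 x) (shift m1 y)) L" for g
    by (rule cv.pos_index_image[OF shift_lin L(1,3) s0])
  have "cv.pos_index (mat_form D) W' = cv.pos_index (mat_form D) (e ` ?W0) + cv.pos_index (mat_form D) (shift m1 ` L)"
    using cv.pos_index_orth_sum[OF h sE sS int orth] fW unfolding sum by simp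
  also have "cv.pos_index (mat_form D) (e ` ?W0) = cv.pos_index (bfc.F s) ?W0"
    by (rule trans[OF i1 cv.pos_index_cong]) (simp only: v1)
  also have "cv.pos_index (mat_form D) (shift m1 ` L) = cv.neg_index a2 L"
    by (rule trans[OF i2 cv.pos_index_cong]) (simp only: v2)
  finally show "cv.pos_index (mat_form D) W' + cv.dim L0 = cv.pos_index (bfc.F s) ?W0 + cv.dim L"
    using feasible_neg_index(1)[OF feasible] by linarith
  have orth': "- mat_form D x y = 0" if "x \<in> e ` ?W0" "y \<in> shift m1 ` L" for x y
    using orth[OF that] by simp
  have "cv.neg_index (mat_form D) W' = cv.neg_index (mat_form D) (e ` ?W0) + cv.neg_index (mat_form D) (shift m1 ` L)"
    using cv.pos_index_orth_sum[OF cv.hermitian_form_uminus[OF h] sE sS int orth'] fW unfolding sum by simp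
  also have "cv.neg_index (mat_form D) (e ` ?W0) = cv.neg_index (bfc.F s) ?W0"
    by (rule trans[OF i1 cv.pos_index_cong]) (simp only: v1)
  also have "cv.neg_index (mat_form D) (shift m1 ` L) = cv.pos_index a2 L"
    by (rule trans[OF i2 cv.pos_index_cong]) (simp only: v2 minus_minus)
  finally show "cv.neg_index (mat_form D) W' = cv.neg_index (bfc.F s) ?W0"
    using feasible_neg_index(2)[OF feasible] by linarith
qed

lemma k1_eq: "left_kernel (A1 @\<^sub>c B1) = K \<inter> cv.radical a1 (cspace m1)"
  unfolding left_kernel_append_cols[OF A1d(1) B1] left_kernel_B1 left_kernel_hermitian[OF A1] by blast

lemma rank_A1B1: "mat_rank (A1 @\<^sub>c B1) + bfc.k1 = m1"
  using mat_rank_left_kernel[of "A1 @\<^sub>c B1"] unfolding k1_eq using A1d by simp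

lemma neg_inertia_M1: "neg_inertia M1 + cv.dim K = m1 + cv.neg_index a1 K"
  using bordered_inertia(2)[OF A1 B1] .

lemma left_kernel_N:
  "left_kernel N = {w \<in> cspace (m1 + n). head m1 w \<in> K \<and>
     mat_fun A1 (head m1 w) + mat_fun B1 (tail m1 w) = 0 \<and> mat_fun B2 (tail m1 w) = 0}"
proof -
  have c: "0\<^sub>m n n \<in> carrier_mat n n" "(0\<^sub>m m1 m2 :: complex mat) \<in> carrier_mat m1 m2" by auto
  have top: "B1 @\<^sub>c 0\<^sub>m m1 m2 \<in> carrier_mat m1 (n + m2)" using B1 c(2) by (rule append_cols_carrier)
  have bot: "0\<^sub>m n n @\<^sub>c mat_adjoint B2 \<in> carrier_mat n (n + m2)" using c(1) B2' by (rule append_cols_carrier)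
  have T: "A1 @\<^sub>c B1 @\<^sub>c 0\<^sub>m m1 m2 \<in> carrier_mat m1 (m1 + (n + m2))"
    using A1d(1) top by (rule append_cols_carrier)
  have B: "mat_adjoint B1 @\<^sub>c 0\<^sub>m n n @\<^sub>c mat_adjoint B2 \<in> carrier_mat n (m1 + (n + m2))"
    using B1' bot by (rule append_cols_carrier)
  \<comment> \<open>The adjoints of the last two blocks in each block row of
    \<open>N\<close>.\<close>
  let ?P = "mat_adjoint B1 @\<^sub>r 0\<^sub>m m2 m1" and ?Q = "0\<^sub>m n n @\<^sub>r B2"
  have P: "?P \<in> carrier_mat (n + m2) m1" and Q: "?Q \<in> carrier_mat (n + m2) n" using B1' B2 by auto
  have adjT: "mat_adjoint (A1 @\<^sub>c B1 @\<^sub>c 0\<^sub>m m1 m2) = A1 @\<^sub>r ?P"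
    unfolding mat_adjoint_append_cols[OF A1d(1) top] mat_adjoint_append_cols[OF B1 c(2)] A1d(2) mat_adjoint_zero ..
  have adjB: "mat_adjoint (mat_adjoint B1 @\<^sub>c 0\<^sub>m n n @\<^sub>c mat_adjoint B2) = B1 @\<^sub>r ?Q"
    unfolding mat_adjoint_append_cols[OF B1' bot] mat_adjoint_append_cols[OF c(1) B2'] mat_adjoint_zero
      mat_adjoint_adjoint ..
  have eq: "mat_fun (A1 @\<^sub>r ?P) u + mat_fun (B1 @\<^sub>r ?Q) y = 0 \<longleftrightarrow>
      mat_fun A1 u + mat_fun B1 y = 0 \<and> \<beta>1 u = 0 \<and> mat_fun B2 y = 0" for u y
  proof -
    let ?w = "mat_fun (A1 @\<^sub>r ?P) u + mat_fun (B1 @\<^sub>r ?Q) y"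
    have h: "head m1 ?w = mat_fun A1 u + mat_fun B1 y"
      unfolding head.add mat_fun_append_rows[OF A1d(1) P] mat_fun_append_rows[OF B1 Q] ..
    have t: "tail m1 ?w = mat_fun ?P u + mat_fun ?Q y"
      unfolding tail.add mat_fun_append_rows[OF A1d(1) P] mat_fun_append_rows[OF B1 Q] ..
    have th: "head n (tail m1 ?w) = \<beta>1 u"
      unfolding t unfolding head.add mat_fun_append_rows[OF B1' zero_carrier_mat] mat_fun_append_rows[OF c(1) B2]
        mat_fun_zero by (rule add_0_right)
    have tt: "tail n (tail m1 ?w) = mat_fun B2 y"
      unfolding t unfolding tail.add mat_fun_append_rows[OF B1' zero_carrier_mat] mat_fun_append_rows[OF c(1) B2]
        mat_fun_zero by (rule add_0_left)
    show ?thesis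
    proof
      assume "?w = 0"
      then show "mat_fun A1 u + mat_fun B1 y = 0 \<and> \<beta>1 u = 0 \<and> mat_fun B2 y = 0"
        using h th tt by (simp only: head.zero tail.zero)
    next
      assume z: "mat_fun A1 u + mat_fun B1 y = 0 \<and> \<beta>1 u = 0 \<and> mat_fun B2 y = 0"
      have "tail m1 ?w = 0" by (rule head_tail_zero[of n]) (use th tt z in simp_all)
      moreover have "head m1 ?w = 0" using h z by simp
      ultimately show "?w = 0" by (rule head_tail_zero[rotated])
    qed
  qed
  show ?thesis
    unfolding left_kernel_append_rows[OF T B] adjT adjB eq using head_coords by blast
qed

text \<open>\<open>W0\<close> is the preimage of \<open>V\<close>, and the orthogonal complement of
  \<open>V\<close> is the kernel of \<open>B2\<close>; so the complement of \<open>W0\<close> should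
  be the image of that kernel under \<open>B1\<close>. The inclusion needed here is obtained from
  double orthogonal complements in both spaces.\<close>

lemma range_complement:
  assumes u: "u \<in> cspace m1" and o: "\<And>w. w \<in> bfc.W0 \<Longrightarrow> inner m1 u w = 0"
  shows "\<exists>y\<in>cspace n. mat_fun B2 y = 0 \<and> mat_fun B1 y = u"
proof -
  let ?Y = "cv.orth (inner n) V (cspace n)"
  have sY: "cv.subspace ?Y" by (rule cv.subspace_orth[OF inner_hermitian coords_subspace])
  interpret B1: Vector_Spaces.linear vscale vscale "mat_fun B1" by (rule mat_fun_linear)
  let ?S = "mat_fun B1 ` ?Y"
  have S: "cv.subspace ?S" "?S \<subseteq> cspace m1" using B1.subspace_image[OF sY] mat_fun_carrier[OF B1] by auto
  have "inner m1 u w = 0" if w: "w \<in> cv.orth (inner m1) ?S (cspace m1)" for w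
  proof -
    have wm: "w \<in> cspace m1" using w cv.orth_subset by blast
    have "inner n (\<beta>1 w) y = 0" if y: "y \<in> ?Y" for y
    proof -
      have "inner m1 w (mat_fun B1 y) = 0" using w y unfolding cv.orth_def by blast
      then show ?thesis using mat_fun_adjoint[OF B1', of w y] by (simp add: mat_adjoint_adjoint)
    qed
    then have "\<beta>1 w \<in> cv.orth (inner n) ?Y (cspace n)" using \<beta>1_coords unfolding cv.orth_def by blast
    then have "\<beta>1 w \<in> V" unfolding orth_orth[OF V] .
    then show ?thesis using o wm by blast
  qed
  then have "u \<in> cv.orth (inner m1) (cv.orth (inner m1) ?S (cspace m1)) (cspace m1)"
    using u unfolding cv.orth_def by blast
  then have "u \<in> ?S" unfolding orth_orth[OF S] .
  then obtain y where y: "y \<in> ?Y" "u = mat_fun B1 y" by blast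
  have "mat_fun B2 y = 0"
  proof (rule inner_eq_0_imp[OF mat_fun_carrier[OF B2]])
    fix v assume "v \<in> cspace m2"
    then show "inner m2 (mat_fun B2 y) v = 0" using y(1) unfolding mat_fun_adjoint[OF B2] cv.orth_def by blast
  qed
  then show ?thesis using y cv.orth_subset by blast
qed

text \<open>A vector \<open>u\<close> of \<open>K\<close> extends to the left kernel of
  \<open>N\<close> iff \<open>A1 u\<close> lies in the image of the kernel of \<open>B2\<close>
  under \<open>B1\<close>, that is, iff \<open>A1 u\<close> is orthogonal to \<open>W0\<close>. For
  \<open>u\<close> in \<open>K\<close> the form \<open>F s u\<close> is just
  \<open>a1 u\<close>.\<close>

lemma head_left_kernel_N: "head m1 ` left_kernel N = K \<inter> cv.radical (bfc.F s) bfc.W0"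
proof
  show "head m1 ` left_kernel N \<subseteq> K \<inter> cv.radical (bfc.F s) bfc.W0"
  proof
    fix u assume "u \<in> head m1 ` left_kernel N"
    then obtain y where u: "u \<in> K" "mat_fun A1 u + mat_fun B1 y = 0" "mat_fun B2 y = 0"
      unfolding left_kernel_N by blast
    have "bfc.F s u w = 0" if w: "w \<in> bfc.W0" for w
    proof -
      obtain v where v: "v \<in> cspace m2" "\<beta>1 w = \<beta>2 v" using w by blast
      have "mat_fun A1 u = - mat_fun B1 y" using u(2) by (simp only: eq_neg_iff_add_eq_0)
      then have "a1 u w = - inner m1 (mat_fun B1 y) w"
        by (simp only: mat_form_def A1d(3) cv.form_minus_left[OF inner_hermitian])
      also have "inner m1 (mat_fun B1 y) w = inner m2 (mat_fun B2 y) v"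
        unfolding mat_fun_adjoint[OF B1] v(2) mat_fun_adjoint[OF B2, symmetric] ..
      finally have "a1 u w = 0" unfolding u(3) cv.form_zero_left[OF inner_hermitian] by simp
      then show ?thesis using u(1) by (simp add: cv.form_zero_left[OF s])
    qed
    then show "u \<in> K \<inter> cv.radical (bfc.F s) bfc.W0"
      using u(1) bfc.K_W0 unfolding cv.orth_def by blast
  qed
  show "K \<inter> cv.radical (bfc.F s) bfc.W0 \<subseteq> head m1 ` left_kernel N"
  proof
    fix u assume u: "u \<in> K \<inter> cv.radical (bfc.F s) bfc.W0"
    have o: "inner m1 (mat_fun A1 u) w = 0" if w: "w \<in> bfc.W0" for w
    proof -
      have "bfc.F s u w = 0" using u w unfolding cv.orth_def by blast
      moreover have "\<beta>1 u = 0" using u by blast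
      ultimately show ?thesis by (simp add: cv.form_zero_left[OF s] mat_form_def A1d)
    qed
    obtain y where y: "y \<in> cspace n" "mat_fun B2 y = 0" "mat_fun B1 y = mat_fun A1 u"
      using range_complement[OF mat_fun_carrier[OF A1d(1)] o] by blast
    interpret B1: Vector_Spaces.linear vscale vscale "mat_fun B1" by (rule mat_fun_linear)
    interpret B2: Vector_Spaces.linear vscale vscale "mat_fun B2" by (rule mat_fun_linear)
    let ?w = "u + shift m1 (- y)"
    have um: "u \<in> cspace m1" using u by blast
    have uc: "u \<in> cspace (m1 + n)" using um cspace_mono[of m1 "m1 + n"] by auto
    have yc: "- y \<in> cspace n" by (rule cv.subspace_neg[OF coords_subspace y(1)])
    have h: "head m1 ?w = u" unfolding head.add head_shift head_id[OF um] by (rule add_0_right)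
    have t: "tail m1 ?w = - y" unfolding tail.add tail_shift tail_0[OF um] by (rule add_0_left)
    have "?w \<in> left_kernel N"
      unfolding left_kernel_N mem_Collect_eq h t B1.neg B2.neg y(2,3)
      using u cv.subspace_add[OF coords_subspace uc shift_coords[OF yc]] by auto
    then show "u \<in> head m1 ` left_kernel N" using h by (metis imageI)
  qed
qed

text \<open>Rank-nullity for \<open>head m1\<close> on the left kernel of \<open>N\<close>: the
  image has dimension \<open>k2\<close>, and the kernel is a copy of the common null space of
  \<open>B1\<close> and \<open>B2\<close>.\<close>

lemma rank_N: "mat_rank N + bfc.k2 = m1 + mat_rank (B1 @\<^sub>r B2)"
proof -
  let ?B = "B1 @\<^sub>r B2"
  let ?Y = "{y \<in> cspace n. mat_fun ?B y = 0}"
  have B: "dim_col ?B = n" using B1 by simp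
  have 1: "n = cv.dim ?Y + mat_rank ?B"
    using cv.rank_nullity[OF mat_fun_linear[of ?B] coords_subspace cspace_fin[of n]]
    unfolding mat_rank_eq_dim[of ?B] B dim_cspace .
  have sY: "cv.subspace ?Y" by (rule cv.subspace_kernel_on[OF mat_fun_linear coords_subspace])
  have "{w \<in> left_kernel N. head m1 w = 0} = shift m1 ` ?Y"
  proof
    show "{w \<in> left_kernel N. head m1 w = 0} \<subseteq> shift m1 ` ?Y"
    proof
      fix w assume w: "w \<in> {w \<in> left_kernel N. head m1 w = 0}"
      then have w': "w \<in> cspace (m1 + n)" "mat_fun B1 (tail m1 w) = 0" "mat_fun B2 (tail m1 w) = 0"
        "head m1 w = 0"
        unfolding left_kernel_N by auto
      have "tail m1 w \<in> ?Y"
        using mat_fun_append_rows_zero[OF B1 B2] w'(2,3) tail_coords[OF w'(1)] by blast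
      moreover have "w = shift m1 (tail m1 w)" using head_tail[of m1 w] w'(4) by simp
      ultimately show "w \<in> shift m1 ` ?Y" by blast
    qed
    show "shift m1 ` ?Y \<subseteq> {w \<in> left_kernel N. head m1 w = 0}"
    proof
      fix w assume "w \<in> shift m1 ` ?Y"
      then obtain y where y: "w = shift m1 y" "y \<in> cspace n" "mat_fun B1 y = 0" "mat_fun B2 y = 0"
        using mat_fun_append_rows_zero[OF B1 B2] by blast
      show "w \<in> {w \<in> left_kernel N. head m1 w = 0}"
        unfolding left_kernel_N mem_Collect_eq y(1) head_shift tail_shift y(3,4) mat_fun_0
        using shift_coords[OF y(2)] cv.subspace_0[OF K(1)] by simp
    qed
  qed
  moreover have "cv.dim (shift m1 ` ?Y) = cv.dim ?Y"
    by (rule cv.dim_image_inj[OF shift_lin sY]) (metis tail_shift tail.zero)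
  moreover have "cv.fin_dim (left_kernel N)"
    by (rule cv.fin_dim_subset[OF cspace_fin[of "m1 + n"]]) (auto simp: left_kernel_N)
  ultimately have "cv.dim (left_kernel N) = cv.dim ?Y + bfc.k2"
    using cv.rank_nullity[OF head_lin left_kernel_subspace, of N m1] unfolding head_left_kernel_N by simp
  moreover have "dim_row N = m1 + n" using A1d B1 by simp
  ultimately show ?thesis using mat_rank_left_kernel[of N] 1 by linarith
qed

text \<open>The bounds for forms, with \<open>k1\<close>, \<open>k2\<close> and the indices on
  \<open>K\<close> and \<open>W0\<close> replaced by ranks and inertias of the block
  matrices.\<close>

lemma
  assumes X: "X \<in> T1"
  shows neg_inertia_F_le: "neg_inertia (F X) \<le> neg_inertia M1"
    and pos_inertia_F_ge: "mat_rank (A1 @\<^sub>c B1) \<le> pos_inertia (F X) + neg_inertia M1"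
    and pos_inertia_F_le: "pos_inertia (F X) + mat_rank (A2 @\<^sub>c B2) \<le> pos_inertia M"
    and neg_inertia_F_ge: "mat_rank (A1 @\<^sub>c B1) + neg_inertia M \<le> neg_inertia (F X) + mat_rank N"
    and rank_F_le: "mat_rank (F X) \<le> mat_rank (A1 @\<^sub>c B1)"
proof -
  have hX: "X \<in> hermitian_mats n" using X by blast
  have x: "bfc.admissible (mat_form X)" using T1_iff[OF hX] X by blast
  have hx: "cv.hermitian_form (mat_form X)" using mat_form_hermitian[OF hX] .
  note i = F_index[OF hX]
  show "neg_inertia (F X) \<le> neg_inertia M1"
    using bfc.neg_index_upper[OF hx] neg_inertia_M1 i by (simp add: dim_cspace)
  show "mat_rank (A1 @\<^sub>c B1) \<le> pos_inertia (F X) + neg_inertia M1"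
    using bfc.pos_index_lower[OF hx] neg_inertia_M1 rank_A1B1 i by linarith
  show "pos_inertia (F X) + mat_rank (A2 @\<^sub>c B2) \<le> pos_inertia M"
    using bfc.pos_index_upper[OF x] inertia_M(1) W'_index(1,2) rank_A2B2 i(1) by (simp add: dim_cspace)
  show "mat_rank (A1 @\<^sub>c B1) + neg_inertia M \<le> neg_inertia (F X) + mat_rank N"
    using bfc.neg_index_ge[OF x] inertia_M(2) W'_index(3) rank_A1B1 rank_N rank_B i(2) by linarith
  have "mat_rank (F X) + cv.dim (cv.radical (bfc.F (mat_form X)) (cspace m1)) = m1"
    using cv.inertia_sum[OF bfc.F_hermitian[OF hx] coords_subspace cspace_fin]
      rank_inertia[OF F_hermitian[OF hX]] i by (simp add: dim_cspace)
  then show "mat_rank (F X) \<le> mat_rank (A1 @\<^sub>c B1)"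
    using bfc.radical_ge[OF hx] rank_A1B1 by linarith
qed

lemma neg_inertia_max: "\<exists>X\<in>T1. neg_inertia M1 \<le> neg_inertia (F X)"
proof -
  obtain x where x: "bfc.admissible x" "cv.dim (cspace m1) + cv.neg_index a1 K \<le> cv.neg_index (bfc.F x) (cspace m1) + cv.dim K"
    using bfc.neg_index_max_attained by blast
  obtain X where X: "X \<in> T1" "neg_inertia (F X) = cv.neg_index (bfc.F x) (cspace m1)"
    using admissible_matrix[OF x(1)] by blast
  have "neg_inertia M1 \<le> neg_inertia (F X)"
    using x(2) neg_inertia_M1 X(2) unfolding dim_cspace by linarith
  then show ?thesis using X(1) by blast
qed

lemma pos_inertia_max: "\<exists>X\<in>T1. pos_inertia M \<le> pos_inertia (F X) + mat_rank (A2 @\<^sub>c B2)"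
proof -
  obtain x where x: "bfc.admissible x"
    "cv.dim (cspace m1) + cv.pos_index (bfc.F s) bfc.W0 \<le> cv.pos_index (bfc.F x) (cspace m1) + cv.dim bfc.W0"
    using bfc.pos_index_max_attained by blast
  obtain X where X: "X \<in> T1" "pos_inertia (F X) = cv.pos_index (bfc.F x) (cspace m1)"
    using admissible_matrix[OF x(1)] by blast
  have "pos_inertia M \<le> pos_inertia (F X) + mat_rank (A2 @\<^sub>c B2)"
    using x(2) inertia_M(1) W'_index(1,2) rank_A2B2 X(2) unfolding dim_cspace by linarith
  then show ?thesis using X(1) by blast
qed

text \<open>A single \<open>X\<close> for both bounds, because the minimal rank is to be the sum of
  the two minima.\<close>

lemma inertia_min: "\<exists>X\<in>T1. neg_inertia (F X) + mat_rank N \<le> mat_rank (A1 @\<^sub>c B1) + neg_inertia M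
  \<and> pos_inertia (F X) + neg_inertia M1 \<le> mat_rank (A1 @\<^sub>c B1)"
proof -
  obtain x where x: "bfc.admissible x"
    "cv.neg_index (bfc.F x) (cspace m1) + bfc.k1 \<le> cv.neg_index (bfc.F s) bfc.W0 + bfc.k2"
    "cv.pos_index (bfc.F x) (cspace m1) + cv.neg_index a1 K + bfc.k1 \<le> cv.dim K"
    using bfc.min_attained by blast
  obtain X where X: "X \<in> T1" "pos_inertia (F X) = cv.pos_index (bfc.F x) (cspace m1)"
    "neg_inertia (F X) = cv.neg_index (bfc.F x) (cspace m1)"
    using admissible_matrix[OF x(1)] by blast
  have "neg_inertia (F X) + mat_rank N \<le> mat_rank (A1 @\<^sub>c B1) + neg_inertia M"
    using x(2) inertia_M(2) W'_index(3) rank_A1B1 rank_N rank_B X(3) by linarith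
  moreover have "pos_inertia (F X) + neg_inertia M1 \<le> mat_rank (A1 @\<^sub>c B1)"
    using x(3) neg_inertia_M1 rank_A1B1 X(2) by linarith
  ultimately show ?thesis using X(1) by blast
qed

text \<open>Under the range inclusion \<open>A1\<close> vanishes on \<open>K\<close>, so
  \<open>K\<close> lies in both radicals, \<open>k1 = k2 = dim K\<close>, and \<open>a1\<close> has
  negative index 0 on \<open>K\<close>.\<close>

lemma range_numbers:
  assumes R: "mat_range A1 \<subseteq> mat_range B1"
  shows "mat_rank (A1 @\<^sub>c B1) = mat_rank B1" "neg_inertia M1 = mat_rank B1"
    "mat_rank N = mat_rank B1 + mat_rank (B1 @\<^sub>r B2)"
proof -
  have A1K: "mat_fun A1 u = 0" if "u \<in> K" for u
    using that by (intro range_subset_kernel[OF A1 B1 R]) auto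
  have rB: "mat_rank B1 + cv.dim K = m1" using mat_rank_left_kernel[of B1] left_kernel_B1 B1 by simp
  have "K \<inter> cv.radical a1 (cspace m1) = K"
    using A1K mat_form_eq_0 unfolding cv.orth_def by blast
  then show "mat_rank (A1 @\<^sub>c B1) = mat_rank B1" using rank_A1B1 rB by simp
  have "cv.neg_index a1 K = 0"
    unfolding cv.pos_index_zero_iff[OF cv.hermitian_form_uminus[OF a1] K(1,3)]
    using A1K mat_form_eq_0 by simp
  then show "neg_inertia M1 = mat_rank B1" using neg_inertia_M1 rB by simp
  have "bfc.F s u w = 0" if u: "u \<in> K" for u w
    using mat_form_eq_0[OF A1K[OF u]] u by (simp add: cv.form_zero_left[OF s])
  then have "K \<inter> cv.radical (bfc.F s) bfc.W0 = K"
    using bfc.K_W0 unfolding cv.orth_def by blast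
  then show "mat_rank N = mat_rank B1 + mat_rank (B1 @\<^sub>r B2)" using rank_N rB by simp
qed

end

context lmi
begin

text \<open>For sufficiency any attained extremum will do, since its witness lies in
  \<open>T1\<close>.\<close>

lemma feasible_iff: "feasible \<longleftrightarrow> (\<exists>X\<in>hermitian_mats n. B2 * X * mat_adjoint B2 \<succeq>\<^sub>L A2)"
proof
  assume f: feasible
  obtain \<delta> where d: "cv.lin \<delta>" "\<forall>y. \<delta> y \<in> cv.orth a2 L (cspace m2)" "\<forall>y\<in>V. \<beta>2 (\<delta> y) = y"
    by (rule feasible_section[OF f])
  interpret feasible_lmi A1 A2 B1 B2 m1 m2 n \<delta>
    by (intro feasible_lmi.intro lmi_axioms feasible_lmi_axioms.intro f d)
  show "\<exists>X\<in>hermitian_mats n. B2 * X * mat_adjoint B2 \<succeq>\<^sub>L A2" using neg_inertia_max by blast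
qed (use feasible_necessary in blast)

lemma rank_A2B2_range:
  assumes "mat_range A2 \<subseteq> mat_range B2" shows "mat_rank (A2 @\<^sub>c B2) = mat_rank B2"
proof -
  have "L0 = L" using range_subset_kernel[OF A2 B2 assms] by blast
  then show ?thesis
    using rank_A2B2 mat_rank_left_kernel[of B2] left_kernel_B2 B2 by simp
qed

end

section \<open>Consequences of attained extrema\<close>

lemma has_max_on_attained_iff:
  "has_max_on f S a \<Longrightarrow> (\<And>x. x \<in> S \<Longrightarrow> f x \<le> k) \<Longrightarrow> (\<exists>x\<in>S. f x = k) \<longleftrightarrow> a = int k"
  unfolding has_max_on_def by (metis antisym of_nat_eq_iff of_nat_le_iff)

lemma has_min_on_zero_iff: "has_min_on f S b \<Longrightarrow> (\<exists>x\<in>S. f x = 0) \<longleftrightarrow> b = 0"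
  unfolding has_min_on_def by (metis antisym of_nat_0 of_nat_0_le_iff of_nat_eq_0_iff)

lemma has_max_on_zero_iff: "has_max_on f S a \<Longrightarrow> (\<forall>x\<in>S. f x = 0) \<longleftrightarrow> a = 0"
  unfolding has_max_on_def by (metis antisym of_nat_0 of_nat_0_le_iff of_nat_eq_0_iff)

lemma has_min_on_full_iff:
  "has_min_on f S b \<Longrightarrow> (\<And>x. x \<in> S \<Longrightarrow> f x \<le> k) \<Longrightarrow> (\<forall>x\<in>S. f x = k) \<longleftrightarrow> b = int k"
  unfolding has_min_on_def by (metis antisym of_nat_eq_iff of_nat_le_iff)

lemma constant_on_iff:
  "has_max_on f S a \<Longrightarrow> has_min_on f S b \<Longrightarrow> (\<exists>c. \<forall>x\<in>S. f x = c) \<longleftrightarrow> a = b"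
  unfolding has_max_on_def has_min_on_def by (metis antisym of_nat_eq_iff)

theorem theorem3p3:
  fixes A1 A2 B1 B2 M N M1 M2 :: "complex mat"
    and m1 m2 n :: nat
    and T1 :: "complex mat set"
    and F :: "complex mat \<Rightarrow> complex mat"
    and r ip im :: "complex mat \<Rightarrow> int"
  assumes A1: "A1 \<in> hermitian_mats m1" and A2: "A2 \<in> hermitian_mats m2"
    and B1: "B1 \<in> carrier_mat m1 n" and B2: "B2 \<in> carrier_mat m2 n"
    and M: "M = four_block_mat
                  (four_block_mat A1 (0\<^sub>m m1 m2) (0\<^sub>m m2 m1) (- A2)) (B1 @\<^sub>r B2)
                  (mat_adjoint B1 @\<^sub>c mat_adjoint B2)               (0\<^sub>m n n)"
    and N: "N = (A1 @\<^sub>c B1 @\<^sub>c 0\<^sub>m m1 m2) @\<^sub>r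
                (mat_adjoint B1 @\<^sub>c 0\<^sub>m n n @\<^sub>c mat_adjoint B2)"
    and M1: "M1 = four_block_mat A1 B1 (mat_adjoint B1) (0\<^sub>m n n)"
    and M2: "M2 = four_block_mat A2 B2 (mat_adjoint B2) (0\<^sub>m n n)"
    and T1: "T1 = {X \<in> hermitian_mats n. B2 * X * mat_adjoint B2 \<succeq>\<^sub>L A2}"
    and F: "F = (\<lambda>X. A1 - B1 * X * mat_adjoint B1)"
    and r: "r = (\<lambda>A. int (mat_rank A))"
    and ip: "ip = (\<lambda>A. int (pos_inertia A))"
    and im: "im = (\<lambda>A. int (neg_inertia A))"
  shows
    "((\<exists>X \<in> hermitian_mats n. B2 * X * mat_adjoint B2 \<succeq>\<^sub>L A2) \<longleftrightarrow> im M2 = r (A2 @\<^sub>c B2))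
   \<and> ((\<exists>X \<in> hermitian_mats n. B2 * X * mat_adjoint B2 \<succeq>\<^sub>L A2) \<longrightarrow>
      \<comment> \<open>extremal ranks and inertias\<close>
        has_max_on (\<lambda>X. mat_rank (F X)) T1 (r (A1 @\<^sub>c B1))
      \<and> has_min_on (\<lambda>X. mat_rank (F X)) T1 (2 * r (A1 @\<^sub>c B1) + im M - im M1 - r N)
      \<and> has_max_on (\<lambda>X. pos_inertia (F X)) T1 (ip M - r (A2 @\<^sub>c B2))
      \<and> has_min_on (\<lambda>X. pos_inertia (F X)) T1 (r (A1 @\<^sub>c B1) - im M1)
      \<and> has_max_on (\<lambda>X. neg_inertia (F X)) T1 (im M1)
      \<and> has_min_on (\<lambda>X. neg_inertia (F X)) T1 (r (A1 @\<^sub>c B1) - r N + im M)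
      \<comment> \<open>(a)\<close>
      \<and> ((\<exists>X\<in>T1. invertible_mat (F X)) \<longleftrightarrow> r (A1 @\<^sub>c B1) = int m1)
      \<comment> \<open>(b)\<close>
      \<and> ((\<forall>X\<in>T1. invertible_mat (F X)) \<longleftrightarrow>
           r (A1 @\<^sub>c B1) = int m1 \<and> im M = im M1 + r N - int m1)
      \<comment> \<open>(c)\<close>
      \<and> ((\<exists>X\<in>T1. B1 * X * mat_adjoint B1 = A1) \<longleftrightarrow>
           mat_range A1 \<subseteq> mat_range B1 \<and> im M = r (B1 @\<^sub>r B2))
      \<comment> \<open>(d)\<close>
      \<and> ((\<exists>X\<in>T1. B1 * X * mat_adjoint B1 \<prec>\<^sub>L A1) \<longleftrightarrow> ip M = r (A2 @\<^sub>c B2) + int m1)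
      \<comment> \<open>(e)\<close>
      \<and> ((\<exists>X\<in>T1. B1 * X * mat_adjoint B1 \<succ>\<^sub>L A1) \<longleftrightarrow> im M1 = int m1)
      \<comment> \<open>(f)\<close>
      \<and> ((\<exists>X\<in>T1. B1 * X * mat_adjoint B1 \<preceq>\<^sub>L A1) \<longleftrightarrow> im M = r N - r (A1 @\<^sub>c B1))
      \<comment> \<open>(g)\<close>
      \<and> ((\<exists>X\<in>T1. B1 * X * mat_adjoint B1 \<succeq>\<^sub>L A1) \<longleftrightarrow> im M1 = r (A1 @\<^sub>c B1))
      \<comment> \<open>(h)\<close>
      \<and> ((\<forall>X\<in>T1. B1 * X * mat_adjoint B1 \<succeq>\<^sub>L A1) \<longleftrightarrow>
           T1 \<subseteq> {X \<in> hermitian_mats n. B1 * X * mat_adjoint B1 \<succeq>\<^sub>L A1})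
      \<and> ((\<forall>X\<in>T1. B1 * X * mat_adjoint B1 \<succeq>\<^sub>L A1) \<longleftrightarrow> ip M = r (A2 @\<^sub>c B2))
      \<comment> \<open>(i)\<close>
      \<and> ((\<exists>c. \<forall>X\<in>T1. mat_rank (F X) = c) \<longleftrightarrow> im M = im M1 + r N - r (A1 @\<^sub>c B1))
      \<comment> \<open>(j)\<close>
      \<and> ((\<exists>c. \<forall>X\<in>T1. pos_inertia (F X) = c) \<longleftrightarrow>
           ip M + im M1 = r (A1 @\<^sub>c B1) + r (A2 @\<^sub>c B2))
      \<comment> \<open>(k)\<close>
      \<and> ((\<exists>c. \<forall>X\<in>T1. neg_inertia (F X) = c) \<longleftrightarrow> im M1 + r N = r (A1 @\<^sub>c B1) + im M)
      \<comment> \<open>(l)\<close>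
      \<and> ((\<exists>X1\<in>hermitian_mats n. \<exists>X2\<in>hermitian_mats n.
             B1 * X1 * mat_adjoint B1 = A1 \<and> B2 * X2 * mat_adjoint B2 = A2) \<longleftrightarrow>
           mat_range A1 \<subseteq> mat_range B1 \<and> mat_range A2 \<subseteq> mat_range B2)
      \<and> ((\<exists>X1\<in>hermitian_mats n. \<exists>X2\<in>hermitian_mats n.
             B1 * X1 * mat_adjoint B1 = A1 \<and> B2 * X2 * mat_adjoint B2 = A2) \<longrightarrow>
            has_max_on (\<lambda>X. mat_rank (F X)) T1 (r B1)
          \<and> has_min_on (\<lambda>X. mat_rank (F X)) T1 (im M - r (B1 @\<^sub>r B2))
          \<and> has_max_on (\<lambda>X. pos_inertia (F X)) T1 (ip M - r B2)
          \<and> has_min_on (\<lambda>X. pos_inertia (F X)) T1 0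
          \<and> has_max_on (\<lambda>X. neg_inertia (F X)) T1 (r B1)
          \<and> has_min_on (\<lambda>X. neg_inertia (F X)) T1 (im M - r (B1 @\<^sub>r B2))))"
proof -
  interpret lmi A1 A2 B1 B2 m1 m2 n by unfold_locales fact+
  let ?P = "\<exists>X\<in>hermitian_mats n. B2 * X * mat_adjoint B2 \<succeq>\<^sub>L A2"
  let ?r1 = "r (A1 @\<^sub>c B1)" and ?r2 = "r (A2 @\<^sub>c B2)"
  have first: "?P \<longleftrightarrow> im M2 = ?r2"
    unfolding feasible_iff[symmetric] feasible_iff_M2 im r M2 by simp
  show ?thesis
    apply (rule conjI[OF first])
    apply (rule impI)
    subgoal premises P
    proof -
      have f: feasible using P feasible_iff by blast
      obtain \<delta> where d: "cv.lin \<delta>" "\<forall>y. \<delta> y \<in> cv.orth (mat_form A2) L (cspace m2)"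
        "\<forall>y\<in>V. mat_fun (mat_adjoint B2) (\<delta> y) = y"
        by (rule feasible_section[OF f])
      interpret feasible_lmi A1 A2 B1 B2 m1 m2 n \<delta>
        by (intro feasible_lmi.intro lmi_axioms feasible_lmi_axioms.intro f d)
      have FX: "F X = A1 - B1 * X * mat_adjoint B1" for X using F by simp
      have FH: "F X \<in> hermitian_mats m1" if "X \<in> T1" for X
        using that F_hermitian unfolding T1 F by blast
      have rk: "mat_rank (F X) = pos_inertia (F X) + neg_inertia (F X)" if "X \<in> T1" for X
        by (rule rank_inertia[OF FH[OF that]])
      have neg_le: "int (neg_inertia (F X)) \<le> im M1" if "X \<in> T1" for X
        using neg_inertia_F_le that unfolding T1 FX im M1 by simp
      have pos_ge: "?r1 - im M1 \<le> int (pos_inertia (F X))" if "X \<in> T1" for X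
        using pos_inertia_F_ge[of X] that unfolding T1 FX im r M1 by simp
      have pos_le: "int (pos_inertia (F X)) \<le> ip M - ?r2" if "X \<in> T1" for X
        using pos_inertia_F_le[of X] that unfolding T1 FX ip r M by simp
      have neg_ge: "?r1 - r N + im M \<le> int (neg_inertia (F X))" if "X \<in> T1" for X
        using neg_inertia_F_ge[of X] that unfolding T1 FX im r M N by simp
      have rk_le: "int (mat_rank (F X)) \<le> ?r1" if "X \<in> T1" for X
        using rank_F_le[of X] that unfolding T1 FX r by simp
      obtain X1 where X1: "X1 \<in> T1" "im M1 \<le> int (neg_inertia (F X1))"
        using neg_inertia_max unfolding T1 FX im M1 by auto
      obtain X2 where X2: "X2 \<in> T1" "ip M - ?r2 \<le> int (pos_inertia (F X2))"
        using pos_inertia_max unfolding T1 FX ip r M by force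
      obtain X3 where X3: "X3 \<in> T1" "int (neg_inertia (F X3)) \<le> ?r1 - r N + im M"
        "int (pos_inertia (F X3)) \<le> ?r1 - im M1"
        using inertia_min unfolding T1 FX im r M M1 N by force
      \<comment> \<open>At \<open>X1\<close> the negative inertia is \<open>im M1\<close> and the
        positive one at least \<open>?r1 - im M1\<close>, so their sum reaches the upper
        bound.\<close>
      have max_rank: "has_max_on (\<lambda>X. mat_rank (F X)) T1 ?r1"
        unfolding has_max_on_def
        using rk_le rk[OF X1(1)] rk_le[OF X1(1)] pos_ge[OF X1(1)] X1 by (intro conjI bexI[of _ X1]) auto
      \<comment> \<open>The value is the sum of the two minimal inertias, both of which are taken at
        \<open>X3\<close>.\<close>
      have min_rank: "has_min_on (\<lambda>X. mat_rank (F X)) T1 (2 * ?r1 + im M - im M1 - r N)"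
        unfolding has_min_on_def
      proof (intro conjI bexI[of _ X3] ballI)
        show "int (mat_rank (F X3)) = 2 * ?r1 + im M - im M1 - r N"
          using rk[OF X3(1)] pos_ge[OF X3(1)] neg_ge[OF X3(1)] X3 by simp
        show "2 * ?r1 + im M - im M1 - r N \<le> int (mat_rank (F X))" if "X \<in> T1" for X
          using rk[OF that] pos_ge[OF that] neg_ge[OF that] by simp
      qed (rule X3)
      have max_pos: "has_max_on (\<lambda>X. pos_inertia (F X)) T1 (ip M - ?r2)"
        unfolding has_max_on_def using pos_le X2 by (meson antisym)
      have min_pos: "has_min_on (\<lambda>X. pos_inertia (F X)) T1 (?r1 - im M1)"
        unfolding has_min_on_def using pos_ge X3 by (meson antisym)
      have max_neg: "has_max_on (\<lambda>X. neg_inertia (F X)) T1 (im M1)"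
        unfolding has_max_on_def using neg_le X1 by (meson antisym)
      have min_neg: "has_min_on (\<lambda>X. neg_inertia (F X)) T1 (?r1 - r N + im M)"
        unfolding has_min_on_def using neg_ge X3 by (meson antisym)
      have rle: "mat_rank (F X) \<le> m1" if "X \<in> T1" for X
        using mat_rank_left_kernel[of "F X"] hermitian_matsD[OF FH[OF that]] by simp
      have ple: "pos_inertia (F X) \<le> m1" "neg_inertia (F X) \<le> m1" if "X \<in> T1" for X
        using rk[OF that] rle[OF that] by simp_all
      have inv: "invertible_mat (F X) \<longleftrightarrow> mat_rank (F X) = m1" if "X \<in> T1" for X
        by (rule invertible_iff_rank[OF hermitian_matsD(1)[OF FH[OF that]]])
      have carr: "B1 * X * mat_adjoint B1 \<in> carrier_mat m1 m1" if "X \<in> T1" for X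
        using that sandwich_carrier(1) unfolding T1 by blast
      have zero: "B1 * X * mat_adjoint B1 = A1 \<longleftrightarrow> mat_rank (F X) = 0" if "X \<in> T1" for X
      proof -
        have "mat_rank (F X) = 0 \<longleftrightarrow> A1 - B1 * X * mat_adjoint B1 = 0\<^sub>m m1 m1"
          using rank_zero_iff[OF FH[OF that]] unfolding FX .
        moreover have "A1 - A1 = 0\<^sub>m m1 m1" by (rule minus_r_inv_mat[OF A1d(1)])
        ultimately show ?thesis using diff_zero_mat_eq[OF A1d(1) carr[OF that]] by metis
      qed
      have lt: "B1 * X * mat_adjoint B1 \<prec>\<^sub>L A1 \<longleftrightarrow> pos_inertia (F X) = m1" if "X \<in> T1" for X
        using pos_def_inertia[OF FH[OF that]] unfolding loewner_gt_def FX .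
      have gt: "B1 * X * mat_adjoint B1 \<succ>\<^sub>L A1 \<longleftrightarrow> neg_inertia (F X) = m1" if "X \<in> T1" for X
        using pos_def_uminus_inertia[OF FH[OF that]]
        unfolding loewner_gt_def FX uminus_sandwich[OF A1d(1) carr[OF that]] .
      have le: "B1 * X * mat_adjoint B1 \<preceq>\<^sub>L A1 \<longleftrightarrow> neg_inertia (F X) = 0" if "X \<in> T1" for X
        using pos_semidef_inertia[OF FH[OF that]] unfolding loewner_ge_def FX .
      have ge: "B1 * X * mat_adjoint B1 \<succeq>\<^sub>L A1 \<longleftrightarrow> pos_inertia (F X) = 0" if "X \<in> T1" for X
        using pos_semidef_uminus_inertia[OF FH[OF that]]
        unfolding loewner_ge_def FX uminus_sandwich[OF A1d(1) carr[OF that]] .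
      have "mat_rank (A1 @\<^sub>c B1) \<le> m1" using rank_A1B1 by linarith
      then have r1le: "?r1 \<le> int m1" unfolding r of_nat_le_iff .
      have pa: "(\<exists>X\<in>T1. invertible_mat (F X)) \<longleftrightarrow> ?r1 = int m1"
        using has_max_on_attained_iff[OF max_rank rle] inv by simp
      \<comment> \<open>The minimal rank is at most \<open>?r1\<close>, which is at most
        \<open>m1\<close>. So it equals \<open>m1\<close> only if \<open>?r1 = m1\<close>, and then
        the formula for the minimum becomes the stated equation.\<close>
      have pb: "(\<forall>X\<in>T1. invertible_mat (F X)) \<longleftrightarrow> ?r1 = int m1 \<and> im M = im M1 + r N - int m1"
      proof -
        have "(\<forall>X\<in>T1. invertible_mat (F X)) \<longleftrightarrow> 2 * ?r1 + im M - im M1 - r N = int m1"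
          using has_min_on_full_iff[OF min_rank rle] inv by simp
        moreover have "2 * ?r1 + im M - im M1 - r N \<le> ?r1"
          using min_rank rk_le[OF X1(1)] X1(1) unfolding has_min_on_def by fastforce
        ultimately show ?thesis using r1le by auto
      qed
      have pc: "(\<exists>X\<in>T1. B1 * X * mat_adjoint B1 = A1) \<longleftrightarrow>
          mat_range A1 \<subseteq> mat_range B1 \<and> im M = r (B1 @\<^sub>r B2)"
      proof -
        have 1: "(\<exists>X\<in>T1. B1 * X * mat_adjoint B1 = A1) \<longleftrightarrow> 2 * ?r1 + im M - im M1 - r N = 0"
          using has_min_on_zero_iff[OF min_rank] zero by simp
        have 2: "(\<exists>X\<in>T1. B1 * X * mat_adjoint B1 = A1) \<Longrightarrow> mat_range A1 \<subseteq> mat_range B1"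
          using sandwich_solvable_iff[OF A1 B1] unfolding T1 by blast
        \<comment> \<open>A solution forces the range inclusion by fact 2, and under it
          \<open>range_numbers\<close> collapses the minimal rank; so the two conditions together
          say that this minimum is 0.\<close>
        have 3: "2 * ?r1 + im M - im M1 - r N = im M - r (B1 @\<^sub>r B2)" if "mat_range A1 \<subseteq> mat_range B1"
          using range_numbers[OF that] unfolding r im M1 N by simp
        show ?thesis using 1 2 3 by (metis right_minus_eq)
      qed
      have pd: "(\<exists>X\<in>T1. B1 * X * mat_adjoint B1 \<prec>\<^sub>L A1) \<longleftrightarrow> ip M = ?r2 + int m1"
        using has_max_on_attained_iff[OF max_pos ple(1)] lt by auto
      have pe: "(\<exists>X\<in>T1. B1 * X * mat_adjoint B1 \<succ>\<^sub>L A1) \<longleftrightarrow> im M1 = int m1"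
        using has_max_on_attained_iff[OF max_neg ple(2)] gt by simp
      have pf: "(\<exists>X\<in>T1. B1 * X * mat_adjoint B1 \<preceq>\<^sub>L A1) \<longleftrightarrow> im M = r N - ?r1"
        using has_min_on_zero_iff[OF min_neg] le by auto
      have pg: "(\<exists>X\<in>T1. B1 * X * mat_adjoint B1 \<succeq>\<^sub>L A1) \<longleftrightarrow> im M1 = ?r1"
        using has_min_on_zero_iff[OF min_pos] ge by auto
      have ph1: "(\<forall>X\<in>T1. B1 * X * mat_adjoint B1 \<succeq>\<^sub>L A1) \<longleftrightarrow>
          T1 \<subseteq> {X \<in> hermitian_mats n. B1 * X * mat_adjoint B1 \<succeq>\<^sub>L A1}"
        unfolding T1 by blast
      have ph2: "(\<forall>X\<in>T1. B1 * X * mat_adjoint B1 \<succeq>\<^sub>L A1) \<longleftrightarrow> ip M = ?r2"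
        using has_max_on_zero_iff[OF max_pos] ge by auto
      have pi: "(\<exists>c. \<forall>X\<in>T1. mat_rank (F X) = c) \<longleftrightarrow> im M = im M1 + r N - ?r1"
        unfolding constant_on_iff[OF max_rank min_rank] by auto
      have pj: "(\<exists>c. \<forall>X\<in>T1. pos_inertia (F X) = c) \<longleftrightarrow> ip M + im M1 = ?r1 + ?r2"
        unfolding constant_on_iff[OF max_pos min_pos] by auto
      have pk: "(\<exists>c. \<forall>X\<in>T1. neg_inertia (F X) = c) \<longleftrightarrow> im M1 + r N = ?r1 + im M"
        unfolding constant_on_iff[OF max_neg min_neg] by auto
      have pl1: "(\<exists>X1\<in>hermitian_mats n. \<exists>X2\<in>hermitian_mats n.
             B1 * X1 * mat_adjoint B1 = A1 \<and> B2 * X2 * mat_adjoint B2 = A2) \<longleftrightarrow>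
           mat_range A1 \<subseteq> mat_range B1 \<and> mat_range A2 \<subseteq> mat_range B2"
        using sandwich_solvable_iff[OF A1 B1] sandwich_solvable_iff[OF A2 B2] by blast
      have pl2: "(\<exists>X1\<in>hermitian_mats n. \<exists>X2\<in>hermitian_mats n.
             B1 * X1 * mat_adjoint B1 = A1 \<and> B2 * X2 * mat_adjoint B2 = A2) \<longrightarrow>
            has_max_on (\<lambda>X. mat_rank (F X)) T1 (r B1)
          \<and> has_min_on (\<lambda>X. mat_rank (F X)) T1 (im M - r (B1 @\<^sub>r B2))
          \<and> has_max_on (\<lambda>X. pos_inertia (F X)) T1 (ip M - r B2)
          \<and> has_min_on (\<lambda>X. pos_inertia (F X)) T1 0
          \<and> has_max_on (\<lambda>X. neg_inertia (F X)) T1 (r B1)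
          \<and> has_min_on (\<lambda>X. neg_inertia (F X)) T1 (im M - r (B1 @\<^sub>r B2))"
      proof
        assume "\<exists>X1\<in>hermitian_mats n. \<exists>X2\<in>hermitian_mats n.
             B1 * X1 * mat_adjoint B1 = A1 \<and> B2 * X2 * mat_adjoint B2 = A2"
        then have R: "mat_range A1 \<subseteq> mat_range B1" "mat_range A2 \<subseteq> mat_range B2"
          using pl1 by blast+
        have r1: "?r1 = r B1" and m: "im M1 = r B1" and rN: "r N = r B1 + r (B1 @\<^sub>r B2)"
          using range_numbers[OF R(1)] unfolding r im M1 N by simp_all
        have r2: "?r2 = r B2" unfolding r rank_A2B2_range[OF R(2)] ..
        have e: "2 * r B1 + im M - r B1 - (r B1 + r (B1 @\<^sub>r B2)) = im M - r (B1 @\<^sub>r B2)"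
          "r B1 - (r B1 + r (B1 @\<^sub>r B2)) + im M = im M - r (B1 @\<^sub>r B2)" "r B1 - r B1 = 0"
          by simp_all
        show "has_max_on (\<lambda>X. mat_rank (F X)) T1 (r B1)
          \<and> has_min_on (\<lambda>X. mat_rank (F X)) T1 (im M - r (B1 @\<^sub>r B2))
          \<and> has_max_on (\<lambda>X. pos_inertia (F X)) T1 (ip M - r B2)
          \<and> has_min_on (\<lambda>X. pos_inertia (F X)) T1 0
          \<and> has_max_on (\<lambda>X. neg_inertia (F X)) T1 (r B1)
          \<and> has_min_on (\<lambda>X. neg_inertia (F X)) T1 (im M - r (B1 @\<^sub>r B2))"
          using max_rank min_rank max_pos min_pos max_neg min_neg unfolding r1 r2 m rN e by (intro conjI)
      qed
      show ?thesis
        by (intro conjI max_rank min_rank max_pos min_pos max_neg min_neg pa pb pc pd pe pf pg ph1 ph2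
            pi pj pk pl1 pl2)
    qed
    done
qed

end
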